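(* For every $m\in\mathbb N$, the space $\mathbf W^{m}_2(\mathbb D_1^L,\mathbb D_2^L)$ coincides with the domain $\mathcal D(\Delta_L^{m/2})$, and the norm $$\|f\|_{\mathbf L^2(G,d\mu_l)}+\sum_{(j_1,\dots,j_m)\in\{1,2\}^m}\|\mathbb D^L_{j_1}\cdots\mathbb D^L_{j_m}f\|_{\mathbf L^2(G,d\mu_l)}$$ is equivalent to the graph norm $\|f\|_{\mathbf L^2(G,d\mu_l)}+\|\Delta_L^{m/2}f\|_{\mathbf L^2(G,d\mu_l)}$.
   Context: Identify the "$ax+b$" group $G$ with $(0,\infty)\times\mathbb R$ with multiplication $(a,b)(c,d)=(ac,\,ad+b)$ and left Haar measure $d\mu_l=a^{-2}\,da\,db$. The left regular representation on $\mathbf L^2(G,d\mu_l)$ is $U^L(a,b)f(x,y)=f(ax,ay+b)$ (unitary). Its one-parameter groups $U^L_1(t)f(x,y)=f(e^tx,e^ty)$ and $U^L_2(t)f(x,y)=f(x,y+t)$ have generators $\mathbb D^L_1$, $\mathbb D^L_2$, which on the Gårding space $\mathcal G^L$ (linear span of $\int_G\varphi(g)U^L(g)f\,d\mu_l(g)$, $\varphi\in C_0^\infty(G)$, $f\in\mathbf L^2(G,d\mu_l)$) act as $\mathbb D^L_1=x\partial_x+y\partial_y$, $\mathbb D^L_2=\partial_y$; we use their closures. $\Delta_L$ is the self-adjoint non-negative closure from $\mathcal G^L$ of $-(\mathbb D^L_1)^2-(\mathbb D^L_2)^2$. $\mathbf W^m_2(\mathbb D^L_1,\mathbb D^L_2)$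 is the set of $f\in\mathbf L^2(G,d\mu_l)$ such that all $\mathbb D^L_{j_1}\cdots\mathbb D^L_{j_k}f$, $1\le k\le m$, $j_i\in\{1,2\}$, are defined and the norm $\|f\|+\sum_{k=1}^m\sum_{(j_1,\dots,j_k)}\|\mathbb D^L_{j_1}\cdots\mathbb D^L_{j_k}f\|$ is finite. *)

theory Defs
  imports "HOL-Analysis.Analysis"
begin

type_synonym pt = "real \<times> real"
type_synonym fn = "pt \<Rightarrow> complex"
type_synonym oper = "(fn \<times> fn) set"
  \<comment> \<open>(possibly unbounded) operators on L^2 are represented by their graphs,
      saturated w.r.t. equality almost everywhere\<close>

text \<open>G = (0,oo) x R inside R^2; left Haar measure a^(-2) da db (zero outside G).\<close>
definition mu_l :: "pt measure" where
  "mu_l = density lborel (\<lambda>(a,b). if 0 < a then ennreal (1 / a\<^sup>2) else 0)"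

definition L2 :: "fn set" where
  "L2 = {f. f \<in> borel_measurable mu_l \<and> integrable mu_l (\<lambda>p. (cmod (f p))\<^sup>2)}"

definition nrm :: "fn \<Rightarrow> real" where
  "nrm f = sqrt (\<integral>p. (cmod (f p))\<^sup>2 \<partial>mu_l)"

definition inner_L2 :: "fn \<Rightarrow> fn \<Rightarrow> complex" where
  "inner_L2 f g = (\<integral>p. f p * cnj (g p) \<partial>mu_l)"

definition ae_eq :: "fn \<Rightarrow> fn \<Rightarrow> bool" where
  "ae_eq f g \<longleftrightarrow> (AE p in mu_l. f p = g p)"

definition idop :: oper where
  "idop = {(f,g). f \<in> L2 \<and> g \<in> L2 \<and> ae_eq f g}"

definition opcomp :: "oper \<Rightarrow> oper \<Rightarrow> oper" where
  "opcomp B A = {(f,h). \<exists>g. (f,g) \<in> A \<and> (g,h) \<in> B}"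

fun oppow :: "nat \<Rightarrow> oper \<Rightarrow> oper" where
  "oppow 0 A = idop"
| "oppow (Suc k) A = opcomp A (oppow k A)"

definition opdom :: "oper \<Rightarrow> fn set" where
  "opdom A = fst ` A"

definition opapp :: "oper \<Rightarrow> fn \<Rightarrow> fn" where
  "opapp A f = (SOME g. (f,g) \<in> A)"

definition adjoint :: "oper \<Rightarrow> oper" where
  "adjoint A = {(u,v). u \<in> L2 \<and> v \<in> L2 \<and>
      (\<forall>(f,g)\<in>A. inner_L2 g u = inner_L2 f v)}"

definition selfadjoint :: "oper \<Rightarrow> bool" where
  "selfadjoint A \<longleftrightarrow> A = adjoint A \<and>
     (\<forall>f g g'. (f,g) \<in> A \<longrightarrow> (f,g') \<in> A \<longrightarrow> ae_eq g g')"

definition nonneg :: "oper \<Rightarrow> bool" where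
  "nonneg A \<longleftrightarrow> (\<forall>(f,g)\<in>A. Im (inner_L2 g f) = 0 \<and> 0 \<le> Re (inner_L2 g f))"

definition opsqrt :: "oper \<Rightarrow> oper" where
  "opsqrt A = (THE S. selfadjoint S \<and> nonneg S \<and> opcomp S S = A)"

definition halfpow :: "nat \<Rightarrow> oper \<Rightarrow> oper" where
  "halfpow m A = oppow m (opsqrt A)"

definition opclosure :: "oper \<Rightarrow> oper" where
  "opclosure A = {(f,g). f \<in> L2 \<and> g \<in> L2 \<and>
     (\<exists>fs gs. (\<forall>n. (fs n, gs n) \<in> A) \<and>
        (\<lambda>n. nrm (\<lambda>p. fs n p - f p)) \<longlonglongrightarrow> 0 \<and>
        (\<lambda>n. nrm (\<lambda>p. gs n p - g p)) \<longlonglongrightarrow> 0)}"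

definition UL :: "pt \<Rightarrow> fn \<Rightarrow> fn" where
  "UL g f = (\<lambda>(x,y). f (fst g * x, fst g * y + snd g))"

definition UL1 :: "real \<Rightarrow> fn \<Rightarrow> fn" where
  "UL1 t f = (\<lambda>(x,y). f (exp t * x, exp t * y))"

definition UL2 :: "real \<Rightarrow> fn \<Rightarrow> fn" where
  "UL2 t f = (\<lambda>(x,y). f (x, y + t))"

definition generator :: "(real \<Rightarrow> fn \<Rightarrow> fn) \<Rightarrow> oper" where
  "generator U = {(f,g). f \<in> L2 \<and> g \<in> L2 \<and>
     ((\<lambda>t. nrm (\<lambda>p. (U t f p - f p) / complex_of_real t - g p)) \<longlongrightarrow> 0) (at 0)}"

definition DL :: "nat \<Rightarrow> oper" where
  "DL j = (if j = 1 then generator UL1 else generator UL2)"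

definition pd1 :: "(pt \<Rightarrow> real) \<Rightarrow> pt \<Rightarrow> real" where
  "pd1 \<phi> = (\<lambda>(x,y). deriv (\<lambda>s. \<phi> (s,y)) x)"
definition pd2 :: "(pt \<Rightarrow> real) \<Rightarrow> pt \<Rightarrow> real" where
  "pd2 \<phi> = (\<lambda>(x,y). deriv (\<lambda>s. \<phi> (x,s)) y)"

fun iter_pd :: "bool list \<Rightarrow> (pt \<Rightarrow> real) \<Rightarrow> pt \<Rightarrow> real" where
  "iter_pd [] \<phi> = \<phi>"
| "iter_pd (b # bs) \<phi> = (if b then pd1 else pd2) (iter_pd bs \<phi>)"

definition smooth :: "(pt \<Rightarrow> real) \<Rightarrow> bool" where
  "smooth \<phi> \<longleftrightarrow> (\<forall>bs. iter_pd bs \<phi> differentiable_on UNIV)"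

text \<open>C_0^oo(G), extended by zero to R^2.\<close>
definition C0inf_G :: "(pt \<Rightarrow> real) set" where
  "C0inf_G = {\<phi>. smooth \<phi> \<and> (\<exists>K. compact K \<and> K \<subseteq> {p. 0 < fst p} \<and> (\<forall>p. p \<notin> K \<longrightarrow> \<phi> p = 0))}"

text \<open>Garding vector  int_G phi(g) U^L(g) f dmu_l(g), computed pointwise.\<close>
definition garding_vec :: "(pt \<Rightarrow> real) \<Rightarrow> fn \<Rightarrow> fn" where
  "garding_vec \<phi> f = (\<lambda>p. \<integral>g. complex_of_real (\<phi> g) * UL g f p \<partial>mu_l)"

definition garding :: "fn set" where
  "garding = {h. \<exists>(n::nat) (c::nat \<Rightarrow> complex) (\<phi>::nat \<Rightarrow> pt \<Rightarrow> real) (f::nat \<Rightarrow> fn). (\<forall>i<n. \<phi> i \<in> C0inf_G \<and> f i \<in> L2) \<and>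
       (\<forall>p. h p = (\<Sum>i<n. c i * garding_vec (\<phi> i) (f i) p))}"

definition lap0 :: oper where
  "lap0 = {(f,h). f \<in> garding \<and>
     (\<exists>g1 h1 g2 h2. (f,g1) \<in> DL 1 \<and> (g1,h1) \<in> DL 1 \<and> (f,g2) \<in> DL 2 \<and> (g2,h2) \<in> DL 2 \<and>
        h \<in> L2 \<and> ae_eq h (\<lambda>p. - (h1 p + h2 p)))}"

definition DeltaL :: oper where
  "DeltaL = opclosure lap0"

fun iterD :: "nat list \<Rightarrow> oper" where
  "iterD [] = idop"
| "iterD (j # js) = opcomp (DL j) (iterD js)"

definition W2 :: "nat \<Rightarrow> fn set" where
  "W2 m = {f. f \<in> L2 \<and> (\<forall>js. 1 \<le> length js \<and> length js \<le> m \<and> set js \<subseteq> {1,2}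
              \<longrightarrow> f \<in> opdom (iterD js))}"

definition W2norm_top :: "nat \<Rightarrow> fn \<Rightarrow> real" where
  "W2norm_top m f = nrm f +
     (\<Sum>js\<in>{js. length js = m \<and> set js \<subseteq> {1,2}}. nrm (opapp (iterD js) f))"

definition graph_norm :: "nat \<Rightarrow> fn \<Rightarrow> real" where
  "graph_norm m f = nrm f + nrm (opapp (halfpow m DeltaL) f)"

end

theory Submission
  imports Defs
begin

text \<open>The two one-parameter groups satisfy \<open>U\<^sub>1(s) U\<^sub>2(t) = U\<^sub>2(e\<^sup>-\<^sup>s t) U\<^sub>1(s)\<close>, whence
  \<open>D\<^sub>2 D\<^sub>1 = D\<^sub>1 D\<^sub>2 + D\<^sub>2\<close>, and nothing else about the representation matters for the estimates. The form
  \<open>\<parallel>D\<^sub>1 f\<parallel>\<^sup>2 + \<parallel>D\<^sub>2 f\<parallel>\<^sup>2\<close> is closed on the intersection of the domains of \<open>D\<^sub>1\<close> and \<open>D\<^sub>2\<close> and defines a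
  positive self-adjoint operator \<open>L\<close>. Difference quotients along the two groups show that the domain of
  \<open>L\<close> is \<open>W\<^sup>2\<close>. Commuting \<open>D\<^sub>1\<close> and \<open>D\<^sub>2\<close> through \<open>L\<close> then gives, with estimates, that \<open>L f \<in> W\<^sup>k\<close> implies
  \<open>f \<in> W\<^sup>k\<^sup>+\<^sup>2\<close>. Since the domain of \<open>L\<^sup>1\<^sup>/\<^sup>2\<close> is the form domain \<open>W\<^sup>1\<close>, an induction in steps of two identifies
  the domain of \<open>L\<^sup>m\<^sup>/\<^sup>2\<close> with \<open>W\<^sup>m\<close>. Finally, averaging over the group against bump functions approximates
  every \<open>f\<close> in the domain of \<open>L\<close> by Garding vectors in the graph norm, so \<open>L\<close> is the closure
  \<open>\<Delta>\<^sub>L\<close> of the Laplacian from the Garding space.\<close>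

section \<open>Orthogonality in real Hilbert spaces\<close>

text \<open>The estimates use only the real part of the inner product, so the abstract sections live
  in a real Hilbert space; the complex structure returns at the end as the isometry
  \<open>mul_i\<close>, which commutes with both groups and hence with the operators built from
  them. Two obstacles shape the proof. \<open>DeltaL\<close> is a closure from Garding vectors,
  whose self-adjointness is not evident, so a self-adjoint \<open>Lap\<close> is built independently
  and the two are identified afterwards. And \<open>opsqrt\<close> is a definite description, so
  uniqueness of the root has to be shown among arbitrary relations between functions. The generators
  do not commute, but their commutators with the Laplacian have order two; a regularity step of one
  order can therefore absorb them into the preceding estimate. The norm of the theorem contains only
  derivatives of order exactly \<open>m\<close>: it bounds the graph norm because, going up by two,
  \<open>Lap\<close> contributes the pure words \<open>[1, 1]\<close> and \<open>[2, 2]\<close>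
  alone, while the opposite bound goes through the full norm \<open>snorm m\<close>.\<close>

lemma subspace_closure:
  fixes M :: "'a::real_normed_vector set"
  assumes M: "subspace M"
  shows "subspace (closure M)"
  unfolding subspace_def
proof (intro conjI ballI allI)
  show "0 \<in> closure M" using M closure_subset subspace_0 by blast
next
  fix x y assume "x \<in> closure M" "y \<in> closure M"
  then obtain f g where "\<And>n. f n \<in> M" "\<And>n. g n \<in> M" "f \<longlonglongrightarrow> x" "g \<longlonglongrightarrow> y"
    unfolding closure_sequential by blast
  then have "\<And>n. f n + g n \<in> M" "(\<lambda>n. f n + g n) \<longlonglongrightarrow> x + y"
    using M by (auto intro: subspace_add tendsto_add)
  then show "x + y \<in> closure M" unfolding closure_sequential by (intro exI[of _ "\<lambda>n. f n + g n"]) auto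
next
  fix c :: real and x assume "x \<in> closure M"
  then obtain f where "\<And>n. f n \<in> M" "f \<longlonglongrightarrow> x"
    unfolding closure_sequential by blast
  then have "\<And>n. c *\<^sub>R f n \<in> M" "(\<lambda>n. c *\<^sub>R f n) \<longlonglongrightarrow> c *\<^sub>R x"
    using M by (auto intro: subspace_scale tendsto_intros)
  then show "c *\<^sub>R x \<in> closure M" unfolding closure_sequential by (intro exI[of _ "\<lambda>n. c *\<^sub>R f n"]) auto
qed

text \<open>A minimizing sequence for the distance to \<open>x\<close> is Cauchy by the
  parallelogram identity, because midpoints stay in \<open>M\<close>; varying the minimizer along
  \<open>r\<close> gives orthogonality.\<close>

lemma orthogonal_projection_exists:
  fixes M :: "'a::{real_inner,banach} set"
  assumes M: "subspace M" "closed M"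
  shows "\<exists>p\<in>M. \<forall>q\<in>M. inner (x - p) q = 0"
proof -
  define d where "d = Inf ((\<lambda>q. (norm (x - q))\<^sup>2) ` M)"
  have ne: "M \<noteq> {}" using M(1) subspace_0 by blast
  have bdd: "bdd_below ((\<lambda>q. (norm (x - q))\<^sup>2) ` M)"
    by (rule bdd_belowI2[of _ 0]) simp
  have d_le: "d \<le> (norm (x - q))\<^sup>2" if "q \<in> M" for q
    unfolding d_def using bdd that by (intro cInf_lower) auto
  have "\<exists>q\<in>M. (norm (x - q))\<^sup>2 < d + 1 / real (Suc n)" for n
  proof -
    have "Inf ((\<lambda>q. (norm (x - q))\<^sup>2) ` M) < d + 1 / real (Suc n)"
      unfolding d_def by simp
    then show ?thesis using ne bdd by (subst (asm) cInf_less_iff) auto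
  qed
  then obtain q where q: "\<And>n. q n \<in> M" "\<And>n. (norm (x - q n))\<^sup>2 < d + 1 / real (Suc n)"
    by metis
  have par: "(norm (a - b))\<^sup>2 \<le> 2 * ((norm (x - a))\<^sup>2 - d) + 2 * ((norm (x - b))\<^sup>2 - d)"
    if "a \<in> M" "b \<in> M" for a b
  proof -
    have "(1/2) *\<^sub>R (a + b) \<in> M"
      using M(1) that by (intro subspace_scale subspace_add)
    then have "d \<le> (norm (x - (1/2) *\<^sub>R (a + b)))\<^sup>2" by (rule d_le)
    moreover have "(norm (a - b))\<^sup>2 + 4 * (norm (x - (1/2) *\<^sub>R (a + b)))\<^sup>2
        = 2 * (norm (x - a))\<^sup>2 + 2 * (norm (x - b))\<^sup>2"
      unfolding power2_norm_eq_inner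
      by (simp add: inner_simps inner_commute algebra_simps)
    moreover have "P \<le> 2 * (A - d) + 2 * (B - d)" if "d \<le> C" "P + 4 * C = 2 * A + 2 * B" for P A B C :: real
      using that by argo
    ultimately show ?thesis by blast
  qed
  have "Cauchy q"
  proof (rule metric_CauchyI)
    fix e :: real assume e: "0 < e"
    obtain N where N: "4 / real (Suc N) < e\<^sup>2"
    proof -
      obtain N where "4 / e\<^sup>2 < real N" using reals_Archimedean2 by blast
      then have "4 / e\<^sup>2 < real (Suc N)" by simp
      then have "4 / real (Suc N) < e\<^sup>2" using e by (simp add: field_simps)
      then show ?thesis using that by blast
    qed
    have "dist (q m) (q n) < e" if "m \<ge> N" "n \<ge> N" for m n
    proof -
      have *: "(norm (x - q k))\<^sup>2 - d < 1 / real (Suc N)" if "k \<ge> N" for k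
      proof -
        have "1 / real (Suc k) \<le> 1 / real (Suc N)" using that by (simp add: frac_le)
        then show ?thesis using q(2)[of k] by linarith
      qed
      have "(norm (q m - q n))\<^sup>2 < 4 / real (Suc N)"
        using par[OF q(1) q(1), of m n] *[OF that(1)] *[OF that(2)] by simp
      then have "(norm (q m - q n))\<^sup>2 < e\<^sup>2" using N by linarith
      then show ?thesis using e by (simp add: dist_norm power2_less_imp_less)
    qed
    then show "\<exists>N. \<forall>m\<ge>N. \<forall>n\<ge>N. dist (q m) (q n) < e" by blast
  qed
  then obtain p where p: "q \<longlonglongrightarrow> p" using Cauchy_convergent convergentD by blast
  have pM: "p \<in> M" using closed_sequentially[OF M(2)] q(1) p by blast
  have min: "(norm (x - p))\<^sup>2 \<le> d"
  proof (rule LIMSEQ_le)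
    show "(\<lambda>n. (norm (x - q n))\<^sup>2) \<longlonglongrightarrow> (norm (x - p))\<^sup>2" by (intro tendsto_intros p)
    have "(\<lambda>n. d + inverse (real (Suc n))) \<longlonglongrightarrow> d + 0"
      by (intro tendsto_intros LIMSEQ_inverse_real_of_nat)
    then show "(\<lambda>n. d + 1 / real (Suc n)) \<longlonglongrightarrow> d" by (simp add: inverse_eq_divide)
    show "\<exists>N. \<forall>n\<ge>N. (norm (x - q n))\<^sup>2 \<le> d + 1 / real (Suc n)"
      using q(2) less_imp_le by blast
  qed
  have "inner (x - p) r = 0" if r: "r \<in> M" for r
  proof (cases "r = 0")
    case False
    \<comment> \<open>The minimum point of the squared distance from \<open>x\<close> along the line
      \<open>p + t r\<close>.\<close>
    define t where "t = inner (x - p) r / inner r r"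
    have pos: "0 < inner r r" using False by simp
    have "p + t *\<^sub>R r \<in> M" using M(1) pM r by (intro subspace_add subspace_scale)
    then have "(norm (x - p))\<^sup>2 \<le> (norm (x - (p + t *\<^sub>R r)))\<^sup>2"
      using d_le min order_trans by blast
    also have "\<dots> = (norm (x - p))\<^sup>2 - 2 * t * inner (x - p) r + t\<^sup>2 * inner r r"
      unfolding power2_norm_eq_inner
      by (simp add: inner_simps inner_commute algebra_simps power2_eq_square)
    also have "\<dots> = (norm (x - p))\<^sup>2 - (inner (x - p) r)\<^sup>2 / inner r r"
      unfolding t_def using pos by (simp add: field_simps power2_eq_square)
    finally have "(inner (x - p) r)\<^sup>2 / inner r r \<le> 0" by simp
    then show ?thesis using pos by (simp add: divide_le_0_iff)
  qed simp
  then show ?thesis using pM by blast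
qed

text \<open>The residual of projecting \<open>x\<close> to \<open>closure M\<close> lies in
  \<open>N\<close> and is orthogonal to \<open>M\<close>. With a closed graph as \<open>N\<close>
  this yields core statements such as \<open>Lap_core\<close>.\<close>

lemma in_closure_by_orthogonality:
  fixes M N :: "'a::{real_inner,banach} set"
  assumes M: "subspace M" and N: "subspace N" "closed N" and MN: "M \<subseteq> N" and x: "x \<in> N"
    and orth: "\<And>u. u \<in> N \<Longrightarrow> (\<And>q. q \<in> M \<Longrightarrow> inner u q = 0) \<Longrightarrow> u = 0"
  shows "x \<in> closure M"
proof -
  have "subspace (closure M)" using M by (rule subspace_closure)
  then obtain p where p: "p \<in> closure M" "\<forall>q\<in>closure M. inner (x - p) q = 0"
    using orthogonal_projection_exists[of "closure M" x] by auto
  have "p \<in> N" using p(1) MN N(2) closure_minimal by blast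
  then have "x - p \<in> N" using N(1) x by (simp add: subspace_diff)
  then have "x - p = 0" using orth p(2) closure_subset by blast
  then show ?thesis using p(1) by simp
qed

lemma dense_by_orthogonality:
  fixes M :: "'a::{real_inner,banach} set"
  assumes "subspace M" "\<And>u. (\<And>q. q \<in> M \<Longrightarrow> inner u q = 0) \<Longrightarrow> u = 0"
  shows "closure M = UNIV"
  using in_closure_by_orthogonality[of M UNIV] assms by auto

lemma orthogonal_to_dense:
  fixes u :: "'a::real_inner"
  assumes "closure M = UNIV" "\<And>q. q \<in> M \<Longrightarrow> inner u q = 0"
  shows "u = 0"
proof -
  have "closed {q. inner u q = 0}" by (intro closed_Collect_eq continuous_intros)
  then have "closure M \<subseteq> {q. inner u q = 0}" using assms(2) by (intro closure_minimal) auto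
  then have "inner u u = 0" using assms(1) by blast
  then show ?thesis by simp
qed

text \<open>The one-sided bound extends by continuity to all \<open>q\<close>, and
  \<open>q = u\<close> gives the claim.\<close>

lemma norm_le_by_dense:
  fixes u :: "'a::real_inner"
  assumes "closure M = UNIV" "\<And>q. q \<in> M \<Longrightarrow> inner u q \<le> C * norm q" "0 \<le> C"
  shows "norm u \<le> C"
proof -
  have "closed {q. inner u q \<le> C * norm q}" by (intro closed_Collect_le continuous_intros)
  then have "closure M \<subseteq> {q. inner u q \<le> C * norm q}" using assms(2) by (intro closure_minimal) auto
  then have "inner u u \<le> C * norm u" using assms(1) by blast
  then have "norm u * norm u \<le> C * norm u" by (simp flip: power2_norm_eq_inner power2_eq_square)
  then show ?thesis using assms(3) by (cases "u = 0") auto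
qed

text \<open>The functional is given by its graph \<open>G\<close>; the representing vector is read off the component
  of \<open>(0, 1)\<close> orthogonal to the closure of \<open>G\<close>, so no extension to the whole space is needed.\<close>
lemma riesz_on_subspace:
  fixes G :: "('a::{real_inner,banach} \<times> real) set"
  assumes G: "subspace G" and bd: "\<And>g r. (g, r) \<in> G \<Longrightarrow> \<bar>r\<bar> \<le> C * norm g"
  shows "\<exists>v. \<forall>(g, r)\<in>G. r = inner v g"
proof -
  have "subspace (closure G)" using G by (rule subspace_closure)
  then obtain p where p: "p \<in> closure G" "\<forall>q\<in>closure G. inner ((0, 1) - p) q = 0"
    using orthogonal_projection_exists[of "closure G" "(0, 1)"] by auto
  obtain a b where ab: "(0, 1) - p = (a, b)" by force
  have "closed {q :: 'a \<times> real. \<bar>snd q\<bar> \<le> C * norm (fst q)}"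
    by (intro closed_Collect_le continuous_intros)
  then have cl: "closure G \<subseteq> {q. \<bar>snd q\<bar> \<le> C * norm (fst q)}"
    using bd by (intro closure_minimal) auto
  \<comment> \<open>\<open>b = 0\<close> would put \<open>(0, 1)\<close> into the closure of the
    graph, against the bound, which survives closure.\<close>
  have "b \<noteq> 0"
  proof
    assume b: "b = 0"
    have "inner (a, b) (a, b) = inner (a, b) (0, 1) - inner (a, b) p"
      by (metis ab inner_diff_right)
    also have "inner (a, b) p = 0" using p ab by auto
    also have "inner (a, b) (0, 1) - 0 = 0" using b by simp
    finally have "(0, 1) - p = 0" unfolding ab by (simp only: inner_eq_zero_iff)
    then have "(0, 1) = p" by simp
    then show False using p(1) cl by force
  qed
  have "r = inner ((- 1 / b) *\<^sub>R a) g" if "(g, r) \<in> G" for g r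
  proof -
    have "inner (a, b) (g, r) = 0" using p(2) ab that closure_subset by (metis subsetD)
    then show ?thesis using \<open>b \<noteq> 0\<close> by (simp add: field_simps)
  qed
  then show ?thesis by blast
qed

text \<open>Degenerate case of the Cauchy--Schwarz inequality for a semidefinite form: were
  \<open>F y x\<close> nonzero, the form would be affine and nonconstant along
  \<open>x + t y\<close>, hence negative somewhere.\<close>

lemma cauchy_schwarz_form:
  fixes F :: "'a::real_vector \<Rightarrow> 'a \<Rightarrow> real"
  assumes add: "\<And>x y z. F (x + y) z = F x z + F y z" and sc: "\<And>c x z. F (c *\<^sub>R x) z = c * F x z"
    and sym: "\<And>x y. F x y = F y x" and pos: "\<And>x. 0 \<le> F x x"
    and zero: "F y y = 0"
  shows "F y x = 0"
proof (rule ccontr)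
  assume nz: "F y x \<noteq> 0"
  \<comment> \<open>Solves \<open>F x x + 2 * t * F y x = - 1\<close>.\<close>
  define t where "t = - (F x x + 1) / (2 * F y x)"
  have "F (x + t *\<^sub>R y) (x + t *\<^sub>R y) = F x (x + t *\<^sub>R y) + t * F y (x + t *\<^sub>R y)"
    by (simp add: add sc)
  also have "F x (x + t *\<^sub>R y) = F x x + t * F y x"
    using sym[of x "x + t *\<^sub>R y"] by (simp add: add sc)
  also have "F y (x + t *\<^sub>R y) = F y x + t * F y y"
    using sym[of y "x + t *\<^sub>R y"] sym[of x y] by (simp add: add sc)
  also have "F x x + t * F y x + t * (F y x + t * F y y) = F x x + 2 * t * F y x + t\<^sup>2 * F y y"
    by (simp add: algebra_simps power2_eq_square)
  also have "\<dots> = - 1" using nz by (simp add: zero t_def field_simps)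
  finally show False using pos[of "x + t *\<^sub>R y"] by simp
qed

section \<open>Square roots of bounded positive operators\<close>

text \<open>A fixed point satisfies \<open>2 Y = A + Y Y\<close>, that is
  \<open>(1 - Y) (1 - Y) = 1 - A\<close>, so \<open>1 - Y\<close> is a root of \<open>1 - A\<close>.
  Every iterate is a polynomial in \<open>A\<close>, which hands symmetry and commutation on to the
  limit.\<close>

fun sqrt_iter :: "('a::real_normed_vector \<Rightarrow>\<^sub>L 'a) \<Rightarrow> nat \<Rightarrow> ('a \<Rightarrow>\<^sub>L 'a)" where
  "sqrt_iter A 0 = 0"
| "sqrt_iter A (Suc n) = (1/2) *\<^sub>R (A + (sqrt_iter A n o\<^sub>L sqrt_iter A n))"

text \<open>Scalar majorant: the same iteration with 1 in place of \<open>A\<close>. It increases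
  and is bounded by 1, so it converges, and its increments dominate those of the operators.\<close>

fun sqrt_iter_real :: "nat \<Rightarrow> real" where
  "sqrt_iter_real 0 = 0"
| "sqrt_iter_real (Suc n) = (1 + (sqrt_iter_real n)\<^sup>2) / 2"

lemma sqrt_iter_real_bounds: "0 \<le> sqrt_iter_real n \<and> sqrt_iter_real n \<le> 1"
proof (induction n)
  case (Suc n)
  then have "(sqrt_iter_real n)\<^sup>2 \<le> 1" by (simp add: power_le_one)
  then show ?case by simp
qed simp

lemma sqrt_iter_real_mono: "sqrt_iter_real n \<le> sqrt_iter_real (Suc n)"
proof -
  have "0 \<le> (1 - sqrt_iter_real n)\<^sup>2" by simp
  then show ?thesis by (simp add: power2_eq_square algebra_simps)
qed

lemma norm_sqrt_iter:
  assumes "norm A \<le> 1"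
  shows "norm (sqrt_iter A n) \<le> sqrt_iter_real n"
proof (induction n)
  case (Suc n)
  have "norm (A + (sqrt_iter A n o\<^sub>L sqrt_iter A n))
      \<le> norm A + norm (sqrt_iter A n) * norm (sqrt_iter A n)"
    by (rule norm_triangle_le) (simp add: norm_blinfun_compose)
  also have "\<dots> \<le> 1 + sqrt_iter_real n * sqrt_iter_real n"
    using Suc assms by (intro add_mono mult_mono) (auto simp: sqrt_iter_real_bounds)
  finally show ?case by (simp add: power2_eq_square)
qed simp

text \<open>The factorization \<open>a a - b b = a (a - b) + (a - b) b\<close> needs no
  commutativity and is exact for the scalar iteration, so the induction closes with the increments
  of the majorant.\<close>

lemma norm_sqrt_iter_diff:
  assumes "norm A \<le> 1"
  shows "norm (sqrt_iter A (Suc n) - sqrt_iter A n) \<le> sqrt_iter_real (Suc n) - sqrt_iter_real n"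
proof (induction n)
  case 0
  then show ?case using assms by simp
next
  case (Suc n)
  let ?Y = "sqrt_iter A" and ?y = sqrt_iter_real
  have "?Y (Suc (Suc n)) - ?Y (Suc n)
      = (1/2) *\<^sub>R ((?Y (Suc n) o\<^sub>L ?Y (Suc n)) - (?Y n o\<^sub>L ?Y n))"
    by (subst (1 2) sqrt_iter.simps(2)) (simp add: scaleR_diff_right scaleR_add_right del: sqrt_iter.simps)
  also have "(?Y (Suc n) o\<^sub>L ?Y (Suc n)) - (?Y n o\<^sub>L ?Y n)
      = (?Y (Suc n) o\<^sub>L (?Y (Suc n) - ?Y n)) + ((?Y (Suc n) - ?Y n) o\<^sub>L ?Y n)"
    by (rule blinfun_eqI) (simp add: blinfun.bilinear_simps del: sqrt_iter.simps)
  finally have "norm (?Y (Suc (Suc n)) - ?Y (Suc n))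
      \<le> 1/2 * (norm (?Y (Suc n)) * norm (?Y (Suc n) - ?Y n) + norm (?Y (Suc n) - ?Y n) * norm (?Y n))"
    by (simp del: sqrt_iter.simps)
       (meson add_mono norm_blinfun_compose norm_triangle_le)
  also have "\<dots> \<le> 1/2 * (?y (Suc n) * (?y (Suc n) - ?y n) + (?y (Suc n) - ?y n) * ?y n)"
    using Suc norm_sqrt_iter[OF assms] sqrt_iter_real_bounds sqrt_iter_real_mono
    by (intro mult_left_mono add_mono mult_mono) (auto simp del: sqrt_iter.simps sqrt_iter_real.simps)
  also have "\<dots> = ?y (Suc (Suc n)) - ?y (Suc n)"
    by (simp add: sqrt_iter_real.simps(2)[of "Suc n"] sqrt_iter_real.simps(2)[of n, symmetric]
        power2_eq_square field_simps del: sqrt_iter_real.simps)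
      (simp add: power2_eq_square field_simps)
  finally show ?case .
qed

lemma sqrt_iter_convergent:
  fixes A :: "'a::banach \<Rightarrow>\<^sub>L 'a"
  assumes "norm A \<le> 1"
  shows "convergent (sqrt_iter A)"
proof -
  let ?Y = "sqrt_iter A" and ?y = sqrt_iter_real
  have diff: "norm (?Y (m + k) - ?Y m) \<le> ?y (m + k) - ?y m" for m k
  proof (induction k)
    case (Suc k)
    have "norm (?Y (m + Suc k) - ?Y m)
        \<le> norm (?Y (Suc (m + k)) - ?Y (m + k)) + norm (?Y (m + k) - ?Y m)"
      using norm_triangle_ineq[of "?Y (Suc (m + k)) - ?Y (m + k)" "?Y (m + k) - ?Y m"]
      by (simp del: sqrt_iter.simps)
    then show ?case using Suc norm_sqrt_iter_diff[OF assms, of "m + k"] by simp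
  qed simp
  have "Cauchy ?y"
    using sqrt_iter_real_bounds sqrt_iter_real_mono
    by (intro convergent_Cauchy Bseq_monoseq_convergent BseqI'[of _ 1]) (auto simp: monoseq_Suc)
  have "Cauchy ?Y"
  proof (rule metric_CauchyI)
    fix e :: real assume "0 < e"
    then obtain N where N: "\<And>m n. m \<ge> N \<Longrightarrow> n \<ge> N \<Longrightarrow> dist (?y m) (?y n) < e"
      using \<open>Cauchy ?y\<close> metric_CauchyD by blast
    have *: "dist (?Y m) (?Y n) < e" if "m \<ge> N" "n \<ge> m" for m n
    proof -
      have "norm (?Y (m + (n - m)) - ?Y m) \<le> ?y (m + (n - m)) - ?y m" by (rule diff)
      then have "norm (?Y n - ?Y m) \<le> ?y n - ?y m" using that by simp
      also have "\<dots> < e" using N[of n m] that by (simp add: dist_real_def)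
      finally show ?thesis by (simp add: dist_norm norm_minus_commute)
    qed
    have "dist (?Y m) (?Y n) < e" if "m \<ge> N" "n \<ge> N" for m n
      using *[of m n] *[of n m] that by (cases "m \<le> n") (auto simp: dist_commute)
    then show "\<exists>N. \<forall>m\<ge>N. \<forall>n\<ge>N. dist (?Y m) (?Y n) < e" by blast
  qed
  then show ?thesis by (rule Cauchy_convergent)
qed

text \<open>The root is \<open>1 - Y\<close> for the limit \<open>Y\<close>, and positive because
  \<open>norm Y \<le> 1\<close>. The bound on \<open>id_blinfun - X\<close> is recorded so that the
  root is again an admissible argument and can be rooted once more, as in
  \<open>pos_QR\<close>.\<close>

lemma blinfun_sqrt_exists:
  fixes A :: "'a::{real_inner,banach} \<Rightarrow>\<^sub>L 'a"
  assumes A: "norm A \<le> 1" and sym: "\<And>x y. inner (A x) y = inner x (A y)"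
  shows "\<exists>X :: 'a \<Rightarrow>\<^sub>L 'a. X o\<^sub>L X = id_blinfun - A \<and>
    (\<forall>C. C o\<^sub>L A = A o\<^sub>L C \<longrightarrow> C o\<^sub>L X = X o\<^sub>L C) \<and>
    (\<forall>x y. inner (X x) y = inner x (X y)) \<and> (\<forall>x. 0 \<le> inner (X x) x) \<and>
    norm (id_blinfun - X) \<le> 1"
proof -
  let ?Y = "sqrt_iter A"
  obtain Y where Y: "?Y \<longlonglongrightarrow> Y" using sqrt_iter_convergent[OF A] convergentD by blast
  have fix_Y: "Y = (1/2) *\<^sub>R (A + (Y o\<^sub>L Y))"
  proof (rule LIMSEQ_unique)
    show "(\<lambda>n. ?Y (Suc n)) \<longlonglongrightarrow> Y" using Y by (rule LIMSEQ_Suc)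
    show "(\<lambda>n. ?Y (Suc n)) \<longlonglongrightarrow> (1/2) *\<^sub>R (A + (Y o\<^sub>L Y))"
      unfolding sqrt_iter.simps
      by (intro tendsto_intros bounded_bilinear.tendsto[OF bounded_bilinear_blinfun_compose] Y)
  qed
  have nY: "norm Y \<le> 1"
  proof (rule LIMSEQ_le_const2)
    show "(\<lambda>n. norm (?Y n)) \<longlonglongrightarrow> norm Y" by (intro tendsto_intros Y)
    show "\<exists>N. \<forall>n\<ge>N. norm (?Y n) \<le> 1"
      using norm_sqrt_iter[OF A] sqrt_iter_real_bounds order_trans by blast
  qed
  have sym_n: "inner (?Y n x) y = inner x (?Y n y)" for n x y
    by (induction n arbitrary: x y) (simp_all add: blinfun.bilinear_simps inner_simps sym)
  have sym_Y: "inner (Y x) y = inner x (Y y)" for x y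
  proof (rule LIMSEQ_unique)
    show "(\<lambda>n. inner (?Y n x) y) \<longlonglongrightarrow> inner (Y x) y"
      by (intro tendsto_intros blinfun.tendsto Y)
    show "(\<lambda>n. inner (?Y n x) y) \<longlonglongrightarrow> inner x (Y y)"
      unfolding sym_n by (intro tendsto_intros blinfun.tendsto Y)
  qed
  have comm_Y: "C o\<^sub>L Y = Y o\<^sub>L C" if C: "C o\<^sub>L A = A o\<^sub>L C" for C
  proof (rule LIMSEQ_unique)
    have "C (A x) = A (C x)" for x using C by (metis blinfun_apply_blinfun_compose)
    then have "C (?Y n x) = ?Y n (C x)" for n x
      by (induction n arbitrary: x) (simp_all add: blinfun.bilinear_simps)
    then have "C o\<^sub>L ?Y n = ?Y n o\<^sub>L C" for n by (intro blinfun_eqI) simp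
    moreover have "(\<lambda>n. C o\<^sub>L ?Y n) \<longlonglongrightarrow> (C o\<^sub>L Y)" "(\<lambda>n. ?Y n o\<^sub>L C) \<longlonglongrightarrow> (Y o\<^sub>L C)"
      by (intro bounded_bilinear.tendsto[OF bounded_bilinear_blinfun_compose] Y tendsto_intros)+
    ultimately show "(\<lambda>n. C o\<^sub>L ?Y n) \<longlonglongrightarrow> (C o\<^sub>L Y)" "(\<lambda>n. C o\<^sub>L ?Y n) \<longlonglongrightarrow> (Y o\<^sub>L C)" by simp_all
  qed
  have fix_apply: "2 *\<^sub>R Y x = A x + Y (Y x)" for x
  proof -
    have "Y x = ((1/2) *\<^sub>R (A + (Y o\<^sub>L Y))) x" using fix_Y by simp
    then have "2 *\<^sub>R Y x = 2 *\<^sub>R (((1/2) *\<^sub>R (A + (Y o\<^sub>L Y))) x)" by (rule arg_cong)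
    also have "\<dots> = A x + Y (Y x)" by (simp add: blinfun.bilinear_simps)
    finally show ?thesis .
  qed
  define X where "X = id_blinfun - Y"
  have "X o\<^sub>L X = id_blinfun - A"
  proof (rule blinfun_eqI)
    fix x
    have "Y (Y x) = Y x + Y x - A x" using fix_apply[of x] by (simp add: scaleR_2)
    then show "(X o\<^sub>L X) x = (id_blinfun - A) x"
      by (simp add: X_def blinfun.bilinear_simps)
  qed
  moreover have "C o\<^sub>L X = X o\<^sub>L C" if "C o\<^sub>L A = A o\<^sub>L C" for C
  proof (rule blinfun_eqI)
    fix x
    have "C (Y x) = Y (C x)" using comm_Y[OF that] by (metis blinfun_apply_blinfun_compose)
    then show "(C o\<^sub>L X) x = (X o\<^sub>L C) x" by (simp add: X_def blinfun.bilinear_simps)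
  qed
  moreover have "inner (X x) y = inner x (X y)" for x y
    by (simp add: X_def blinfun.bilinear_simps inner_simps sym_Y)
  moreover have "0 \<le> inner (X x) x" for x
  proof -
    have "norm (Y x) \<le> norm x"
      using norm_blinfun[of Y x] mult_right_mono[OF nY norm_ge_zero[of x]] by simp
    then have "norm (Y x) * norm x \<le> norm x * norm x" by (rule mult_right_mono) simp
    then have "inner (Y x) x \<le> norm x * norm x"
      using norm_cauchy_schwarz[of "Y x" x] by linarith
    then show ?thesis
      by (simp add: X_def blinfun.bilinear_simps inner_simps power2_norm_eq_inner[symmetric] power2_eq_square)
  qed
  moreover have "norm (id_blinfun - X) \<le> 1" using nY by (simp add: X_def)
  ultimately show ?thesis by blast
qed

text \<open>Commutation with every bounded operator that commutes with \<open>P\<close> stands in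
  for the functional calculus: it makes the roots of one resolvent and of its complement
  commute.\<close>

definition is_bsqrt :: "('a::{real_inner,banach} \<Rightarrow>\<^sub>L 'a) \<Rightarrow> ('a \<Rightarrow>\<^sub>L 'a) \<Rightarrow> bool" where
  "is_bsqrt P X \<longleftrightarrow> (\<forall>x. X (X x) = P x) \<and>
    (\<forall>C :: 'a \<Rightarrow>\<^sub>L 'a. (\<forall>x. C (P x) = P (C x)) \<longrightarrow> (\<forall>x. C (X x) = X (C x))) \<and>
    (\<forall>x y. inner (X x) y = inner x (X y)) \<and> (\<forall>x. 0 \<le> inner (X x) x) \<and>
    norm (id_blinfun - X) \<le> 1"

definition bsqrt :: "('a::{real_inner,banach} \<Rightarrow>\<^sub>L 'a) \<Rightarrow> ('a \<Rightarrow>\<^sub>L 'a)" where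
  "bsqrt P = (SOME X. is_bsqrt P X)"

lemma
  fixes P :: "'a::{real_inner,banach} \<Rightarrow>\<^sub>L 'a"
  assumes "norm (id_blinfun - P) \<le> 1" "\<And>x y. inner (P x) y = inner x (P y)"
  shows bsqrt_square: "bsqrt P (bsqrt P x) = P x"
    and bsqrt_commute: "\<And>C :: 'a \<Rightarrow>\<^sub>L 'a. (\<And>x. C (P x) = P (C x)) \<Longrightarrow> C (bsqrt P x) = bsqrt P (C x)"
    and bsqrt_sym: "inner (bsqrt P x) y = inner x (bsqrt P y)"
    and bsqrt_pos: "0 \<le> inner (bsqrt P x) x"
    and norm_bsqrt: "norm (id_blinfun - bsqrt P) \<le> 1"
proof -
  have sym: "inner ((id_blinfun - P) x) y = inner x ((id_blinfun - P) y)" for x y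
    by (simp add: blinfun.diff_left inner_diff_left inner_diff_right assms(2))
  obtain X where X: "X o\<^sub>L X = id_blinfun - (id_blinfun - P)"
    "\<forall>C. C o\<^sub>L (id_blinfun - P) = (id_blinfun - P) o\<^sub>L C \<longrightarrow> C o\<^sub>L X = X o\<^sub>L C"
    "\<forall>x y. inner (X x) y = inner x (X y)" "\<forall>x. 0 \<le> inner (X x) x" "norm (id_blinfun - X) \<le> 1"
    using blinfun_sqrt_exists[OF assms(1) sym] by (elim exE conjE) (rule that)
  have "X (X x) = P x" for x
    using arg_cong[OF X(1), of "\<lambda>Y. blinfun_apply Y x"] by simp
  moreover have "C (X x) = X (C x)" if C: "\<forall>x. C (P x) = P (C x)" for C :: "'a \<Rightarrow>\<^sub>L 'a" and x
  proof -
    have "C o\<^sub>L (id_blinfun - P) = (id_blinfun - P) o\<^sub>L C"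
      using C by (intro blinfun_eqI) (simp add: blinfun.bilinear_simps)
    then show ?thesis using X(2) by (metis blinfun_apply_blinfun_compose)
  qed
  ultimately have "is_bsqrt P X" using X(3-5) unfolding is_bsqrt_def by blast
  then have "is_bsqrt P (bsqrt P)" unfolding bsqrt_def by (rule someI)
  then show "bsqrt P (bsqrt P x) = P x"
    "\<And>C :: 'a \<Rightarrow>\<^sub>L 'a. (\<And>x. C (P x) = P (C x)) \<Longrightarrow> C (bsqrt P x) = bsqrt P (C x)"
    "inner (bsqrt P x) y = inner x (bsqrt P y)" "0 \<le> inner (bsqrt P x) x"
    "norm (id_blinfun - bsqrt P) \<le> 1"
    unfolding is_bsqrt_def by blast+
qed

lemmas bsqrt = bsqrt_square bsqrt_commute bsqrt_sym bsqrt_pos norm_bsqrt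

text \<open>With \<open>y = K x - P x\<close>, commutation gives \<open>K y + P y = 0\<close>.
  Positivity forces \<open>inner (K y) y\<close> and \<open>inner (P y) y\<close> to vanish, hence
  \<open>K y = P y = 0\<close>, and
  \<open>inner y y = inner x (K y) - inner x (P y)\<close>.\<close>

lemma positive_square_root_unique:
  fixes K P :: "'a::real_inner \<Rightarrow>\<^sub>L 'a"
  assumes K: "\<And>x y. inner (K x) y = inner x (K y)" "\<And>x. 0 \<le> inner (K x) x"
    and P: "\<And>x y. inner (P x) y = inner x (P y)" "\<And>x. 0 \<le> inner (P x) x"
    and sq: "\<And>x. K (K x) = P (P x)" and comm: "\<And>x. K (P x) = P (K x)"
  shows "K x = P x"
proof -
  have null: "A y = 0"
    if A: "\<And>x y. inner (A x) y = inner x (A y)" "\<And>x. 0 \<le> inner (A x) x" and y: "inner (A y) y = 0"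
    for A :: "'a \<Rightarrow>\<^sub>L 'a" and y
  proof -
    have "inner (A y) (A y) = 0"
      by (rule cauchy_schwarz_form[of "\<lambda>x y. inner (A x) y"])
        (use A y in \<open>auto simp: blinfun.bilinear_simps inner_simps inner_commute\<close>)
    then show ?thesis by simp
  qed
  define y where "y = K x - P x"
  have "K y + P y = 0"
    by (simp add: y_def blinfun.bilinear_simps sq comm)
  then have "inner (K y) y + inner (P y) y = 0" by (metis inner_add_left inner_zero_left)
  then have "inner (K y) y = 0" "inner (P y) y = 0" using K(2)[of y] P(2)[of y] by linarith+
  then have "K y = 0" "P y = 0" using null K P by blast+
  moreover have "inner y y = inner x (K y) - inner x (P y)"
    using K(1)[of x y] P(1)[of x y] by (subst y_def) (simp add: inner_diff_left)
  ultimately show ?thesis by (simp add: y_def)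
qed

section \<open>Square roots of unbounded positive operators\<close>

text \<open>An unbounded positive self-adjoint operator \<open>L\<close> is represented by its resolvent
  \<open>B = (1 + L)\<^sup>-\<^sup>1\<close>. With the commuting bounded operators \<open>Q = B\<^sup>1\<^sup>/\<^sup>2\<close> and \<open>R = (1 - B)\<^sup>1\<^sup>/\<^sup>2\<close>, for which
  \<open>Q\<^sup>2 + R\<^sup>2 = 1\<close>, the graph of the square root of \<open>L\<close> is \<open>{(Q u, R u)}\<close>.\<close>

locale pos_resolvent =
  fixes B :: "'a::{real_inner,banach} \<Rightarrow>\<^sub>L 'a"
  assumes sym_B: "inner (B x) y = inner x (B y)"
    and norm_B: "norm B \<le> 1"
    and norm_compl: "norm (id_blinfun - B) \<le> 1"
    and inj_B: "B x = 0 \<Longrightarrow> x = 0"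
begin

definition op_graph :: "('a \<times> 'a) set" where
  "op_graph = range (\<lambda>h. (B h, h - B h))"

abbreviation Q :: "'a \<Rightarrow>\<^sub>L 'a" where "Q \<equiv> bsqrt B"
abbreviation R :: "'a \<Rightarrow>\<^sub>L 'a" where "R \<equiv> bsqrt (id_blinfun - B)"

definition sqrt_graph :: "('a \<times> 'a) set" where
  "sqrt_graph = range (\<lambda>u. (Q u, R u))"

lemma op_graph_iff: "(f, g) \<in> op_graph \<longleftrightarrow> f = B (f + g)"
  by (auto simp: op_graph_def image_iff intro!: exI[of _ "f + g"])

lemma QQ: "Q (Q x) = B x"
  and sym_Q: "inner (Q x) y = inner x (Q y)"
  and norm_Q: "norm (id_blinfun - Q) \<le> 1"
  and Q_commute: "\<And>C :: 'a \<Rightarrow>\<^sub>L 'a. (\<And>x. C (B x) = B (C x)) \<Longrightarrow> C (Q x) = Q (C x)"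
  using bsqrt[OF norm_compl sym_B] by blast+

lemma RR: "R (R x) = x - B x"
  and sym_R: "inner (R x) y = inner x (R y)"
  and pos_R: "0 \<le> inner (R x) x"
  and R_commute: "\<And>C :: 'a \<Rightarrow>\<^sub>L 'a. (\<And>x. C (B x) = B (C x)) \<Longrightarrow> C (R x) = R (C x)"
proof -
  have n: "norm (id_blinfun - (id_blinfun - B)) \<le> 1" using norm_B by simp
  have s: "inner ((id_blinfun - B) x) y = inner x ((id_blinfun - B) y)" for x y
    by (simp add: blinfun.bilinear_simps inner_simps sym_B)
  note b = bsqrt[OF n s]
  show "R (R x) = x - B x" using b(1)[of x] by (simp add: blinfun.bilinear_simps)
  show "inner (R x) y = inner x (R y)" "0 \<le> inner (R x) x" using b by blast+
  show "C (R x) = R (C x)" if "\<And>x. C (B x) = B (C x)" for C :: "'a \<Rightarrow>\<^sub>L 'a"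
    using b(2)[of C x] that by (simp add: blinfun.bilinear_simps)
qed

lemma B_R: "B (R x) = R (B x)" by (rule R_commute) simp
lemma RQ: "R (Q x) = Q (R x)" by (rule Q_commute) (simp add: B_R)

lemma Q_Q_R: "Q (Q x) + R (R x) = x" by (simp add: QQ RR)

text \<open>\<open>Q\<close> is the square of its own root, which commutes with \<open>R\<close> and
  can be moved to the other side; what remains is the positivity of \<open>R\<close>.\<close>

lemma pos_QR: "0 \<le> inner (Q (R x)) x"
proof -
  note b = bsqrt[OF norm_Q sym_Q]
  have "inner (Q (R x)) x = inner (bsqrt Q (R x)) (bsqrt Q x)" by (simp add: b(1) flip: b(3))
  also have "bsqrt Q (R x) = R (bsqrt Q x)" using b(2)[of R x] RQ by simp
  finally show ?thesis by (simp add: pos_R)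
qed

lemma dense_range_B: "closure (range B) = UNIV"
proof (rule dense_by_orthogonality)
  show "subspace (range B)" by (simp add: blinfun.bounded_linear_right bounded_linear.linear linear_subspace_image)
  show "u = 0" if "\<And>q. q \<in> range B \<Longrightarrow> inner u q = 0" for u
  proof -
    have "inner (B u) (B u) = inner u (B (B u))" by (rule sym_B)
    then show ?thesis using that inj_B by force
  qed
qed

lemma dense_range_Q: "closure (range Q) = UNIV"
proof -
  have "range B \<subseteq> range Q" using QQ by (metis image_subsetI rangeI)
  then show ?thesis using dense_range_B closure_mono by blast
qed

lemma subspace_sqrt_graph: "subspace sqrt_graph"
proof -
  have "linear (\<lambda>u. (Q u, R u))"
    by (intro linearI) (simp_all add: blinfun.bilinear_simps)
  then show ?thesis unfolding sqrt_graph_def by (rule linear_subspace_image) simp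
qed

lemma sqrt_graph_single_valued: "(0, g) \<in> sqrt_graph \<Longrightarrow> g = 0"
proof -
  assume "(0, g) \<in> sqrt_graph"
  then obtain u where "Q u = 0" "g = R u" by (auto simp: sqrt_graph_def)
  then have "u = 0" using QQ[of u] inj_B by simp
  then show "g = 0" using \<open>g = R u\<close> by simp
qed

lemma sqrt_graph_symmetric:
  "(f, g) \<in> sqrt_graph \<Longrightarrow> (u, v) \<in> sqrt_graph \<Longrightarrow> inner g u = inner f v"
  by (auto simp: sqrt_graph_def sym_R sym_Q RQ)

text \<open>Testing against all \<open>(Q w, R w)\<close> gives \<open>R u = Q v\<close>; then
  \<open>w = Q u + R v\<close> satisfies \<open>Q w = u\<close> and \<open>R w = v\<close> because
  \<open>Q Q + R R = 1\<close>. The same vector, called \<open>h\<close>, proves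
  \<open>sqrt_graph_square\<close>.\<close>

lemma sqrt_graph_selfadjoint:
  assumes "\<And>f g. (f, g) \<in> sqrt_graph \<Longrightarrow> inner g u = inner f v"
  shows "(u, v) \<in> sqrt_graph"
proof -
  have "inner w (R u) = inner w (Q v)" for w
    using assms[of "Q w" "R w"] by (auto simp: sqrt_graph_def sym_R sym_Q)
  then have RuQv: "R u = Q v" using inner_commute vector_eq_rdot by metis
  define w where "w = Q u + R v"
  have "Q w = Q (Q u) + R (Q v)" by (simp add: w_def blinfun.bilinear_simps RQ)
  then have 1: "Q w = u" by (simp add: Q_Q_R flip: RuQv)
  have "R w = Q (R u) + R (R v)" by (simp add: w_def blinfun.bilinear_simps RQ)
  then have 2: "R w = v" by (simp add: Q_Q_R RuQv)
  show ?thesis using 1 2 by (auto simp: sqrt_graph_def)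
qed

lemma sqrt_graph_nonneg: "(f, g) \<in> sqrt_graph \<Longrightarrow> 0 \<le> inner g f"
proof -
  assume "(f, g) \<in> sqrt_graph"
  then obtain u where "f = Q u" "g = R u" by (auto simp: sqrt_graph_def)
  then have "inner g f = inner (Q (R u)) u" by (simp add: sym_Q)
  then show "0 \<le> inner g f" by (simp add: pos_QR)
qed

text \<open>Self-adjointness exhibits the graph as an intersection of closed conditions.\<close>

lemma closed_sqrt_graph: "closed sqrt_graph"
proof -
  have "sqrt_graph = (\<Inter>p\<in>sqrt_graph. {q. inner (snd p) (fst q) = inner (fst p) (snd q)})"
  proof (intro subset_antisym subsetI)
    fix p assume "p \<in> sqrt_graph"
    then show "p \<in> (\<Inter>p\<in>sqrt_graph. {q. inner (snd p) (fst q) = inner (fst p) (snd q)})"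
      using sqrt_graph_symmetric[of _ _ "fst p" "snd p"] by simp
  next
    fix p assume *: "p \<in> (\<Inter>p\<in>sqrt_graph. {q. inner (snd p) (fst q) = inner (fst p) (snd q)})"
    have "(fst p, snd p) \<in> sqrt_graph" by (rule sqrt_graph_selfadjoint) (use * in fastforce)
    then show "p \<in> sqrt_graph" by simp
  qed
  moreover have "closed (\<Inter>p\<in>sqrt_graph. {q. inner (snd p) (fst q) = inner (fst p) (snd q)})"
    by (intro closed_INT ballI closed_Collect_eq continuous_intros)
  ultimately show ?thesis by simp
qed

lemma sqrt_graph_square: "sqrt_graph O sqrt_graph = op_graph"
proof (intro set_eqI iffI)
  fix p assume "p \<in> sqrt_graph O sqrt_graph"
  then obtain u v where p: "p = (Q u, R v)" "R u = Q v" by (auto simp: sqrt_graph_def)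
  define h where "h = Q u + R v"
  have "Q h = Q (Q u) + R (Q v)" by (simp add: h_def blinfun.bilinear_simps RQ)
  then have "Q h = u" by (simp add: Q_Q_R flip: p(2))
  then have "B h = Q u" by (metis QQ)
  then show "p \<in> op_graph" using p(1) by (simp add: op_graph_iff h_def)
next
  fix p assume "p \<in> op_graph"
  then obtain h where p: "p = (B h, h - B h)" by (auto simp: op_graph_def)
  have "(B h, R (Q h)) \<in> sqrt_graph" by (auto simp: sqrt_graph_def image_iff QQ[symmetric])
  moreover have "(R (Q h), h - B h) \<in> sqrt_graph"
    by (auto simp: sqrt_graph_def image_iff RQ RR[symmetric])
  ultimately show "p \<in> sqrt_graph O sqrt_graph" using p by blast
qed

text \<open>Pairs \<open>(Q u, R u)\<close> with \<open>u\<close> in the dense range of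
  \<open>Q\<close> suffice: for \<open>u = Q k\<close> the first component is \<open>B k\<close>,
  which lies in the domain of the operator.\<close>

lemma op_graph_core:
  assumes "(f, g) \<in> sqrt_graph"
  shows "\<exists>F G. (\<forall>n. (F n, G n) \<in> sqrt_graph \<and> F n \<in> Domain op_graph) \<and> F \<longlonglongrightarrow> f \<and> G \<longlonglongrightarrow> g"
proof -
  obtain u where u: "f = Q u" "g = R u" using assms by (auto simp: sqrt_graph_def)
  obtain h where h: "\<And>n. h n \<in> range Q" "h \<longlonglongrightarrow> u"
    using dense_range_Q closure_sequential by (metis UNIV_I)
  have "(\<lambda>n. Q (h n)) \<longlonglongrightarrow> f" "(\<lambda>n. R (h n)) \<longlonglongrightarrow> g"
    unfolding u by (intro blinfun.tendsto h tendsto_const)+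
  moreover have "(Q (h n), R (h n)) \<in> sqrt_graph \<and> Q (h n) \<in> Domain op_graph" for n
    using h(1)[of n] by (auto simp: sqrt_graph_def op_graph_def QQ Domain_iff image_iff)
  ultimately show ?thesis
    by (intro exI[of _ "\<lambda>n. Q (h n)"] exI[of _ "\<lambda>n. R (h n)"]) auto
qed

lemma sqrt_graph_commute:
  fixes J :: "'a \<Rightarrow>\<^sub>L 'a"
  assumes J: "\<And>x. J (B x) = B (J x)" and fg: "(f, g) \<in> sqrt_graph"
  shows "(J f, J g) \<in> sqrt_graph"
  using fg Q_commute[of J, OF J] R_commute[of J, OF J] by (auto simp: sqrt_graph_def)

text \<open>\<open>T\<close> after \<open>B\<close> is a bounded operator \<open>K\<close> with
  \<open>K K = B - B B\<close>, hence the positive root \<open>Q R\<close> by uniqueness for bounded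
  operators. So \<open>T\<close> contains a core of \<open>sqrt_graph\<close>, by closedness all of
  it, and a symmetric extension of a self-adjoint operator is that operator.\<close>

lemma sqrt_graph_unique:
  assumes T: "subspace T" "closed T" "\<And>f g u v. (f, g) \<in> T \<Longrightarrow> (u, v) \<in> T \<Longrightarrow> inner g u = inner f v"
    and nonneg: "\<And>f g. (f, g) \<in> T \<Longrightarrow> 0 \<le> inner g f"
    and TT: "T O T = op_graph"
  shows "T = sqrt_graph"
proof -
  \<comment> \<open>A value of \<open>T\<close> at 0 is orthogonal to the domain of
    \<open>T\<close>, which contains the dense range of \<open>B\<close>.\<close>
  have single: "g = g'" if "(f, g) \<in> T" "(f, g') \<in> T" for f g g'
  proof -
    have "(0, g - g') \<in> T" using subspace_diff[OF T(1) that] by simp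
    then have "inner (g - g') q = 0" if "q \<in> range B" for q
    proof -
      from \<open>q \<in> range B\<close> obtain h where "q = B h" ..
      then have "(q, h - B h) \<in> op_graph" by (auto simp: op_graph_def)
      then obtain v where "(q, v) \<in> T" using TT by blast
      then show ?thesis using T(3)[OF \<open>(0, g - g') \<in> T\<close>] by simp
    qed
    then have "g - g' = 0" using orthogonal_to_dense[OF dense_range_B] by blast
    then show ?thesis by simp
  qed
  have "\<exists>g. (B h, g) \<in> T \<and> (g, h - B h) \<in> T" for h
  proof -
    have "(B h, h - B h) \<in> T O T" using TT by (simp add: op_graph_def)
    then show ?thesis by blast
  qed
  then obtain k where k: "\<And>h. (B h, k h) \<in> T" "\<And>h. (k h, h - B h) \<in> T" by metis
  have k_bd: "norm (k h) \<le> norm h * 1" for h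
  proof -
    have "(norm (k h))\<^sup>2 = inner (B h) (h - B h)"
      unfolding power2_norm_eq_inner by (rule T(3)[OF k])
    also have "\<dots> \<le> norm (B h) * norm (h - B h)" by (rule norm_cauchy_schwarz)
    also have "\<dots> \<le> norm h * norm h"
    proof (rule mult_mono)
      show "norm (B h) \<le> norm h"
        using norm_blinfun[of B h] mult_right_mono[OF norm_B norm_ge_zero[of h]] by simp
      show "norm (h - B h) \<le> norm h"
        using norm_blinfun[of "id_blinfun - B" h] mult_right_mono[OF norm_compl norm_ge_zero[of h]]
        by (simp add: blinfun.bilinear_simps)
    qed auto
    finally show ?thesis by (simp add: power2_eq_square[symmetric] power2_le_iff_abs_le)
  qed
  have "bounded_linear k"
  proof (rule bounded_linear_intro[OF _ _ k_bd])
    show "k (x + y) = k x + k y" for x y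
      using single[OF k(1)[of "x + y"]] subspace_add[OF T(1) k(1)[of x] k(1)[of y]]
      by (simp add: blinfun.bilinear_simps)
    show "k (r *\<^sub>R x) = r *\<^sub>R k x" for r x
      using single[OF k(1)[of "r *\<^sub>R x"]] subspace_scale[OF T(1) k(1)[of x], of r]
      by (simp add: blinfun.bilinear_simps)
  qed
  define K where "K = Blinfun k"
  have K: "K x = k x" for x using \<open>bounded_linear k\<close> by (simp add: K_def bounded_linear_Blinfun_apply)
  \<comment> \<open>\<open>T\<close> commutes with its square: the chain from \<open>k (B h)\<close>
    over \<open>B h - B (B h)\<close> to \<open>k h - k (B h)\<close> stays in \<open>T\<close>, so
    its ends form a pair of \<open>op_graph\<close>.\<close>
  have comm: "K (B h) = B (K h)" for h
  proof -
    have "(B h - B (B h), k h - k (B h)) \<in> T" using subspace_diff[OF T(1) k(1)[of h] k(1)[of "B h"]] by simp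
    then have "(k (B h), k h - k (B h)) \<in> op_graph" using k(2)[of "B h"] TT by blast
    then show ?thesis by (simp add: op_graph_iff K)
  qed
  have K_sym: "inner (K x) y = inner x (K y)" for x y
  proof -
    have "inner (k x) (B y) = inner (B x) (k y)" by (rule T(3)) (rule k)+
    moreover have "inner (x - B x) (k y) = inner (k x) (y - B y)" by (rule T(3)) (rule k)+
    ultimately show ?thesis by (simp add: K inner_simps)
  qed
  have K_pos: "0 \<le> inner (K x) x" for x
  proof -
    have "0 \<le> inner (k x) (B x)" "0 \<le> inner (x - B x) (k x)" using nonneg k by blast+
    then show ?thesis by (simp add: K inner_simps inner_commute)
  qed
  have KK: "K (K h) = B h - B (B h)" for h
  proof -
    have "(k (B h), k (k h)) \<in> T" using k(1)[of "k h"] comm[of h] by (simp add: K)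
    then show ?thesis using single k(2) by (simp add: K)
  qed
  have K_Q: "K (Q x) = Q (K x)" and K_R: "K (R x) = R (K x)" for x
    using comm by (auto intro: Q_commute R_commute)
  have "K x = (Q o\<^sub>L R) x" for x
  proof (rule positive_square_root_unique[OF K_sym K_pos])
    show "inner ((Q o\<^sub>L R) x) y = inner x ((Q o\<^sub>L R) y)" for x y by (simp add: sym_Q sym_R RQ)
    show "0 \<le> inner ((Q o\<^sub>L R) x) x" for x using pos_QR by simp
    show "K (K x) = (Q o\<^sub>L R) ((Q o\<^sub>L R) x)" for x
      by (simp add: KK RQ RR QQ blinfun.bilinear_simps)
    show "K ((Q o\<^sub>L R) x) = (Q o\<^sub>L R) (K x)" for x by (simp add: K_Q K_R)
  qed
  then have QR_T: "(B h, Q (R h)) \<in> T" for h using k(1)[of h] K by simp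
  have ST: "sqrt_graph \<subseteq> T"
  proof
    fix p assume "p \<in> sqrt_graph"
    then obtain u where p: "p = (Q u, R u)" by (auto simp: sqrt_graph_def)
    obtain h where h: "\<And>n. h n \<in> range Q" "h \<longlonglongrightarrow> u"
      using dense_range_Q closure_sequential by (metis UNIV_I)
    have "(\<lambda>n. (Q (h n), R (h n))) \<longlonglongrightarrow> (Q u, R u)"
      by (intro tendsto_Pair blinfun.tendsto h tendsto_const)
    moreover have "(Q (h n), R (h n)) \<in> T" for n
      using h(1)[of n] QR_T by (auto simp: QQ RQ)
    ultimately show "p \<in> T"
      using closed_sequentially[OF T(2), of "\<lambda>n. (Q (h n), R (h n))"] p by simp
  qed
  moreover have "T \<subseteq> sqrt_graph"
  proof
    fix p assume "p \<in> T"
    then show "p \<in> sqrt_graph"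
      using sqrt_graph_selfadjoint[of "fst p" "snd p"] T(3) ST by (metis prod.collapse subsetD)
  qed
  ultimately show ?thesis by blast
qed

end

section \<open>One-parameter groups of isometries and their generators\<close>

lemma filterlim_uminus_at_0: "filterlim uminus (at (0::real)) (at 0)"
  using filtermap_at_minus[of "0::real"] by (simp add: filterlim_def)

lemma has_vector_derivative_iff_quotient:
  "(f has_vector_derivative f') (at x) \<longleftrightarrow> ((\<lambda>h. (f (x + h) - f x) /\<^sub>R h) \<longlongrightarrow> f') (at 0)"
proof -
  have eq: "norm (f (x + h) - f x - h *\<^sub>R f') / norm h = norm ((f (x + h) - f x) /\<^sub>R h - f')"
    if "h \<noteq> 0" for h
  proof -
    have "(f (x + h) - f x) /\<^sub>R h - f' = inverse h *\<^sub>R (f (x + h) - f x - h *\<^sub>R f')"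
      using that by (simp add: scaleR_diff_right)
    then show ?thesis by (simp add: divide_inverse)
  qed
  have "(f has_vector_derivative f') (at x)
      \<longleftrightarrow> ((\<lambda>h. norm (f (x + h) - f x - h *\<^sub>R f') / norm h) \<longlongrightarrow> 0) (at 0)"
    unfolding has_vector_derivative_def has_derivative_at by (simp add: bounded_linear_scaleR_left)
  also have "\<dots> \<longleftrightarrow> ((\<lambda>h. norm ((f (x + h) - f x) /\<^sub>R h - f')) \<longlongrightarrow> 0) (at 0)"
    by (rule filterlim_cong) (auto simp: eventually_at eq[unfolded real_norm_def] intro!: exI[of _ 1])
  also have "\<dots> \<longleftrightarrow> ((\<lambda>h. (f (x + h) - f x) /\<^sub>R h) \<longlongrightarrow> f') (at 0)"
    by (simp add: tendsto_norm_zero_iff LIM_zero_iff)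
  finally show ?thesis .
qed

lemmas has_vector_derivative_quotient_tendsto = has_vector_derivative_iff_quotient[THEN iffD1]

definition gen :: "(real \<Rightarrow> 'a \<Rightarrow> 'a::real_normed_vector) \<Rightarrow> ('a \<times> 'a) set" where
  "gen U = {(f, g). ((\<lambda>t. (U t f - f) /\<^sub>R t) \<longlongrightarrow> g) (at 0)}"

locale isometry_group =
  fixes U :: "real \<Rightarrow> 'a::{real_inner,banach} \<Rightarrow> 'a"
  assumes U_add: "U t (x + y) = U t x + U t y"
    and U_scale: "U t (c *\<^sub>R x) = c *\<^sub>R U t x"
    and U_group: "U (s + t) x = U s (U t x)"
    and U_0: "U 0 x = x"
    and norm_U: "norm (U t x) = norm x"
    and U_tendsto: "((\<lambda>t. U t x) \<longlongrightarrow> x) (at 0)"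
begin

lemma linear_U: "linear (U t)" by (rule linearI) (rule U_add U_scale)+
lemma bounded_linear_U: "bounded_linear (U t)"
  by (rule bounded_linear_intro[of _ 1]) (simp_all add: U_add U_scale norm_U)
lemma U_diff: "U t (x - y) = U t x - U t y" by (rule linear_diff[OF linear_U])

lemma U_inverse: "U (- t) (U t x) = x" "U t (U (- t) x) = x"
  using U_group[of "- t" t x] U_group[of t "- t" x] by (simp_all add: U_0)

lemma U_commute: "U s (U t x) = U t (U s x)"
  by (metis U_group add.commute)

lemma inner_U: "inner (U t x) (U t y) = inner x y"
  by (simp add: dot_norm norm_U flip: U_add)

lemma inner_U_adj: "inner (U t x) y = inner x (U (- t) y)"
  using inner_U[of t x "U (- t) y"] by (simp add: U_inverse)

lemma continuous_on_U: "continuous_on S (\<lambda>t. U t x)"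
proof -
  have "isCont (\<lambda>t. U t x) a" for a
  proof -
    have "((\<lambda>h. U a (U h x)) \<longlongrightarrow> U a x) (at 0)"
      using bounded_linear.tendsto[OF bounded_linear_U U_tendsto] .
    then show ?thesis by (simp add: isCont_def LIM_offset_zero_iff[of a] flip: U_group)
  qed
  then show ?thesis by (simp add: continuous_at_imp_continuous_on)
qed

abbreviation D :: "('a \<times> 'a) set" where "D \<equiv> gen U"

lemma gen_iff: "(f, g) \<in> D \<longleftrightarrow> ((\<lambda>t. (U t f - f) /\<^sub>R t) \<longlongrightarrow> g) (at 0)"
  by (simp add: gen_def)

lemma gen_unique: "(f, g) \<in> D \<Longrightarrow> (f, g') \<in> D \<Longrightarrow> g = g'"
  unfolding gen_iff using LIM_unique by blast

lemma subspace_gen: "subspace D"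
  unfolding subspace_def
proof (safe)
  show "0 \<in> D" using linear_0[OF linear_U] by (simp add: gen_iff zero_prod_def)
next
  fix f g f' g' assume "(f, g) \<in> D" "(f', g') \<in> D"
  then have "((\<lambda>t. (U t f - f) /\<^sub>R t + (U t f' - f') /\<^sub>R t) \<longlongrightarrow> g + g') (at 0)"
    unfolding gen_iff by (rule tendsto_add)
  then show "(f, g) + (f', g') \<in> D" by (simp add: gen_iff U_add scaleR_add_right[symmetric] add_diff_add)
next
  fix c f g assume "(f, g) \<in> D"
  then have "((\<lambda>t. c *\<^sub>R ((U t f - f) /\<^sub>R t)) \<longlongrightarrow> c *\<^sub>R g) (at 0)"
    unfolding gen_iff by (intro tendsto_intros)
  then show "c *\<^sub>R (f, g) \<in> D" by (simp add: gen_iff U_scale scaleR_diff_right mult.commute)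
qed

lemma gen_bounded_linear:
  assumes "(f, g) \<in> D" "bounded_linear T" "\<And>t. U t (T f) = T (U t f)"
  shows "(T f, T g) \<in> D"
proof -
  interpret T: bounded_linear T by fact
  have "((\<lambda>t. T ((U t f - f) /\<^sub>R t)) \<longlongrightarrow> T g) (at 0)"
    using assms(1) unfolding gen_iff by (rule T.tendsto)
  then show ?thesis by (simp add: gen_iff assms(3) T.scaleR T.diff)
qed

lemma gen_U: "(f, g) \<in> D \<Longrightarrow> (U t f, U t g) \<in> D"
  by (rule gen_bounded_linear) (auto intro: bounded_linear_U U_commute)

lemma has_vector_derivative_U:
  assumes "(f, g) \<in> D"
  shows "((\<lambda>s. U s f) has_vector_derivative U t g) (at t)"
  using gen_U[OF assms, of t]
  by (simp add: has_vector_derivative_iff_quotient gen_iff add.commute[of t] U_group)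

text \<open>The scalar mean value theorem for \<open>inner (U s f) w\<close>. The point
  \<open>\<xi>\<close> depends on \<open>w\<close>, since a vector-valued function need not have a
  mean value point.\<close>

lemma gen_mean_value:
  assumes "(f, g) \<in> D"
  shows "\<exists>\<xi>. \<bar>\<xi>\<bar> \<le> \<bar>t\<bar> \<and> inner (U t f - f) w = t * inner (U \<xi> g) w"
proof -
  have der: "((\<lambda>s. inner (U s f) w) has_real_derivative inner (U s g) w) (at s)" for s
  proof -
    have "((\<lambda>s. inner (U s f) w) has_vector_derivative inner (U s g) w) (at s)"
      by (rule bounded_linear.has_vector_derivative[OF bounded_linear_inner_left has_vector_derivative_U[OF assms]])
    then show ?thesis by (simp add: has_real_derivative_iff_has_vector_derivative)
  qed
  consider "t = 0" | "0 < t" | "t < 0" by linarith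
  then show ?thesis
  proof cases
    case 1
    then show ?thesis by (intro exI[of _ 0]) (simp add: U_0)
  next
    case 2
    then obtain z where z: "0 < z" "z < t" "inner (U t f) w - inner (U 0 f) w = (t - 0) * inner (U z g) w"
      using MVT2[of 0 t "\<lambda>s. inner (U s f) w" "\<lambda>s. inner (U s g) w"] der by blast
    then show ?thesis using 2 by (intro exI[of _ z]) (simp add: U_0 inner_diff_left)
  next
    case 3
    then obtain z where z: "t < z" "z < 0" "inner (U 0 f) w - inner (U t f) w = (0 - t) * inner (U z g) w"
      using MVT2[of t 0 "\<lambda>s. inner (U s f) w" "\<lambda>s. inner (U s g) w"] der by blast
    then show ?thesis using 3 by (intro exI[of _ z]) (simp add: U_0 inner_diff_left)
  qed
qed

text \<open>The mean value theorem tested against \<open>U t f - f\<close> itself.\<close>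

lemma norm_U_diff_le:
  assumes "(f, g) \<in> D"
  shows "norm (U t f - f) \<le> \<bar>t\<bar> * norm g"
proof -
  obtain \<xi> where "inner (U t f - f) (U t f - f) = t * inner (U \<xi> g) (U t f - f)"
    using gen_mean_value[OF assms] by blast
  also have "\<dots> \<le> \<bar>t\<bar> * (norm (U \<xi> g) * norm (U t f - f))"
    by (rule order_trans[OF abs_ge_self]) (simp add: abs_mult mult_left_mono Cauchy_Schwarz_ineq2)
  finally have "norm (U t f - f) * norm (U t f - f) \<le> (\<bar>t\<bar> * norm g) * norm (U t f - f)"
    by (simp add: norm_U power2_norm_eq_inner[symmetric] power2_eq_square mult.assoc)
  then show ?thesis by (cases "U t f - f = 0") auto
qed

text \<open>Isometry moves \<open>U t\<close> to the other side as \<open>U (- t)\<close>, which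
  reverses the sign of the difference quotient.\<close>

lemma gen_skew:
  assumes "(f, g) \<in> D" "(u, v) \<in> D"
  shows "inner g u = - inner f v"
proof (rule LIM_unique)
  show "((\<lambda>t. inner ((U t f - f) /\<^sub>R t) u) \<longlongrightarrow> inner g u) (at 0)"
    using assms(1) unfolding gen_iff by (intro tendsto_intros)
  have "((\<lambda>t. (U (- t) u - u) /\<^sub>R (- t)) \<longlongrightarrow> v) (at 0)"
    using filterlim_compose[OF assms(2)[unfolded gen_iff] filterlim_uminus_at_0] .
  then have "((\<lambda>t. - inner f ((U (- t) u - u) /\<^sub>R (- t))) \<longlongrightarrow> - inner f v) (at 0)"
    by (intro tendsto_intros)
  moreover have "- inner f ((U (- t) u - u) /\<^sub>R (- t)) = inner ((U t f - f) /\<^sub>R t) u" for t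
  proof -
    have "inner (U t f - f) u = inner f (U (- t) u - u)"
      by (simp add: inner_diff_left inner_diff_right inner_U_adj)
    then show ?thesis by simp
  qed
  ultimately show "((\<lambda>t. inner ((U t f - f) /\<^sub>R t) u) \<longlongrightarrow> - inner f v) (at 0)"
    by (simp only:)
qed

lemma gen_integral:
  assumes a: "0 \<le> a"
  shows "(integral {0..a} (\<lambda>s. U s u), U a u - u) \<in> D"
proof -
  \<comment> \<open>The antiderivative starts at -1 rather than 0, so that 0 is an interior point
    and the derivative there is two-sided.\<close>
  define \<Phi> where "\<Phi> r = integral {-1..r} (\<lambda>s. U s u)" for r
  have int: "(\<lambda>s. U s u) integrable_on {b..c}" for b c
    by (intro integrable_continuous_real continuous_on_U)
  have \<Phi>: "integral {b..c} (\<lambda>s. U s u) = \<Phi> c - \<Phi> b" if "-1 \<le> b" "b \<le> c" for b c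
    using Henstock_Kurzweil_Integration.integral_combine[OF that int] by (simp add: \<Phi>_def algebra_simps)
  have der: "((\<lambda>h. (\<Phi> (x + h) - \<Phi> x) /\<^sub>R h) \<longlongrightarrow> U x u) (at 0)" if "-1 < x" for x
  proof (rule has_vector_derivative_quotient_tendsto)
    have "(\<Phi> has_vector_derivative U x u) (at x within {-1..x+1})"
      unfolding \<Phi>_def using that by (intro integral_has_vector_derivative continuous_on_U) auto
    then show "(\<Phi> has_vector_derivative U x u) (at x)"
      using that by (simp add: at_within_Icc_at)
  qed
  have "((\<lambda>h. (\<Phi> (a + h) - \<Phi> a) /\<^sub>R h - (\<Phi> (0 + h) - \<Phi> 0) /\<^sub>R h) \<longlongrightarrow> U a u - U 0 u) (at 0)"
    using a by (intro tendsto_diff der) auto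
  then have "((\<lambda>t. (U t (integral {0..a} (\<lambda>s. U s u)) - integral {0..a} (\<lambda>s. U s u)) /\<^sub>R t)
      \<longlongrightarrow> U a u - U 0 u) (at 0)"
  proof (rule Lim_transform_eventually)
    have "U t (integral {0..a} (\<lambda>s. U s u)) = \<Phi> (a + t) - \<Phi> t" if "\<bar>t\<bar> < 1" for t
    proof -
      have "U t (integral {0..a} (\<lambda>s. U s u)) = integral {0..a} (U t \<circ> (\<lambda>s. U s u))"
        using integral_linear[OF int bounded_linear_U] by simp
      also have "U t \<circ> (\<lambda>s. U s u) = (\<lambda>s. U s u) \<circ> (+) t" by (auto simp: U_group)
      also have "integral {0..a} \<dots> = integral {0 + t..a + t} (\<lambda>s. U s u)"
        by (rule integral_shift_Icc_real)
      finally show ?thesis using \<Phi>[of t "a + t"] that a by simp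
    qed
    note shift = this
    have "(\<Phi> (a + t) - \<Phi> a) /\<^sub>R t - (\<Phi> (0 + t) - \<Phi> 0) /\<^sub>R t
        = (U t (integral {0..a} (\<lambda>s. U s u)) - integral {0..a} (\<lambda>s. U s u)) /\<^sub>R t"
      if "\<bar>t\<bar> < 1" for t
      unfolding shift[OF that] using \<Phi>[of 0 a] a by (simp add: algebra_simps flip: scaleR_diff_right)
    then show "\<forall>\<^sub>F t in at 0. (\<Phi> (a + t) - \<Phi> a) /\<^sub>R t - (\<Phi> (0 + t) - \<Phi> 0) /\<^sub>R t
        = (U t (integral {0..a} (\<lambda>s. U s u)) - integral {0..a} (\<lambda>s. U s u)) /\<^sub>R t"
      unfolding eventually_at by (intro exI[of _ 1]) auto
  qed
  then show ?thesis by (simp add: gen_iff U_0)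
qed

lemma integral_mean_tendsto:
  "(\<lambda>n. integral {0..1 / real (Suc n)} (\<lambda>s. U s u) /\<^sub>R (1 / real (Suc n))) \<longlonglongrightarrow> u"
proof -
  have "((\<lambda>r. integral {-1..r} (\<lambda>s. U s u)) has_vector_derivative U 0 u) (at 0 within {-1..1})"
    by (intro integral_has_vector_derivative continuous_on_U) auto
  then have "((\<lambda>r. integral {-1..r} (\<lambda>s. U s u)) has_vector_derivative U 0 u) (at 0)"
    by (simp add: at_within_Icc_at)
  then have "((\<lambda>h. (integral {-1..0 + h} (\<lambda>s. U s u) - integral {-1..0} (\<lambda>s. U s u)) /\<^sub>R h) \<longlongrightarrow> U 0 u) (at 0)"
    by (rule has_vector_derivative_quotient_tendsto)
  moreover have "filterlim (\<lambda>n. 1 / real (Suc n)) (at 0) sequentially"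
    using LIMSEQ_inverse_real_of_nat by (simp add: filterlim_at inverse_eq_divide)
  ultimately have "(\<lambda>n. (integral {-1..0 + 1 / real (Suc n)} (\<lambda>s. U s u) - integral {-1..0} (\<lambda>s. U s u))
      /\<^sub>R (1 / real (Suc n))) \<longlonglongrightarrow> U 0 u"
    by (rule filterlim_compose)
  moreover have "integral {-1..0 + 1 / real (Suc n)} (\<lambda>s. U s u) - integral {-1..0} (\<lambda>s. U s u)
      = integral {0..1 / real (Suc n)} (\<lambda>s. U s u)" for n
    using Henstock_Kurzweil_Integration.integral_combine[of "-1" 0 "1 / real (Suc n)" "\<lambda>s. U s u"]
      integrable_continuous_real[OF continuous_on_U] by (simp add: algebra_simps)
  ultimately show ?thesis by (simp add: U_0)
qed

lemma dense_Domain_gen: "closure (Domain D) = UNIV"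
proof -
  have "u \<in> closure (Domain D)" for u
    unfolding closure_sequential
  proof (intro exI conjI allI)
    show "(\<lambda>n. integral {0..1 / real (Suc n)} (\<lambda>s. U s u) /\<^sub>R (1 / real (Suc n))) \<longlonglongrightarrow> u"
      by (rule integral_mean_tendsto)
    show "integral {0..1 / real (Suc n)} (\<lambda>s. U s u) /\<^sub>R (1 / real (Suc n)) \<in> Domain D" for n
      using subspace_scale[OF subspace_gen gen_integral[of "1 / real (Suc n)" u], of "inverse (1 / real (Suc n))"]
      by (auto simp del: of_nat_Suc)
  qed
  then show ?thesis by blast
qed

text \<open>The mean value theorem along the orbits of \<open>f\<close>, tested against a dense set of \<open>f\<close>, turns the
  weak derivative \<open>v\<close> of the orbit of \<open>u\<close> into a norm derivative.\<close>
lemma gen_skew_adjoint: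
  assumes uv: "\<And>f g. (f, g) \<in> D \<Longrightarrow> inner g u = - inner f v"
  shows "(u, v) \<in> D"
proof -
  have bound: "norm (U t u - u - t *\<^sub>R v) \<le> \<bar>t\<bar> * e"
    if e: "\<And>\<xi>. \<bar>\<xi>\<bar> \<le> \<bar>t\<bar> \<Longrightarrow> norm (U \<xi> v - v) \<le> e" for t e
  proof (rule norm_le_by_dense[OF dense_Domain_gen])
    show "0 \<le> \<bar>t\<bar> * e" using order_trans[OF norm_ge_zero e[of 0]] by simp
    fix f assume "f \<in> Domain D"
    then obtain g where fg: "(f, g) \<in> D" by blast
    obtain \<xi> where \<xi>: "\<bar>\<xi>\<bar> \<le> \<bar>- t\<bar>" "inner (U (- t) f - f) u = (- t) * inner (U \<xi> g) u"
      using gen_mean_value[OF fg] by blast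
    have "inner (U t u - u) f = inner (U (- t) f - f) u"
      by (simp only: inner_diff_left inner_U_adj[of t] inner_commute[of u])
    also have "\<dots> = t * inner (U \<xi> f) v" using \<xi>(2) uv[OF gen_U[OF fg]] by simp
    also have "inner (U \<xi> f) v = inner (U (- \<xi>) v) f" 
      by (metis inner_U_adj inner_commute)
    finally have "inner (U t u - u - t *\<^sub>R v) f = t * inner (U (- \<xi>) v - v) f"
      by (simp add: inner_diff_left right_diff_distrib)
    also have "\<dots> \<le> \<bar>t\<bar> * (norm (U (- \<xi>) v - v) * norm f)"
      by (rule order_trans[OF abs_ge_self]) (simp add: abs_mult mult_left_mono Cauchy_Schwarz_ineq2)
    also have "\<dots> \<le> \<bar>t\<bar> * (e * norm f)"
      using e[of "- \<xi>"] \<xi>(1) by (intro mult_left_mono mult_right_mono) auto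
    finally show "inner (U t u - u - t *\<^sub>R v) f \<le> \<bar>t\<bar> * e * norm f" by (simp add: mult.assoc)
  qed
  show ?thesis unfolding gen_iff
  proof (rule LIM_I)
    fix r :: real assume r: "0 < r"
    obtain d where d: "0 < d" "\<And>t. t \<noteq> 0 \<Longrightarrow> \<bar>t\<bar> < d \<Longrightarrow> norm (U t v - v) < r / 2"
      using LIM_D[OF U_tendsto[of v], of "r / 2"] r by auto
    have "norm ((U t u - u) /\<^sub>R t - v) < r" if t: "t \<noteq> 0" "\<bar>t\<bar> < d" for t
    proof -
      have "norm (U \<xi> v - v) \<le> r / 2" if "\<bar>\<xi>\<bar> \<le> \<bar>t\<bar>" for \<xi>
        using d(2)[of \<xi>] that t r by (cases "\<xi> = 0") (auto simp: U_0)
      then have "norm (U t u - u - t *\<^sub>R v) \<le> \<bar>t\<bar> * (r / 2)" by (rule bound)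
      moreover have "(U t u - u) /\<^sub>R t - v = (U t u - u - t *\<^sub>R v) /\<^sub>R t"
        using t by (simp add: scaleR_diff_right)
      ultimately have "norm ((U t u - u) /\<^sub>R t - v) \<le> inverse \<bar>t\<bar> * (\<bar>t\<bar> * (r / 2))"
        by (simp only: norm_scaleR abs_inverse) (intro mult_left_mono, auto)
      also have "\<dots> < r" using t r by simp
      finally show ?thesis .
    qed
    then show "\<exists>s>0. \<forall>x. x \<noteq> 0 \<and> norm (x - 0) < s \<longrightarrow> norm ((U x u - u) /\<^sub>R x - v) < r"
      using d(1) by auto
  qed
qed

text \<open>As for a self-adjoint operator, skew-adjointness describes the graph by closed
  conditions.\<close>

lemma closed_gen: "closed D"
proof -
  have "D = (\<Inter>p\<in>D. {q. inner (snd p) (fst q) = - inner (fst p) (snd q)})"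
  proof (intro subset_antisym subsetI)
    fix p assume "p \<in> D"
    then show "p \<in> (\<Inter>p\<in>D. {q. inner (snd p) (fst q) = - inner (fst p) (snd q)})"
      using gen_skew[of _ _ "fst p" "snd p"] by simp
  next
    fix p assume *: "p \<in> (\<Inter>p\<in>D. {q. inner (snd p) (fst q) = - inner (fst p) (snd q)})"
    have "(fst p, snd p) \<in> D" by (rule gen_skew_adjoint) (use * in fastforce)
    then show "p \<in> D" by simp
  qed
  moreover have "closed (\<Inter>p\<in>D. {q. inner (snd p) (fst q) = - inner (fst p) (snd q)})"
    by (intro closed_INT ballI closed_Collect_eq continuous_intros)
  ultimately show ?thesis by simp
qed

lemma gen_limit:
  assumes "\<And>n. (f n, g n) \<in> D" "f \<longlonglongrightarrow> a" "g \<longlonglongrightarrow> b"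
  shows "(a, b) \<in> D"
  using closed_sequentially[OF closed_gen, of "\<lambda>n. (f n, g n)"] tendsto_Pair[OF assms(2,3)] assms(1) by blast

text \<open>Takes the place of weak compactness: bounded derivatives make \<open>inner d w'\<close>,
  as a function of \<open>w\<close>, a bounded functional on the domain, and by skew-adjointness
  minus its Riesz vector is the derivative of \<open>d\<close>.\<close>

lemma gen_bounded_limit:
  assumes fg: "\<And>n. (f n, g n) \<in> D" and lim: "f \<longlonglongrightarrow> d" and C: "\<And>n. norm (g n) \<le> C"
  shows "\<exists>v. (d, v) \<in> D \<and> norm v \<le> C"
proof -
  have bd: "\<bar>inner d w'\<bar> \<le> C * norm w" if "(w, w') \<in> D" for w w'
  proof (rule LIMSEQ_le_const2)
    show "(\<lambda>n. \<bar>inner (f n) w'\<bar>) \<longlonglongrightarrow> \<bar>inner d w'\<bar>" by (intro tendsto_intros lim)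
    have "\<bar>inner (f n) w'\<bar> \<le> C * norm w" for n
    proof -
      have "\<bar>inner (f n) w'\<bar> = \<bar>inner (g n) w\<bar>" using gen_skew[OF fg[of n] that] by simp
      also have "\<dots> \<le> norm (g n) * norm w" by (rule Cauchy_Schwarz_ineq2)
      also have "\<dots> \<le> C * norm w" using C by (intro mult_right_mono) auto
      finally show ?thesis .
    qed
    then show "\<exists>N. \<forall>n\<ge>N. \<bar>inner (f n) w'\<bar> \<le> C * norm w" by blast
  qed
  define G where "G = (\<lambda>(w, w'). (w, inner d w')) ` D"
  have "linear (\<lambda>(w, w'). (w, inner d w'))"
    by (rule linearI) (auto simp: inner_simps)
  then have "subspace G" unfolding G_def using subspace_gen by (rule linear_subspace_image)
  moreover have "\<bar>r\<bar> \<le> C * norm w" if "(w, r) \<in> G" for w r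
    using that bd by (auto simp: G_def)
  ultimately obtain v where v: "\<forall>(w, r)\<in>G. r = inner v w" using riesz_on_subspace by blast
  have v': "inner d w' = inner v w" if "(w, w') \<in> D" for w w'
    using v that by (auto simp: G_def)
  have "(d, - v) \<in> D"
    by (rule gen_skew_adjoint) (use v' in \<open>auto simp: inner_commute\<close>)
  moreover have "norm v \<le> C"
  proof (rule norm_le_by_dense[OF dense_Domain_gen])
    show "0 \<le> C" using C[of 0] norm_ge_zero order_trans by blast
    show "inner v w \<le> C * norm w" if "w \<in> Domain D" for w
      using that bd v' by force
  qed
  ultimately show ?thesis by (metis norm_minus_cancel)
qed

end

section \<open>Isometric representations of the affine group\<close>

lemma filterlim_inverse_Suc_at_0: "filterlim (\<lambda>n. 1 / real (Suc n)) (at 0) sequentially"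
  using LIMSEQ_inverse_real_of_nat by (simp add: filterlim_at inverse_eq_divide)

locale affine_rep = G1: isometry_group U1 + G2: isometry_group U2
  for U1 U2 :: "real \<Rightarrow> 'a::{real_inner,banach} \<Rightarrow> 'a" +
  assumes U1_U2: "U1 s (U2 t x) = U2 (exp (- s) * t) (U1 s x)"
begin

abbreviation D1 :: "('a \<times> 'a) set" where "D1 \<equiv> gen U1"
abbreviation D2 :: "('a \<times> 'a) set" where "D2 \<equiv> gen U2"

lemma U2_U1: "U2 t (U1 s x) = U1 s (U2 (exp s * t) x)"
  by (simp add: U1_U2 flip: mult.assoc exp_add)

lemma D2_U1:
  assumes "(f, g) \<in> D2"
  shows "(U1 s f, exp s *\<^sub>R U1 s g) \<in> D2"
proof -
  have "filterlim (\<lambda>t. exp s * t) (at 0) (at 0)"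
    by (auto simp: filterlim_at eventually_at intro!: tendsto_eq_intros exI[of _ 1])
  then have "((\<lambda>t. (U2 (exp s * t) f - f) /\<^sub>R (exp s * t)) \<longlongrightarrow> g) (at 0)"
    using assms filterlim_compose unfolding G2.gen_iff by blast
  then have "((\<lambda>t. exp s *\<^sub>R U1 s ((U2 (exp s * t) f - f) /\<^sub>R (exp s * t))) \<longlongrightarrow> exp s *\<^sub>R U1 s g) (at 0)"
    by (intro tendsto_intros bounded_linear.tendsto[OF G1.bounded_linear_U])
  moreover have "exp s *\<^sub>R U1 s ((U2 (exp s * t) f - f) /\<^sub>R (exp s * t)) = (U2 t (U1 s f) - U1 s f) /\<^sub>R t" for t
    by (simp add: U2_U1 G1.U_scale G1.U_diff)
  ultimately show ?thesis unfolding G2.gen_iff by (simp only:)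
qed

text \<open>Differentiate \<open>U2 (exp (- s) * t) (U1 s f)\<close> at \<open>s = 0\<close>: the
  inner group yields \<open>f1\<close>, the moving time \<open>exp (- s) * t\<close> yields
  \<open>f2\<close> with the factor \<open>- t\<close>.\<close>

lemma D1_U2:
  assumes f1: "(f, f1) \<in> D1" and f2: "(f, f2) \<in> D2"
  shows "(U2 t f, U2 t (f1 - t *\<^sub>R f2)) \<in> D1"
proof -
  have "((\<lambda>s. U2 (exp (- s) * t) f) has_vector_derivative (- t) *\<^sub>R U2 (exp (- 0) * t) f2) (at 0)"
  proof (rule vector_diff_chain_at[unfolded o_def])
    show "((\<lambda>s. exp (- s) * t) has_vector_derivative - t) (at 0)"
      unfolding has_real_derivative_iff_has_vector_derivative[symmetric]
      by (auto intro!: derivative_eq_intros)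
    show "((\<lambda>t. U2 t f) has_vector_derivative U2 (exp (- 0) * t) f2) (at (exp (- 0) * t))"
      by (rule G2.has_vector_derivative_U[OF f2])
  qed
  from has_vector_derivative_quotient_tendsto[OF this]
  have q2: "((\<lambda>s. (U2 (exp (- s) * t) f - U2 t f) /\<^sub>R s) \<longlongrightarrow> - t *\<^sub>R U2 t f2) (at 0)" by simp
  \<comment> \<open>The outer operator varies with \<open>s\<close>, but as an isometry it does not
    disturb the convergence of the quotient to \<open>f1\<close>.\<close>
  have q1: "((\<lambda>s. U2 (exp (- s) * t) ((U1 s f - f) /\<^sub>R s)) \<longlongrightarrow> U2 t f1) (at 0)"
  proof -
    have "((\<lambda>s. norm ((U1 s f - f) /\<^sub>R s - f1)) \<longlongrightarrow> 0) (at 0)"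
      using f1 by (simp add: G1.gen_iff LIM_zero_iff tendsto_norm_zero_iff)
    then have "((\<lambda>s. norm (U2 (exp (- s) * t) ((U1 s f - f) /\<^sub>R s) - U2 (exp (- s) * t) f1)) \<longlongrightarrow> 0) (at 0)"
      by (simp only: G2.norm_U flip: G2.U_diff)
    then have "((\<lambda>s. U2 (exp (- s) * t) ((U1 s f - f) /\<^sub>R s) - U2 (exp (- s) * t) f1) \<longlongrightarrow> 0) (at 0)"
      by (rule tendsto_norm_zero_cancel)
    moreover have "((\<lambda>s. U2 (exp (- s) * t) f1) \<longlongrightarrow> U2 (exp (- 0) * t) f1) (at 0)"
    proof (rule isCont_tendsto_compose[of _ "\<lambda>t. U2 t f1"])
      show "isCont (\<lambda>t. U2 t f1) (exp (- 0) * t)"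
        using G2.continuous_on_U[of UNIV f1] by (simp add: continuous_on_eq_continuous_at)
    qed (intro tendsto_intros)
    ultimately have "((\<lambda>s. (U2 (exp (- s) * t) ((U1 s f - f) /\<^sub>R s) - U2 (exp (- s) * t) f1)
        + U2 (exp (- s) * t) f1) \<longlongrightarrow> 0 + U2 (exp (- 0) * t) f1) (at 0)"
      by (rule tendsto_add)
    then show ?thesis by simp
  qed
  have "((\<lambda>s. U2 (exp (- s) * t) ((U1 s f - f) /\<^sub>R s) + (U2 (exp (- s) * t) f - U2 t f) /\<^sub>R s)
      \<longlongrightarrow> U2 t f1 + - t *\<^sub>R U2 t f2) (at 0)"
    by (rule tendsto_add[OF q1 q2])
  then show ?thesis
    by (simp add: G1.gen_iff U1_U2 G2.U_scale G2.U_diff scaleR_diff_right)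
qed

text \<open>The derivative of \<open>D\<^sub>2 U\<^sub>1(s) f = e\<^sup>s U\<^sub>1(s) D\<^sub>2 f\<close> at \<open>s = 0\<close>.\<close>
lemma D2_D1:
  assumes f1: "(f, f1) \<in> D1" and f2: "(f, f2) \<in> D2" and f21: "(f2, f21) \<in> D1"
  shows "(f1, f2 + f21) \<in> D2"
proof (rule G2.gen_limit)
  let ?s = "\<lambda>n. 1 / real (Suc n)"
  show "((U1 (?s n) f - f) /\<^sub>R ?s n, (exp (?s n) *\<^sub>R U1 (?s n) f2 - f2) /\<^sub>R ?s n) \<in> D2" for n
    using subspace_scale[OF G2.subspace_gen subspace_diff[OF G2.subspace_gen D2_U1[OF f2] f2], of "inverse (?s n)" "?s n"]
    by simp
  show "(\<lambda>n. (U1 (?s n) f - f) /\<^sub>R ?s n) \<longlonglongrightarrow> f1"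
    by (rule filterlim_compose[OF f1[unfolded G1.gen_iff] filterlim_inverse_Suc_at_0])
  have "((\<lambda>s. exp s *\<^sub>R U1 s f2) has_vector_derivative exp 0 *\<^sub>R U1 0 f21 + exp 0 *\<^sub>R U1 0 f2) (at 0)"
    by (intro has_vector_derivative_scaleR G1.has_vector_derivative_U f21 DERIV_exp)
  from has_vector_derivative_quotient_tendsto[OF this]
  have "((\<lambda>s. (exp s *\<^sub>R U1 s f2 - f2) /\<^sub>R s) \<longlongrightarrow> f2 + f21) (at 0)"
    by (simp add: G1.U_0 add.commute)
  then show "(\<lambda>n. (exp (?s n) *\<^sub>R U1 (?s n) f2 - f2) /\<^sub>R ?s n) \<longlonglongrightarrow> f2 + f21"
    by (rule filterlim_compose[OF _ filterlim_inverse_Suc_at_0])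
qed

text \<open>Tested weakly against the domain of \<open>D2\<close>, so that skew-adjointness replaces
  differentiation under the integral sign.\<close>

lemma D2_integral:
  assumes f: "(f, g) \<in> D2"
  shows "(integral {0..a} (\<lambda>s. U1 s f), integral {0..a} (\<lambda>s. exp s *\<^sub>R U1 s g)) \<in> D2"
proof (rule G2.gen_skew_adjoint)
  fix w w' assume w: "(w, w') \<in> D2"
  have i1: "(\<lambda>s. U1 s f) integrable_on {0..a}"
    by (intro integrable_continuous_real G1.continuous_on_U)
  have i2: "(\<lambda>s. exp s *\<^sub>R U1 s g) integrable_on {0..a}"
    by (intro integrable_continuous_real continuous_intros G1.continuous_on_U)
  have "inner w' (integral {0..a} (\<lambda>s. U1 s f)) = integral {0..a} (\<lambda>s. inner w' (U1 s f))"
    using integral_linear[OF i1 bounded_linear_inner_right[of w']] by (simp add: o_def)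
  also have "\<dots> = integral {0..a} (\<lambda>s. - inner w (exp s *\<^sub>R U1 s g))"
    by (rule arg_cong[of _ _ "integral _"]) (use G2.gen_skew[OF w D2_U1[OF f]] in blast)
  also have "\<dots> = - inner w (integral {0..a} (\<lambda>s. exp s *\<^sub>R U1 s g))"
    using integral_linear[OF i2 bounded_linear_inner_right[of w]]
    by (simp only: o_def Henstock_Kurzweil_Integration.integral_neg)
  finally show "inner w' (integral {0..a} (\<lambda>s. U1 s f)) = - inner w (integral {0..a} (\<lambda>s. exp s *\<^sub>R U1 s g))" .
qed

text \<open>Averages along \<open>U1\<close> lie in the domain of \<open>D1\<close> and, by
  \<open>D2_integral\<close>, do not leave the dense domain of \<open>D2\<close>.\<close>

lemma dense_form_domain: "closure (Domain D1 \<inter> Domain D2) = UNIV"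
proof -
  have "f \<in> closure (Domain D1 \<inter> Domain D2)" if fD: "f \<in> Domain D2" for f
    unfolding closure_sequential
  proof (intro exI conjI allI IntI)
    let ?v = "\<lambda>n. integral {0..1 / real (Suc n)} (\<lambda>s. U1 s f) /\<^sub>R (1 / real (Suc n))"
    show "?v \<longlonglongrightarrow> f" by (rule G1.integral_mean_tendsto)
    show "?v n \<in> Domain D1" for n
      using subspace_scale[OF G1.subspace_gen G1.gen_integral[of "1 / real (Suc n)" f], of "inverse (1 / real (Suc n))"]
      by (auto simp del: of_nat_Suc)
    obtain g where "(f, g) \<in> D2" using fD by blast
    then show "?v n \<in> Domain D2" for n
      using subspace_scale[OF G2.subspace_gen D2_integral[of f g "1 / real (Suc n)"], of "inverse (1 / real (Suc n))"]
      by (auto simp del: of_nat_Suc)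
  qed
  then have "Domain D2 \<subseteq> closure (Domain D1 \<inter> Domain D2)" by blast
  then have "closure (Domain D2) \<subseteq> closure (Domain D1 \<inter> Domain D2)" by (simp add: closure_minimal)
  then show ?thesis using G2.dense_Domain_gen by blast
qed

section \<open>The Laplacian defined by its quadratic form\<close>

definition form_graph :: "('a \<times> 'a \<times> 'a) set" where
  "form_graph = {(f, f1, f2). (f, f1) \<in> D1 \<and> (f, f2) \<in> D2}"

text \<open>The operator associated with the form, in the weak sense; second derivatives are
  recovered later from regularity.\<close>

definition Lap :: "('a \<times> 'a) set" where
  "Lap = {(f, h). \<exists>f1 f2. (f, f1) \<in> D1 \<and> (f, f2) \<in> D2 \<and>
     (\<forall>g g1 g2. (g, g1) \<in> D1 \<longrightarrow> (g, g2) \<in> D2 \<longrightarrow> inner f1 g1 + inner f2 g2 = inner h g)}"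

lemma LapI:
  assumes "(f, f1) \<in> D1" "(f, f2) \<in> D2"
    "\<And>g g1 g2. (g, g1) \<in> D1 \<Longrightarrow> (g, g2) \<in> D2 \<Longrightarrow> inner f1 g1 + inner f2 g2 = inner h g"
  shows "(f, h) \<in> Lap"
  using assms unfolding Lap_def by blast

lemma LapD:
  assumes "(f, h) \<in> Lap" "(f, f1) \<in> D1" "(f, f2) \<in> D2" "(g, g1) \<in> D1" "(g, g2) \<in> D2"
  shows "inner f1 g1 + inner f2 g2 = inner h g"
  using assms G1.gen_unique G2.gen_unique unfolding Lap_def by blast

lemma Lap_domain:
  assumes "(f, h) \<in> Lap"
  obtains f1 f2 where "(f, f1) \<in> D1" "(f, f2) \<in> D2"
  using assms unfolding Lap_def by blast

lemma subspace_form_graph: "subspace form_graph"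
proof (rule subspaceI)
  show "0 \<in> form_graph"
    using subspace_0[OF G1.subspace_gen] subspace_0[OF G2.subspace_gen]
    by (simp add: form_graph_def zero_prod_def)
  show "x + y \<in> form_graph" if "x \<in> form_graph" "y \<in> form_graph" for x y
    using that subspace_add[OF G1.subspace_gen, of "(fst x, fst (snd x))" "(fst y, fst (snd y))"]
      subspace_add[OF G2.subspace_gen, of "(fst x, snd (snd x))" "(fst y, snd (snd y))"]
    by (simp add: form_graph_def split_beta)
  show "c *\<^sub>R x \<in> form_graph" if "x \<in> form_graph" for c x
    using that subspace_scale[OF G1.subspace_gen, of "(fst x, fst (snd x))" c]
      subspace_scale[OF G2.subspace_gen, of "(fst x, snd (snd x))" c]
    by (simp add: form_graph_def split_beta)
qed

lemma closed_form_graph: "closed form_graph"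
  unfolding closed_sequential_limits
proof (intro allI impI)
  fix x l assume *: "(\<forall>n. x n \<in> form_graph) \<and> x \<longlonglongrightarrow> l"
  then have lim: "(\<lambda>n. fst (x n)) \<longlonglongrightarrow> fst l" "(\<lambda>n. fst (snd (x n))) \<longlonglongrightarrow> fst (snd l)"
    "(\<lambda>n. snd (snd (x n))) \<longlonglongrightarrow> snd (snd l)" by (auto intro: tendsto_fst tendsto_snd)
  have mem: "(fst (x n), fst (snd (x n))) \<in> D1 \<and> (fst (x n), snd (snd (x n))) \<in> D2" for n
    using * by (auto simp: form_graph_def split_beta)
  have "(fst l, fst (snd l)) \<in> D1" "(fst l, snd (snd l)) \<in> D2"
    by (rule G1.gen_limit[OF _ lim(1) lim(2)], use mem in blast)
       (rule G2.gen_limit[OF _ lim(1) lim(3)], use mem in blast)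
  then show "l \<in> form_graph" by (auto simp: form_graph_def split_beta)
qed

lemma subspace_Lap: "subspace Lap"
  unfolding subspace_def
proof (safe)
  show "0 \<in> Lap"
    using subspace_0[OF G1.subspace_gen] subspace_0[OF G2.subspace_gen]
    by (auto simp: zero_prod_def intro!: LapI)
next
  fix f h f' h' assume L: "(f, h) \<in> Lap" "(f', h') \<in> Lap"
  obtain f1 f2 where f: "(f, f1) \<in> D1" "(f, f2) \<in> D2" using L(1) by (rule Lap_domain)
  obtain f1' f2' where f': "(f', f1') \<in> D1" "(f', f2') \<in> D2" using L(2) by (rule Lap_domain)
  show "(f, h) + (f', h') \<in> Lap"
    using subspace_add[OF G1.subspace_gen f(1) f'(1)] subspace_add[OF G2.subspace_gen f(2) f'(2)]
      LapD[OF L(1) f] LapD[OF L(2) f']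
    by (auto simp: inner_add_left intro!: LapI[of _ "f1 + f1'" "f2 + f2'"]) (smt (verit))
next
  fix c f h assume L: "(f, h) \<in> Lap"
  obtain f1 f2 where f: "(f, f1) \<in> D1" "(f, f2) \<in> D2" using L by (rule Lap_domain)
  show "c *\<^sub>R (f, h) \<in> Lap"
    using subspace_scale[OF G1.subspace_gen f(1)] subspace_scale[OF G2.subspace_gen f(2)] LapD[OF L f]
    by (auto intro!: LapI[of _ "c *\<^sub>R f1" "c *\<^sub>R f2"] simp flip: distrib_left)
qed

lemma Lap_symmetric:
  assumes "(f, h) \<in> Lap" "(g, k) \<in> Lap"
  shows "inner h g = inner f k"
proof -
  obtain f1 f2 where f: "(f, f1) \<in> D1" "(f, f2) \<in> D2" using assms(1) by (rule Lap_domain)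
  obtain g1 g2 where g: "(g, g1) \<in> D1" "(g, g2) \<in> D2" using assms(2) by (rule Lap_domain)
  show ?thesis using LapD[OF assms(1) f g] LapD[OF assms(2) g f] by (simp add: inner_commute)
qed

lemma Lap_form:
  assumes "(f, h) \<in> Lap" "(f, f1) \<in> D1" "(f, f2) \<in> D2"
  shows "inner h f = (norm f1)\<^sup>2 + (norm f2)\<^sup>2"
  using LapD[OF assms assms(2,3)] by (simp add: power2_norm_eq_inner)

lemma Lap_unique:
  assumes "(f, h) \<in> Lap" "(f, h') \<in> Lap"
  shows "h = h'"
proof -
  obtain f1 f2 where f: "(f, f1) \<in> D1" "(f, f2) \<in> D2" using assms(1) by (rule Lap_domain)
  have "inner (h - h') g = 0" if "g \<in> Domain D1 \<inter> Domain D2" for g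
    using that LapD[OF assms(1) f] LapD[OF assms(2) f] by (fastforce simp: inner_diff_left)
  then have "h - h' = 0" using orthogonal_to_dense[OF dense_form_domain] by blast
  then show ?thesis by simp
qed

text \<open>The weak form of \<open>f + L f = h\<close> says that
  \<open>(h, 0, 0) - (f, f1, f2)\<close> is orthogonal to the form graph, so \<open>f\<close> is
  read off the projection of \<open>(h, 0, 0)\<close>.\<close>

lemma Lap_resolvent_exists: "\<exists>f. (f, h - f) \<in> Lap"
proof -
  obtain p where p: "p \<in> form_graph" "\<forall>q\<in>form_graph. inner ((h, 0, 0) - p) q = 0"
    using orthogonal_projection_exists[OF subspace_form_graph closed_form_graph] by blast
  obtain f f1 f2 where pf: "p = (f, f1, f2)" by (cases p) auto
  have "(f, h - f) \<in> Lap"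
  proof (rule LapI)
    show "(f, f1) \<in> D1" "(f, f2) \<in> D2" using p(1) by (auto simp: pf form_graph_def)
    fix g g1 g2 assume "(g, g1) \<in> D1" "(g, g2) \<in> D2"
    then have "inner ((h, 0, 0) - p) (g, g1, g2) = 0" using p(2) by (auto simp: form_graph_def)
    then show "inner f1 g1 + inner f2 g2 = inner (h - f) g" by (simp add: pf)
  qed
  then show ?thesis ..
qed

lemma Lap_resolvent_norm:
  assumes "(f, h) \<in> Lap"
  shows "norm f \<le> norm (f + h)" "norm h \<le> norm (f + h)"
proof -
  obtain f1 f2 where f: "(f, f1) \<in> D1" "(f, f2) \<in> D2" using assms by (rule Lap_domain)
  have "(norm (f + h))\<^sup>2 = (norm f)\<^sup>2 + 2 * inner h f + (norm h)\<^sup>2"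
    unfolding power2_norm_eq_inner by (simp add: inner_simps inner_commute)
  moreover have "0 \<le> inner h f" using Lap_form[OF assms f] by simp
  ultimately have "(norm f)\<^sup>2 \<le> (norm (f + h))\<^sup>2" "(norm h)\<^sup>2 \<le> (norm (f + h))\<^sup>2" by simp_all
  then show "norm f \<le> norm (f + h)" "norm h \<le> norm (f + h)"
    using power2_le_imp_le norm_ge_zero by blast+
qed

lemma Lap_resolvent_unique:
  assumes "(f, h - f) \<in> Lap" "(f', h - f') \<in> Lap"
  shows "f = f'"
  using Lap_resolvent_norm(1)[OF subspace_diff[OF subspace_Lap assms, simplified]] by simp

section \<open>The resolvent of the Laplacian and cores\<close>

definition res :: "'a \<Rightarrow>\<^sub>L 'a" where
  "res = Blinfun (\<lambda>h. THE f. (f, h - f) \<in> Lap)"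

lemma res_iff: "res h = f \<longleftrightarrow> (f, h - f) \<in> Lap"
proof -
  define b where "b h = (THE f. (f, h - f) \<in> Lap)" for h
  have b: "(b h, h - b h) \<in> Lap" for h
    unfolding b_def by (rule theI') (use Lap_resolvent_exists Lap_resolvent_unique in blast)
  have b_eq: "b h = f \<longleftrightarrow> (f, h - f) \<in> Lap" for h f using b Lap_resolvent_unique by blast
  have "bounded_linear b"
  proof (rule bounded_linear_intro[of _ 1])
    show "b (x + y) = b x + b y" for x y
      unfolding b_eq using subspace_add[OF subspace_Lap b[of x] b[of y]] by (simp add: add_diff_add)
    show "b (r *\<^sub>R x) = r *\<^sub>R b x" for r x
      unfolding b_eq using subspace_scale[OF subspace_Lap b[of x]] by (simp add: scaleR_diff_right)
    show "norm (b x) \<le> norm x * 1" for x using Lap_resolvent_norm(1)[OF b[of x]] by simp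
  qed
  then show ?thesis using b_eq unfolding res_def b_def by (simp add: bounded_linear_Blinfun_apply)
qed

lemma res_Lap: "(res h, h - res h) \<in> Lap" by (simp flip: res_iff)

sublocale pos_resolvent res
proof
  show "inner (res x) y = inner x (res y)" for x y
    using Lap_symmetric[OF res_Lap[of x] res_Lap[of y]] by (simp add: inner_simps)
  show "norm res \<le> 1"
    by (rule norm_blinfun_bound) (use Lap_resolvent_norm(1)[OF res_Lap] in simp_all)
  show "norm (id_blinfun - res) \<le> 1"
    by (rule norm_blinfun_bound)
      (use Lap_resolvent_norm(2)[OF res_Lap] in \<open>simp_all add: blinfun.bilinear_simps\<close>)
  show "x = 0" if "res x = 0" for x
  proof -
    have "(0, x) \<in> Lap" using res_Lap[of x] that by simp
    moreover have "(0, 0) \<in> Lap" using subspace_0[OF subspace_Lap] by (simp add: zero_prod_def)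
    ultimately show ?thesis using Lap_unique by blast
  qed
qed

lemma op_graph_Lap: "op_graph = Lap"
proof -
  have "(f, g) \<in> op_graph \<longleftrightarrow> res (f + g) = f" for f g by (auto simp: op_graph_iff)
  then show ?thesis by (auto simp: res_iff)
qed

lemma closed_Lap: "closed Lap"
proof -
  have "Lap = {p. fst p = res (fst p + snd p)}" by (auto simp: op_graph_iff simp flip: op_graph_Lap)
  moreover have "closed {p. fst p = res (fst p + snd p)}"
    by (intro closed_Collect_eq continuous_intros)
  ultimately show ?thesis by simp
qed

text \<open>The domain of the operator is a core of the form: if \<open>e\<close> in the form domain
  is orthogonal to it in the form norm, then solving \<open>g + L g = e\<close> and testing with
  \<open>g\<close> gives \<open>inner e e = 0\<close>.\<close>

lemma Lap_core:
  assumes "(f, f1) \<in> D1" "(f, f2) \<in> D2"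
  shows "\<exists>F F1 F2. (\<forall>n. F n \<in> Domain Lap \<and> (F n, F1 n) \<in> D1 \<and> (F n, F2 n) \<in> D2) \<and>
    F \<longlonglongrightarrow> f \<and> F1 \<longlonglongrightarrow> f1 \<and> F2 \<longlonglongrightarrow> f2"
proof -
  define M where "M = {p \<in> form_graph. fst p \<in> Domain Lap}"
  have "(f, f1, f2) \<in> closure M"
  proof (rule in_closure_by_orthogonality[OF _ subspace_form_graph closed_form_graph])
    show "subspace M"
    proof (rule subspaceI)
      show "0 \<in> M"
        using subspace_0[OF subspace_form_graph] subspace_0[OF subspace_Lap]
        by (auto simp: M_def zero_prod_def)
      show "x + y \<in> M" if xy: "x \<in> M" "y \<in> M" for x y
      proof -
        obtain h k where "(fst x, h) \<in> Lap" "(fst y, k) \<in> Lap" using xy unfolding M_def by blast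
        then have "(fst x + fst y, h + k) \<in> Lap" using subspace_add[OF subspace_Lap] by fastforce
        then show ?thesis using xy subspace_add[OF subspace_form_graph] by (auto simp: M_def)
      qed
      show "c *\<^sub>R x \<in> M" if x: "x \<in> M" for c x
      proof -
        obtain h where "(fst x, h) \<in> Lap" using x unfolding M_def by blast
        then have "(c *\<^sub>R fst x, c *\<^sub>R h) \<in> Lap" using subspace_scale[OF subspace_Lap] by fastforce
        then show ?thesis using x subspace_scale[OF subspace_form_graph] by (auto simp: M_def)
      qed
    qed
    show "M \<subseteq> form_graph" by (auto simp: M_def)
    show "(f, f1, f2) \<in> form_graph" using assms by (simp add: form_graph_def)
    fix u assume u: "u \<in> form_graph" "\<And>q. q \<in> M \<Longrightarrow> inner u q = 0"
    obtain e e1 e2 where e: "u = (e, e1, e2)" by (cases u) auto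
    have e': "(e, e1) \<in> D1" "(e, e2) \<in> D2" using u(1) by (auto simp: e form_graph_def)
    obtain g where g: "(g, e - g) \<in> Lap" using Lap_resolvent_exists by blast
    obtain g1 g2 where g': "(g, g1) \<in> D1" "(g, g2) \<in> D2" using g by (rule Lap_domain)
    have "inner u (g, g1, g2) = 0" by (rule u(2)) (use g g' in \<open>auto simp: M_def form_graph_def\<close>)
    moreover have "inner g1 e1 + inner g2 e2 = inner (e - g) e" using LapD[OF g g' e'] .
    ultimately have "inner e e = 0" by (simp add: e inner_diff_left inner_diff_right inner_commute)
    then have "e = 0" by simp
    moreover have "e1 = 0" "e2 = 0"
      using e' \<open>e = 0\<close> subspace_0[OF G1.subspace_gen] subspace_0[OF G2.subspace_gen]
        G1.gen_unique G2.gen_unique by (auto simp: zero_prod_def)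
    ultimately show "u = 0" by (simp add: e zero_prod_def)
  qed
  then obtain p where p: "\<And>n. p n \<in> M" "p \<longlonglongrightarrow> (f, f1, f2)" unfolding closure_sequential by blast
  show ?thesis
  proof (intro exI conjI)
    show "\<forall>n. fst (p n) \<in> Domain Lap \<and> (fst (p n), fst (snd (p n))) \<in> D1 \<and> (fst (p n), snd (snd (p n))) \<in> D2"
      using p(1) by (auto simp: M_def form_graph_def split_beta)
    show "(\<lambda>n. fst (p n)) \<longlonglongrightarrow> f" "(\<lambda>n. fst (snd (p n))) \<longlonglongrightarrow> f1" "(\<lambda>n. snd (snd (p n))) \<longlonglongrightarrow> f2"
      using tendsto_fst[OF p(2)] tendsto_fst[OF tendsto_snd[OF p(2)]] tendsto_snd[OF tendsto_snd[OF p(2)]]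
      by simp_all
  qed
qed

text \<open>Test vectors from the domain of \<open>Lap\<close> have second derivatives; restricting
  to them lets the commutator identities put the excess derivatives on the test vector.\<close>

lemma LapI_core:
  assumes f: "(f, f1) \<in> D1" "(f, f2) \<in> D2"
    and core: "\<And>g g1 g2. g \<in> Domain Lap \<Longrightarrow> (g, g1) \<in> D1 \<Longrightarrow> (g, g2) \<in> D2 \<Longrightarrow>
      inner f1 g1 + inner f2 g2 = inner h g"
  shows "(f, h) \<in> Lap"
proof (rule LapI[OF f])
  fix g g1 g2 assume "(g, g1) \<in> D1" "(g, g2) \<in> D2"
  then obtain F F1 F2 where F: "\<And>n. F n \<in> Domain Lap \<and> (F n, F1 n) \<in> D1 \<and> (F n, F2 n) \<in> D2"
    "F \<longlonglongrightarrow> g" "F1 \<longlonglongrightarrow> g1" "F2 \<longlonglongrightarrow> g2" using Lap_core by metis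
  show "inner f1 g1 + inner f2 g2 = inner h g"
  proof (rule LIMSEQ_unique)
    show "(\<lambda>n. inner f1 (F1 n) + inner f2 (F2 n)) \<longlonglongrightarrow> inner f1 g1 + inner f2 g2"
      by (intro tendsto_intros F)
    have "inner f1 (F1 n) + inner f2 (F2 n) = inner h (F n)" for n using core F(1) by blast
    then show "(\<lambda>n. inner f1 (F1 n) + inner f2 (F2 n)) \<longlonglongrightarrow> inner h g"
      by (simp only:) (intro tendsto_intros F)
  qed
qed

section \<open>Elliptic regularity\<close>

text \<open>Nirenberg's method: testing the form with a second difference quotient of \<open>f\<close> bounds the form of
  the first difference quotient uniformly in the step. The constant \<open>c\<close> controls the commutators.\<close>
lemma difference_quotient_regularity:
  assumes V: "isometry_group V" and c: "0 \<le> c"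
    and L: "(f, h) \<in> Lap" and f1: "(f, f1) \<in> D1" and f2: "(f, f2) \<in> D2" and d: "(f, d) \<in> gen V"
    and dom: "\<And>g g1 g2. (g, g1) \<in> D1 \<Longrightarrow> (g, g2) \<in> D2 \<Longrightarrow> \<exists>g'. (g, g') \<in> gen V \<and> norm g' \<le> norm g1 + norm g2"
    and quot: "\<And>t g g1 g2. t \<noteq> 0 \<Longrightarrow> \<bar>t\<bar> \<le> 1 \<Longrightarrow> (g, g1) \<in> D1 \<Longrightarrow> (g, g2) \<in> D2 \<Longrightarrow>
      \<exists>k1 k2. ((V t g - g) /\<^sub>R t, k1) \<in> D1 \<and> ((V t g - g) /\<^sub>R t, k2) \<in> D2 \<and>
        norm (k1 - (V t g1 - g1) /\<^sub>R t) \<le> c * (norm g1 + norm g2) \<and>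
        norm (k2 - (V t g2 - g2) /\<^sub>R t) \<le> c * (norm g1 + norm g2)"
  shows "\<exists>d1 d2. (d, d1) \<in> D1 \<and> (d, d2) \<in> D2 \<and>
    norm d1 \<le> 2 * norm h + 4 * c * (norm f1 + norm f2) \<and>
    norm d2 \<le> 2 * norm h + 4 * c * (norm f1 + norm f2)"
proof -
  interpret V: isometry_group V by (rule V)
  define \<delta> where "\<delta> t x = (V t x - x) /\<^sub>R t" for t x
  let ?N = "norm f1 + norm f2"
  have adj: "inner (\<delta> t x) y = - inner x (\<delta> (- t) y)" for t x y
  proof -
    have "inner (V t x - x) y = inner x (V (- t) y - y)"
      by (simp add: inner_diff_left inner_diff_right V.inner_U_adj)
    then show ?thesis by (simp add: \<delta>_def)
  qed
  have key: "\<exists>k1 k2. (\<delta> t f, k1) \<in> D1 \<and> (\<delta> t f, k2) \<in> D2 \<and>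
      norm k1 + norm k2 \<le> 2 * norm h + 4 * c * ?N" if t: "t \<noteq> 0" "\<bar>t\<bar> \<le> 1" for t
  proof -
    obtain k1 k2 where k: "(\<delta> t f, k1) \<in> D1" "(\<delta> t f, k2) \<in> D2"
      "norm (k1 - \<delta> t f1) \<le> c * ?N" "norm (k2 - \<delta> t f2) \<le> c * ?N"
      using quot[OF t f1 f2] unfolding \<delta>_def by blast
    let ?X = "norm k1 + norm k2"
    define m where "m = \<delta> (- t) (\<delta> t f)"
    have "- t \<noteq> 0" "\<bar>- t\<bar> \<le> 1" using t by auto
    from quot[OF this k(1,2)] obtain m1 m2 where m: "(m, m1) \<in> D1" "(m, m2) \<in> D2"
      "norm (m1 - \<delta> (- t) k1) \<le> c * ?X" "norm (m2 - \<delta> (- t) k2) \<le> c * ?X"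
      unfolding m_def \<delta>_def by blast
    obtain k' where k': "(\<delta> t f, k') \<in> gen V" "norm k' \<le> ?X" using dom k by blast
    have "norm m = norm (V (- t) (\<delta> t f) - \<delta> t f) / \<bar>t\<bar>"
      by (simp add: m_def \<delta>_def[of "- t"] divide_inverse mult.commute)
    also have "\<dots> \<le> norm k'"
      using V.norm_U_diff_le[OF k'(1), of "- t"] t by (simp add: field_simps)
    finally have m_bd: "norm m \<le> ?X" using k'(2) by simp
    have cs: "inner a b \<le> norm a * B" if "norm b \<le> B" for a b :: 'a and B
      by (rule order_trans[OF norm_cauchy_schwarz]) (simp add: mult_left_mono that)
    \<comment> \<open>Moves the difference quotient from \<open>fi\<close> to the test vector
      \<open>mi\<close> and isolates the two commutator errors.\<close>
    have split: "inner ki ki = - inner fi mi + inner fi (mi - \<delta> (- t) ki) + inner ki (ki - \<delta> t fi)"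
      for ki fi mi
      using adj[of t fi ki] by (simp add: inner_diff_right inner_commute)
    have "inner k1 k1 + inner k2 k2 = - inner h m + inner f1 (m1 - \<delta> (- t) k1)
        + inner f2 (m2 - \<delta> (- t) k2) + inner k1 (k1 - \<delta> t f1) + inner k2 (k2 - \<delta> t f2)"
      using split[of k1 f1 m1] split[of k2 f2 m2] LapD[OF L f1 f2 m(1,2)] by linarith
    also have "\<dots> \<le> norm h * ?X + norm f1 * (c * ?X) + norm f2 * (c * ?X) + norm k1 * (c * ?N) + norm k2 * (c * ?N)"
      using cs[OF m(3), of f1] cs[OF m(4), of f2] cs[OF k(3), of k1] cs[OF k(4), of k2]
        cs[of "- m" ?X h] m_bd by simp
    also have "\<dots> = ?X * (norm h + 2 * c * ?N)" by (simp add: algebra_simps)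
    finally have A: "inner k1 k1 + inner k2 k2 \<le> ?X * (norm h + 2 * c * ?N)" .
    \<comment> \<open>The upper bound is linear in \<open>?X\<close>, so one factor cancels; this
      produces the constants 2 and \<open>4 * c\<close>.\<close>
    have "?X * ?X \<le> 2 * (inner k1 k1 + inner k2 k2)"
      using zero_le_power2[of "norm k1 - norm k2"]
      by (simp add: power2_norm_eq_inner[symmetric] power2_eq_square algebra_simps)
    also have "\<dots> \<le> ?X * (2 * (norm h + 2 * c * ?N))"
      using mult_left_mono[OF A, of 2] by (simp only: mult.left_commute[of 2])
    finally have "?X * ?X \<le> ?X * (2 * (norm h + 2 * c * ?N))" .
    moreover have "0 \<le> norm h + 2 * c * ?N" using c by simp
    ultimately have "?X \<le> 2 * (norm h + 2 * c * ?N)"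
      by (cases "?X = 0") (auto simp: mult_le_cancel_left_pos add_nonneg_eq_0_iff add_pos_nonneg add_nonneg_pos)
    then show ?thesis using k(1,2) by (auto simp: algebra_simps)
  qed
  define s where "s n = 1 / real (Suc n)" for n
  have s: "s n \<noteq> 0" "\<bar>s n\<bar> \<le> 1" for n by (auto simp: s_def)
  obtain k1 k2 where k: "\<And>n. (\<delta> (s n) f, k1 n) \<in> D1" "\<And>n. (\<delta> (s n) f, k2 n) \<in> D2"
    "\<And>n. norm (k1 n) + norm (k2 n) \<le> 2 * norm h + 4 * c * ?N"
    using key[OF s] by metis
  have lim: "(\<lambda>n. \<delta> (s n) f) \<longlonglongrightarrow> d"
    unfolding \<delta>_def s_def by (rule filterlim_compose[OF d[unfolded V.gen_iff] filterlim_inverse_Suc_at_0])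
  have "norm (k1 n) \<le> 2 * norm h + 4 * c * ?N" "norm (k2 n) \<le> 2 * norm h + 4 * c * ?N" for n
    using k(3)[of n] norm_ge_zero[of "k1 n"] norm_ge_zero[of "k2 n"] by linarith+
  then show ?thesis
    using G1.gen_bounded_limit[OF k(1) lim] G2.gen_bounded_limit[OF k(2) lim] by blast
qed

text \<open>\<open>D2\<close> passes \<open>U1 t\<close> with the factor \<open>exp t\<close>, so
  the error has the coefficient \<open>(exp t - 1) / t\<close>, at most 3 for times up to 1; the
  component along \<open>D1\<close> has no error.\<close>

lemma D1_regularity:
  assumes L: "(f, h) \<in> Lap" and f1: "(f, f1) \<in> D1" and f2: "(f, f2) \<in> D2"
  shows "\<exists>d1 d2. (f1, d1) \<in> D1 \<and> (f1, d2) \<in> D2 \<and>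
    norm d1 \<le> 2 * norm h + 4 * 3 * (norm f1 + norm f2) \<and> norm d2 \<le> 2 * norm h + 4 * 3 * (norm f1 + norm f2)"
proof (rule difference_quotient_regularity[OF G1.isometry_group_axioms _ L f1 f2 f1])
  fix g g1 g2 assume g: "(g, g1) \<in> D1" "(g, g2) \<in> D2"
  then show "\<exists>g'. (g, g') \<in> D1 \<and> norm g' \<le> norm g1 + norm g2" by (intro exI[of _ g1]) auto
  fix t :: real assume t: "t \<noteq> 0" "\<bar>t\<bar> \<le> 1"
  let ?k1 = "(U1 t g1 - g1) /\<^sub>R t" and ?k2 = "(exp t *\<^sub>R U1 t g2 - g2) /\<^sub>R t"
  have "((U1 t g - g) /\<^sub>R t, ?k1) \<in> D1"
    using subspace_scale[OF G1.subspace_gen subspace_diff[OF G1.subspace_gen G1.gen_U[OF g(1)] g(1)], of "inverse t" t] by simp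
  moreover have "((U1 t g - g) /\<^sub>R t, ?k2) \<in> D2"
    using subspace_scale[OF G2.subspace_gen subspace_diff[OF G2.subspace_gen D2_U1[OF g(2)] g(2)], of "inverse t" t] by simp
  moreover have "norm (?k2 - (U1 t g2 - g2) /\<^sub>R t) \<le> 3 * (norm g1 + norm g2)"
  proof -
    have "?k2 - (U1 t g2 - g2) /\<^sub>R t = ((exp t - 1) / t) *\<^sub>R U1 t g2"
      by (simp add: divide_inverse algebra_simps)
    then have "norm (?k2 - (U1 t g2 - g2) /\<^sub>R t) = \<bar>(exp t - 1) / t\<bar> * norm g2"
      by (simp add: G1.norm_U)
    moreover have "\<bar>(exp t - 1) / t\<bar> \<le> 3"
    proof -
      have "norm (exp t - 1) \<le> 3 * norm (t - 0)"
      proof -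
        have "norm (exp t - exp 0) \<le> 3 * norm (t - 0)"
        proof (rule field_differentiable_bound[of "{-1..1}" exp exp])
          show "norm (exp z) \<le> 3" if "z \<in> {-1..1}" for z :: real
            using that exp_le order_trans[of "exp z" "exp 1" 3] by simp
        qed (use t in \<open>auto intro: DERIV_exp DERIV_subset has_field_derivative_at_within\<close>)
        then show ?thesis by simp
      qed
      then show ?thesis using t by (simp add: field_simps)
    qed
    ultimately have "norm (?k2 - (U1 t g2 - g2) /\<^sub>R t) \<le> 3 * norm g2"
      by (simp only:) (rule mult_right_mono, auto)
    then show ?thesis using norm_ge_zero[of g1] by argo
  qed
  ultimately show "\<exists>k1 k2. ((U1 t g - g) /\<^sub>R t, k1) \<in> D1 \<and> ((U1 t g - g) /\<^sub>R t, k2) \<in> D2 \<and>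
        norm (k1 - (U1 t g1 - g1) /\<^sub>R t) \<le> 3 * (norm g1 + norm g2) \<and>
        norm (k2 - (U1 t g2 - g2) /\<^sub>R t) \<le> 3 * (norm g1 + norm g2)"
    by (intro exI[of _ ?k1] exI[of _ ?k2]) auto
qed simp

text \<open>By \<open>D1_U2\<close> the error along \<open>D1\<close> is exactly
  \<open>- U2 t g2\<close>, whence the constant 1; along \<open>D2\<close> there is none.\<close>

lemma D2_regularity:
  assumes L: "(f, h) \<in> Lap" and f1: "(f, f1) \<in> D1" and f2: "(f, f2) \<in> D2"
  shows "\<exists>d1 d2. (f2, d1) \<in> D1 \<and> (f2, d2) \<in> D2 \<and>
    norm d1 \<le> 2 * norm h + 4 * 1 * (norm f1 + norm f2) \<and> norm d2 \<le> 2 * norm h + 4 * 1 * (norm f1 + norm f2)"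
proof (rule difference_quotient_regularity[OF G2.isometry_group_axioms _ L f1 f2 f2])
  fix g g1 g2 assume g: "(g, g1) \<in> D1" "(g, g2) \<in> D2"
  then show "\<exists>g'. (g, g') \<in> D2 \<and> norm g' \<le> norm g1 + norm g2" by (intro exI[of _ g2]) auto
  fix t :: real assume t: "t \<noteq> 0" "\<bar>t\<bar> \<le> 1"
  let ?k1 = "(U2 t (g1 - t *\<^sub>R g2) - g1) /\<^sub>R t" and ?k2 = "(U2 t g2 - g2) /\<^sub>R t"
  have "((U2 t g - g) /\<^sub>R t, ?k1) \<in> D1"
    using subspace_scale[OF G1.subspace_gen subspace_diff[OF G1.subspace_gen D1_U2[OF g] g(1)], of "inverse t" t] by simp
  moreover have "((U2 t g - g) /\<^sub>R t, ?k2) \<in> D2"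
    using subspace_scale[OF G2.subspace_gen subspace_diff[OF G2.subspace_gen G2.gen_U[OF g(2)] g(2)], of "inverse t" t] by simp
  moreover have "norm (?k1 - (U2 t g1 - g1) /\<^sub>R t) \<le> 1 * (norm g1 + norm g2)"
  proof -
    have "?k1 - (U2 t g1 - g1) /\<^sub>R t = - U2 t g2"
      using t by (simp add: G2.U_diff G2.U_scale scaleR_diff_right)
    then show ?thesis by (simp add: G2.norm_U)
  qed
  ultimately show "\<exists>k1 k2. ((U2 t g - g) /\<^sub>R t, k1) \<in> D1 \<and> ((U2 t g - g) /\<^sub>R t, k2) \<in> D2 \<and>
        norm (k1 - (U2 t g1 - g1) /\<^sub>R t) \<le> 1 * (norm g1 + norm g2) \<and>
        norm (k2 - (U2 t g2 - g2) /\<^sub>R t) \<le> 1 * (norm g1 + norm g2)"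
    by (intro exI[of _ ?k1] exI[of _ ?k2]) auto
qed simp

section \<open>Second derivatives and commutators with the Laplacian\<close>

lemma Lap_strong:
  assumes "(f, f1) \<in> D1" "(f, f2) \<in> D2" "(f1, f11) \<in> D1" "(f2, f22) \<in> D2"
  shows "(f, - (f11 + f22)) \<in> Lap"
proof (rule LapI[OF assms(1,2)])
  fix g g1 g2 assume "(g, g1) \<in> D1" "(g, g2) \<in> D2"
  then show "inner f1 g1 + inner f2 g2 = inner (- (f11 + f22)) g"
    using G1.gen_skew[OF assms(3)] G2.gen_skew[OF assms(4)] by (simp add: inner_diff_left)
qed

lemma Lap_second_order:
  assumes "(f, h) \<in> Lap" "(f, f1) \<in> D1" "(f, f2) \<in> D2"
  obtains f11 f12 f21 f22 where "(f1, f11) \<in> D1" "(f1, f12) \<in> D2" "(f2, f21) \<in> D1" "(f2, f22) \<in> D2"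
    "f12 = f2 + f21" "h = - (f11 + f22)"
proof -
  obtain f11 f12 where 1: "(f1, f11) \<in> D1" "(f1, f12) \<in> D2" using D1_regularity[OF assms] by blast
  obtain f21 f22 where 2: "(f2, f21) \<in> D1" "(f2, f22) \<in> D2" using D2_regularity[OF assms] by blast
  have "f12 = f2 + f21" using D2_D1[OF assms(2,3) 2(1)] 1(2) G2.gen_unique by blast
  moreover have "h = - (f11 + f22)" using Lap_strong[OF assms(2,3) 1(1) 2(2)] assms(1) Lap_unique by blast
  ultimately show ?thesis using that 1 2 by blast
qed

lemma Lap_commute_D2:
  assumes L: "(f, h) \<in> Lap" and f: "(f, f1) \<in> D1" "(f, f2) \<in> D2" and f21: "(f2, f21) \<in> D1"
    and h2: "(h, h2) \<in> D2"
  shows "(f2, h2 + 2 *\<^sub>R f21 + f2) \<in> Lap"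
proof -
  obtain f11 f12 f21' f22 where F: "(f1, f11) \<in> D1" "(f1, f12) \<in> D2" "(f2, f21') \<in> D1" "(f2, f22) \<in> D2"
    "f12 = f2 + f21'" by (rule Lap_second_order[OF L f]) blast
  have f21': "f21' = f21" using F(3) f21 G1.gen_unique by blast
  show ?thesis
  proof (rule LapI_core[OF f21 F(4)])
    fix g g1 g2 assume "g \<in> Domain Lap" and g: "(g, g1) \<in> D1" "(g, g2) \<in> D2"
    then obtain k where k: "(g, k) \<in> Lap" by blast
    obtain g11 g12 g21 g22 where G: "(g1, g11) \<in> D1" "(g1, g12) \<in> D2" "(g2, g21) \<in> D1" "(g2, g22) \<in> D2"
      "g12 = g2 + g21" by (rule Lap_second_order[OF k g]) blast
    have "inner f22 g2 = - inner f2 g22" using G2.gen_skew[OF F(4) G(4)] .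
    moreover have "inner f12 g1 = - inner f1 g12" using G2.gen_skew[OF F(2) G(2)] .
    moreover have "inner f1 g21 + inner f2 g22 = inner h g2" by (rule LapD[OF L f G(3,4)])
    moreover have "inner h2 g = - inner h g2" by (rule G2.gen_skew[OF h2 g(2)])
    moreover have "inner f12 g = - inner f1 g2" by (rule G2.gen_skew[OF F(2) g(2)])
    moreover have "inner f21 g = - inner f2 g1" by (rule G1.gen_skew[OF f21 g(1)])
    ultimately show "inner f21 g1 + inner f22 g2 = inner (h2 + 2 *\<^sub>R f21 + f2) g"
      unfolding F(5) G(5) f21' by (simp add: inner_add_left inner_add_right)
  qed
qed

text \<open>Here the commutator is \<open>L D1 - D1 L = - 2 D2 D2\<close>, again verified on the
  core.\<close>

lemma Lap_commute_D1:
  assumes L: "(f, h) \<in> Lap" and f: "(f, f1) \<in> D1" "(f, f2) \<in> D2" and f22: "(f2, f22) \<in> D2"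
    and h1: "(h, h1) \<in> D1"
  shows "(f1, h1 - 2 *\<^sub>R f22) \<in> Lap"
proof -
  obtain f11 f12 f21 f22' where F: "(f1, f11) \<in> D1" "(f1, f12) \<in> D2" "(f2, f21) \<in> D1" "(f2, f22') \<in> D2"
    "f12 = f2 + f21" by (rule Lap_second_order[OF L f]) blast
  show ?thesis
  proof (rule LapI_core[OF F(1,2)])
    fix g g1 g2 assume "g \<in> Domain Lap" and g: "(g, g1) \<in> D1" "(g, g2) \<in> D2"
    then obtain k where k: "(g, k) \<in> Lap" by blast
    obtain g11 g12 g21 g22 where G: "(g1, g11) \<in> D1" "(g1, g12) \<in> D2" "(g2, g21) \<in> D1" "(g2, g22) \<in> D2"
      "g12 = g2 + g21" by (rule Lap_second_order[OF k g]) blast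
    have "inner f11 g1 = - inner f1 g11" by (rule G1.gen_skew[OF F(1) G(1)])
    moreover have "inner f21 g2 = - inner f2 g21" by (rule G1.gen_skew[OF F(3) G(3)])
    moreover have "inner f1 g11 + inner f2 g12 = inner h g1" by (rule LapD[OF L f G(1,2)])
    moreover have "inner h1 g = - inner h g1" by (rule G1.gen_skew[OF h1 g(1)])
    moreover have "inner f22 g = - inner f2 g2" by (rule G2.gen_skew[OF f22 g(2)])
    ultimately show "inner f11 g1 + inner f12 g2 = inner (h1 - 2 *\<^sub>R f22) g"
      unfolding F(5) G(5) by (simp add: inner_add_left inner_add_right inner_diff_left)
  qed
qed

end

context affine_rep
begin

section \<open>Sobolev spaces and powers of the square root\<close>

definition DD :: "nat \<Rightarrow> ('a \<times> 'a) set" where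
  "DD j = (if j = 1 then D1 else D2)"

text \<open>A total choice, arbitrary outside the domain of the generator; linearity statements
  about it therefore carry membership in a domain or in \<open>Sob\<close>.\<close>

definition dd :: "nat \<Rightarrow> 'a \<Rightarrow> 'a" where
  "dd j f = (SOME g. (f, g) \<in> DD j)"

primrec word :: "nat list \<Rightarrow> ('a \<times> 'a) set" where
  "word [] = Id"
| "word (j # js) = word js O DD j"

primrec wd :: "nat list \<Rightarrow> 'a \<Rightarrow> 'a" where
  "wd [] f = f"
| "wd (j # js) f = dd j (wd js f)"

text \<open>The recursion strips the derivative applied first, whereas \<open>word\<close> and
  \<open>wd\<close> recurse on the one applied last. \<open>word_append\<close> and
  \<open>wd_append\<close> mediate, which is why words are handled by
  \<open>rev_induct\<close>.\<close>

primrec Sob :: "nat \<Rightarrow> 'a set" where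
  "Sob 0 = UNIV"
| "Sob (Suc k) = {f. \<forall>j\<in>{1, 2}. \<exists>g. (f, g) \<in> DD j \<and> g \<in> Sob k}"

primrec snorm :: "nat \<Rightarrow> 'a \<Rightarrow> real" where
  "snorm 0 f = norm f"
| "snorm (Suc k) f = norm f + snorm k (dd 1 f) + snorm k (dd 2 f)"

lemma DD_simps [simp]: "DD (Suc 0) = D1" "DD 2 = D2"
  by (simp_all add: DD_def)

lemma DD_unique: "(f, g) \<in> DD j \<Longrightarrow> (f, g') \<in> DD j \<Longrightarrow> g = g'"
  using G1.gen_unique G2.gen_unique by (auto simp: DD_def split: if_splits)

lemma subspace_DD: "subspace (DD j)"
  by (simp add: DD_def G1.subspace_gen G2.subspace_gen)

lemma dd_eq: "(f, g) \<in> DD j \<Longrightarrow> dd j f = g"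
  unfolding dd_def using DD_unique by (metis someI)

lemma dd_add: "(f, f') \<in> DD j \<Longrightarrow> (g, g') \<in> DD j \<Longrightarrow> dd j (f + g) = dd j f + dd j g"
  using dd_eq subspace_add[OF subspace_DD, of "(f, f')" j "(g, g')"] by simp

lemma dd_scale: "(f, f') \<in> DD j \<Longrightarrow> dd j (c *\<^sub>R f) = c *\<^sub>R dd j f"
  using dd_eq subspace_scale[OF subspace_DD, of "(f, f')" j c] by simp

lemma Sob_Suc_iff:
  "f \<in> Sob (Suc k) \<longleftrightarrow> (f, dd 1 f) \<in> D1 \<and> (f, dd 2 f) \<in> D2 \<and> dd 1 f \<in> Sob k \<and> dd 2 f \<in> Sob k"
proof
  assume "f \<in> Sob (Suc k)"
  then obtain f1 f2 where "(f, f1) \<in> D1" "f1 \<in> Sob k" "(f, f2) \<in> D2" "f2 \<in> Sob k" by auto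
  moreover have "dd 1 f = f1" "dd 2 f = f2" using calculation by (auto intro: dd_eq)
  ultimately show "(f, dd 1 f) \<in> D1 \<and> (f, dd 2 f) \<in> D2 \<and> dd 1 f \<in> Sob k \<and> dd 2 f \<in> Sob k" by simp
qed auto

declare Sob.simps(2) [simp del] snorm.simps(2) [simp del]

lemma dd_D1: "(f, g) \<in> D1 \<Longrightarrow> dd 1 f = g" and dd_D2: "(f, g) \<in> D2 \<Longrightarrow> dd 2 f = g"
  by (auto intro: dd_eq)

lemma Sob_SucI:
  assumes "(f, f1) \<in> D1" "(f, f2) \<in> D2" "f1 \<in> Sob k" "f2 \<in> Sob k"
  shows "f \<in> Sob (Suc k)"
  using assms by (auto simp: Sob_Suc_iff dd_D1[simplified] dd_D2)

lemma Sob_dd: "f \<in> Sob (Suc k) \<Longrightarrow> j \<in> {1, 2} \<Longrightarrow> (f, dd j f) \<in> DD j \<and> dd j f \<in> Sob k"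
  by (auto simp: Sob_Suc_iff)

lemma Sob_Suc_subset: "f \<in> Sob (Suc k) \<Longrightarrow> f \<in> Sob k"
proof (induction k arbitrary: f)
  case (Suc k)
  then show ?case by (auto simp: Sob_Suc_iff[of f])
qed simp

lemma Sob_antimono: "k \<le> n \<Longrightarrow> f \<in> Sob n \<Longrightarrow> f \<in> Sob k"
  by (induction n rule: dec_induct) (auto intro: Sob_Suc_subset)

lemma Sob_add: "f \<in> Sob k \<Longrightarrow> g \<in> Sob k \<Longrightarrow> f + g \<in> Sob k"
proof (induction k arbitrary: f g)
  case (Suc k)
  note d = Sob_Suc_iff[THEN iffD1, OF Suc.prems(1)] Sob_Suc_iff[THEN iffD1, OF Suc.prems(2)]
  show ?case
    by (rule Sob_SucI[of _ "dd 1 f + dd 1 g" "dd 2 f + dd 2 g"])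
      (use d Suc.IH subspace_add[OF G1.subspace_gen, of "(f, dd 1 f)" "(g, dd 1 g)"]
        subspace_add[OF G2.subspace_gen, of "(f, dd 2 f)" "(g, dd 2 g)"] in auto)
qed simp

lemma Sob_scale: "f \<in> Sob k \<Longrightarrow> c *\<^sub>R f \<in> Sob k"
proof (induction k arbitrary: f)
  case (Suc k)
  note d = Sob_Suc_iff[THEN iffD1, OF Suc.prems]
  show ?case
    by (rule Sob_SucI[of _ "c *\<^sub>R dd 1 f" "c *\<^sub>R dd 2 f"])
      (use d Suc.IH subspace_scale[OF G1.subspace_gen, of "(f, dd 1 f)" c]
        subspace_scale[OF G2.subspace_gen, of "(f, dd 2 f)" c] in auto)
qed simp

lemma snorm_nonneg: "0 \<le> snorm k f"
  by (induction k arbitrary: f) (simp_all add: snorm.simps(2))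

lemma norm_le_snorm: "norm f \<le> snorm k f"
  by (cases k) (simp_all add: snorm_nonneg snorm.simps(2) add.assoc)

lemma snorm_dd: "j \<in> {1, 2} \<Longrightarrow> snorm k (dd j f) \<le> snorm (Suc k) f"
  using snorm_nonneg[of k "dd 1 f"] snorm_nonneg[of k "dd 2 f"] by (auto simp: snorm.simps(2))

lemma snorm_mono: "snorm k f \<le> snorm (Suc k) f"
proof (induction k arbitrary: f)
  case (Suc k)
  show ?case using Suc.IH[of "dd 1 f"] Suc.IH[of "dd 2 f"]
    by (simp add: snorm.simps(2)[of k f] snorm.simps(2)[of "Suc k" f])
qed (simp add: snorm_nonneg snorm.simps(2))

lemma snorm_add: "f \<in> Sob k \<Longrightarrow> g \<in> Sob k \<Longrightarrow> snorm k (f + g) \<le> snorm k f + snorm k g"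
proof (induction k arbitrary: f g)
  case (Suc k)
  note f = Sob_dd[OF Suc.prems(1)] and g = Sob_dd[OF Suc.prems(2)]
  have "snorm k (dd j (f + g)) \<le> snorm k (dd j f) + snorm k (dd j g)" if "j \<in> {1, 2}" for j
    using Suc.IH[of "dd j f" "dd j g"] f[OF that] g[OF that] dd_add[of f "dd j f" j g "dd j g"] by simp
  from this[of 1] this[of 2] show ?case using norm_triangle_ineq[of f g] by (simp add: snorm.simps(2))
qed (simp add: norm_triangle_ineq)

lemma snorm_scale: "f \<in> Sob k \<Longrightarrow> snorm k (c *\<^sub>R f) = \<bar>c\<bar> * snorm k f"
proof (induction k arbitrary: f)
  case (Suc k)
  have "snorm k (dd j (c *\<^sub>R f)) = \<bar>c\<bar> * snorm k (dd j f)" if "j \<in> {1, 2}" for j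
    using Suc.IH[of "dd j f"] Sob_dd[OF Suc.prems that] dd_scale[of f "dd j f" j c] by simp
  from this[of 1] this[of 2] show ?case by (simp add: snorm.simps(2) algebra_simps)
qed simp

lemma wd_append: "wd (js @ [j]) f = wd js (dd j f)"
  by (induction js) simp_all

lemma wd_add:
  "f \<in> Sob (length js) \<Longrightarrow> g \<in> Sob (length js) \<Longrightarrow> set js \<subseteq> {1, 2} \<Longrightarrow> wd js (f + g) = wd js f + wd js g"
proof (induction js arbitrary: f g rule: rev_induct)
  case (snoc j js)
  then have j: "j \<in> {1, 2}" and f: "f \<in> Sob (Suc (length js))" and g: "g \<in> Sob (Suc (length js))"
    by simp_all
  show ?case
    using Sob_dd[OF f j] Sob_dd[OF g j] snoc.IH[of "dd j f" "dd j g"] snoc.prems(3)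
      dd_add[of f "dd j f" j g "dd j g"] by (simp add: wd_append)
qed simp

lemma wd_scale:
  "f \<in> Sob (length js) \<Longrightarrow> set js \<subseteq> {1, 2} \<Longrightarrow> wd js (c *\<^sub>R f) = c *\<^sub>R wd js f"
proof (induction js arbitrary: f rule: rev_induct)
  case (snoc j js)
  then have j: "j \<in> {1, 2}" and f: "f \<in> Sob (Suc (length js))" by simp_all
  show ?case
    using Sob_dd[OF f j] snoc.IH[of "dd j f"] snoc.prems(2) dd_scale[of f "dd j f" j c]
    by (simp add: wd_append)
qed simp

lemma norm_wd_le: "set js \<subseteq> {1, 2} \<Longrightarrow> norm (wd js f) \<le> snorm (length js) f"
proof (induction js arbitrary: f rule: rev_induct)
  case (snoc j js)
  then have "norm (wd js (dd j f)) \<le> snorm (length js) (dd j f)" "j \<in> {1, 2}" by auto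
  then show ?case using snorm_dd[of j "length js" f] by (simp add: wd_append)
qed simp

lemma word_append: "word (js @ [j]) = DD j O word js"
  by (induction js) (simp_all add: O_assoc)

lemma word_wd: "(f, g) \<in> word js \<Longrightarrow> wd js f = g"
  by (induction js arbitrary: g) (auto dest: dd_eq)

lemma Sob_imp_word: "f \<in> Sob (length js) \<Longrightarrow> set js \<subseteq> {1, 2} \<Longrightarrow> f \<in> Domain (word js)"
proof (induction js arbitrary: f rule: rev_induct)
  case (snoc j js)
  then have j: "j \<in> {1, 2}" and f: "f \<in> Sob (Suc (length js))" by simp_all
  then show ?case using Sob_dd[OF f j] snoc.IH[of "dd j f"] snoc.prems by (force simp: word_append)
qed simp

text \<open>From right to left, the words ending in \<open>j\<close> provide the derivatives of
  \<open>dd j f\<close>; single-valuedness ensures that they all pass through the same first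
  derivative.\<close>

lemma Sob_iff_word:
  "f \<in> Sob k \<longleftrightarrow> (\<forall>js. length js \<le> k \<and> set js \<subseteq> {1, 2} \<longrightarrow> f \<in> Domain (word js))"
proof (intro iffI allI impI)
  fix js :: "nat list" assume "f \<in> Sob k" "length js \<le> k \<and> set js \<subseteq> {1, 2}"
  then show "f \<in> Domain (word js)" using Sob_imp_word Sob_antimono by blast
next
  assume "\<forall>js. length js \<le> k \<and> set js \<subseteq> {1, 2} \<longrightarrow> f \<in> Domain (word js)"
  then show "f \<in> Sob k"
  proof (induction k arbitrary: f)
    case (Suc k)
    have step: "\<exists>g. (f, g) \<in> DD j \<and> g \<in> Sob k" if j: "j \<in> {1, 2}" for j
    proof -
      have "f \<in> Domain (word [j])" using Suc.prems j by (intro Suc.prems[rule_format]) auto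
      then obtain g where g: "(f, g) \<in> DD j" by auto
      have "g \<in> Domain (word js)" if "length js \<le> k \<and> set js \<subseteq> {1, 2}" for js :: "nat list"
      proof -
        have "f \<in> Domain (word (js @ [j]))" using that j by (intro Suc.prems[rule_format]) auto
        then obtain y z where "(f, y) \<in> DD j" "(y, z) \<in> word js" by (auto simp: word_append)
        moreover have "y = g" using DD_unique g calculation(1) by blast
        ultimately show ?thesis by blast
      qed
      then show ?thesis using Suc.IH g by blast
    qed
    show ?case unfolding Sob.simps(2) mem_Collect_eq by (intro ballI) (rule step)
  qed simp
qed

section \<open>Regularity along the Sobolev scale\<close>

lemma Lap_dd:
  assumes "f \<in> Sob 2"
  shows "(f, - (dd 1 (dd 1 f) + dd 2 (dd 2 f))) \<in> Lap"
proof -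
  have f: "f \<in> Sob (Suc (Suc 0))" using assms by (simp add: numeral_2_eq_2)
  note d = Sob_Suc_iff[THEN iffD1, OF f]
  show ?thesis
    by (rule Lap_strong) (use d in \<open>auto simp: Sob_Suc_iff\<close>)
qed

text \<open>One order at a time: \<open>Lap\<close> maps \<open>D1 f\<close> and \<open>D2 f\<close>
  to derivatives of \<open>h\<close> plus commutators of order two in \<open>f\<close>, which the
  estimate already proved for \<open>f\<close> controls.\<close>

lemma Lap_regularity:
  "\<exists>C\<ge>0. \<forall>f h. (f, h) \<in> Lap \<longrightarrow> h \<in> Sob k \<longrightarrow>
     f \<in> Sob (Suc (Suc k)) \<and> snorm (Suc (Suc k)) f \<le> C * (snorm k h + norm f)"
proof (induction k)
  case 0
  \<comment> \<open>The bounds below add up to 1 + 2 + 52 + 20 = 75 multiples of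
    \<open>norm h + norm f\<close>; 107 is a generous choice.\<close>
  have "f \<in> Sob (Suc (Suc 0)) \<and> snorm (Suc (Suc 0)) f \<le> 107 * (snorm 0 h + norm f)"
    if L: "(f, h) \<in> Lap" for f h
  proof -
    obtain f1 f2 where f: "(f, f1) \<in> D1" "(f, f2) \<in> D2" using L by (rule Lap_domain)
    let ?M = "norm h + norm f"
    have "(norm f1)\<^sup>2 + (norm f2)\<^sup>2 = inner h f" using Lap_form[OF L f] by simp
    also have "\<dots> \<le> norm h * norm f" by (rule norm_cauchy_schwarz)
    also have "\<dots> \<le> ?M\<^sup>2" by (simp add: power2_eq_square algebra_simps)
    finally have "(norm f1)\<^sup>2 + (norm f2)\<^sup>2 \<le> ?M\<^sup>2" .
    then have "(norm f1)\<^sup>2 \<le> ?M\<^sup>2" "(norm f2)\<^sup>2 \<le> ?M\<^sup>2"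
      using zero_le_power2[of "norm f1"] zero_le_power2[of "norm f2"] by linarith+
    then have n: "norm f1 \<le> ?M" "norm f2 \<le> ?M"
      by (auto intro: power2_le_imp_le)
    obtain f11 f12 where 1: "(f1, f11) \<in> D1" "(f1, f12) \<in> D2"
      "norm f11 \<le> 2 * norm h + 4 * 3 * (norm f1 + norm f2)" "norm f12 \<le> 2 * norm h + 4 * 3 * (norm f1 + norm f2)"
      using D1_regularity[OF L f] by blast
    obtain f21 f22 where 2: "(f2, f21) \<in> D1" "(f2, f22) \<in> D2"
      "norm f21 \<le> 2 * norm h + 4 * 1 * (norm f1 + norm f2)" "norm f22 \<le> 2 * norm h + 4 * 1 * (norm f1 + norm f2)"
      using D2_regularity[OF L f] by blast
    have "f1 \<in> Sob (Suc 0)" "f2 \<in> Sob (Suc 0)"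
      using 1(1,2) 2(1,2) by (auto intro: Sob_SucI)
    then have "f \<in> Sob (Suc (Suc 0))" using f by (auto intro: Sob_SucI)
    moreover have "dd 1 f = f1" "dd 2 f = f2" "dd 1 f1 = f11" "dd 2 f1 = f12" "dd 1 f2 = f21" "dd 2 f2 = f22"
      using f 1 2 dd_D1 dd_D2 by blast+
    then have "snorm (Suc (Suc 0)) f = norm f + (norm f1 + norm f11 + norm f12) + (norm f2 + norm f21 + norm f22)"
      by (simp add: snorm.simps(2))
    then have "snorm (Suc (Suc 0)) f \<le> 107 * (norm h + norm f)"
      using n 1(3,4) 2(3,4) norm_ge_zero[of h] norm_ge_zero[of f] by argo
    ultimately show ?thesis by simp
  qed
  then show ?case by (intro exI[of _ 107]) auto
next
  case (Suc k)
  obtain C where C: "0 \<le> C" "\<And>f h. (f, h) \<in> Lap \<Longrightarrow> h \<in> Sob k \<Longrightarrow>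
     f \<in> Sob (Suc (Suc k)) \<and> snorm (Suc (Suc k)) f \<le> C * (snorm k h + norm f)" using Suc.IH by blast
  \<comment> \<open>From \<open>norm f + 2 * (C * (?H + 4 * ?E))\<close> with
    \<open>?E \<le> C * (?H + norm f)\<close>.\<close>
  let ?K = "1 + 2 * C + 8 * C * C"
  have "f \<in> Sob (Suc (Suc (Suc k))) \<and> snorm (Suc (Suc (Suc k))) f \<le> ?K * (snorm (Suc k) h + norm f)"
    if L: "(f, h) \<in> Lap" and h: "h \<in> Sob (Suc k)" for f h
  proof -
    let ?E = "snorm (Suc (Suc k)) f"
    define f1 f2 where "f1 = dd 1 f" and "f2 = dd 2 f"
    have E: "f \<in> Sob (Suc (Suc k))" "?E \<le> C * (snorm k h + norm f)"
      using C(2)[OF L Sob_Suc_subset[OF h]] by blast+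
    have f12: "(f, f1) \<in> D1" "(f, f2) \<in> D2" "f1 \<in> Sob (Suc k)" "f2 \<in> Sob (Suc k)"
      using Sob_Suc_iff[THEN iffD1, OF E(1)] by (auto simp: f1_def f2_def)
    have f2': "(f2, dd 1 f2) \<in> D1" "(f2, dd 2 f2) \<in> D2" "dd 1 f2 \<in> Sob k" "dd 2 f2 \<in> Sob k"
      using Sob_Suc_iff[THEN iffD1, OF f12(4)] by auto
    have h': "(h, dd 1 h) \<in> D1" "(h, dd 2 h) \<in> D2" "dd 1 h \<in> Sob k" "dd 2 h \<in> Sob k"
      using Sob_Suc_iff[THEN iffD1, OF h] by auto
    have nE: "snorm (Suc k) f1 \<le> ?E" "snorm (Suc k) f2 \<le> ?E"
      unfolding f1_def f2_def using snorm_dd by blast+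
    have nE': "snorm k (dd 1 f2) \<le> ?E" "snorm k (dd 2 f2) \<le> ?E" "snorm k f2 \<le> ?E"
      "norm f1 \<le> ?E" "norm f2 \<le> ?E"
      using snorm_dd[of 1 k f2] snorm_dd[of 2 k f2] snorm_mono[of k f2] nE
        norm_le_snorm[of f1 "Suc k"] norm_le_snorm[of f2 "Suc k"]
      by auto
    let ?r1 = "dd 1 h - 2 *\<^sub>R dd 2 f2" and ?r2 = "dd 2 h + 2 *\<^sub>R dd 1 f2 + f2"
    have f2k: "f2 \<in> Sob k" using Sob_Suc_subset[OF f12(4)] .
    have r1: "?r1 \<in> Sob k" "snorm k ?r1 \<le> snorm k (dd 1 h) + 2 * ?E"
      using Sob_add[OF h'(3) Sob_scale[OF f2'(4), of "- 2"]] snorm_add[OF h'(3) Sob_scale[OF f2'(4), of "- 2"]]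
        snorm_scale[OF f2'(4), of "- 2"] nE'(2) by (auto simp: scaleR_minus_left)
    have r2: "?r2 \<in> Sob k" "snorm k ?r2 \<le> snorm k (dd 2 h) + 3 * ?E"
    proof -
      have s: "dd 2 h + 2 *\<^sub>R dd 1 f2 \<in> Sob k" by (rule Sob_add[OF h'(4) Sob_scale[OF f2'(3)]])
      show "?r2 \<in> Sob k" by (rule Sob_add[OF s f2k])
      show "snorm k ?r2 \<le> snorm k (dd 2 h) + 3 * ?E"
        using snorm_add[OF s f2k] snorm_add[OF h'(4) Sob_scale[OF f2'(3), of 2]]
          snorm_scale[OF f2'(3), of 2] nE'(1,3) by simp
    qed
    have L1: "f1 \<in> Sob (Suc (Suc k))" "snorm (Suc (Suc k)) f1 \<le> C * (snorm k ?r1 + norm f1)"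
      using C(2)[OF Lap_commute_D1[OF L f12(1,2) f2'(2) h'(1)] r1(1)] by blast+
    have L2: "f2 \<in> Sob (Suc (Suc k))" "snorm (Suc (Suc k)) f2 \<le> C * (snorm k ?r2 + norm f2)"
      using C(2)[OF Lap_commute_D2[OF L f12(1,2) f2'(1) h'(2)] r2(1)] by blast+
    let ?H = "snorm (Suc k) h"
    have hH: "snorm k (dd 1 h) \<le> ?H" "snorm k (dd 2 h) \<le> ?H" "snorm k h \<le> ?H"
      using snorm_dd[of 1 k h] snorm_dd[of 2 k h] snorm_mono[of k h] by auto
    have "f \<in> Sob (Suc (Suc (Suc k)))" using f12 L1(1) L2(1) by (auto intro: Sob_SucI)
    moreover have "snorm (Suc (Suc (Suc k))) f \<le> ?K * (?H + norm f)"
    proof -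
      have "snorm (Suc (Suc (Suc k))) f = norm f + snorm (Suc (Suc k)) f1 + snorm (Suc (Suc k)) f2"
        unfolding f1_def f2_def by (rule snorm.simps(2))
      also have "\<dots> \<le> norm f + C * (snorm k ?r1 + norm f1) + C * (snorm k ?r2 + norm f2)"
        using L1(2) L2(2) by linarith
      also have "\<dots> \<le> norm f + C * (?H + 4 * ?E) + C * (?H + 4 * ?E)"
      proof -
        have "snorm k ?r1 + norm f1 \<le> ?H + 4 * ?E" "snorm k ?r2 + norm f2 \<le> ?H + 4 * ?E"
          using r1(2) r2(2) hH nE' snorm_nonneg[of "Suc (Suc k)" f] by linarith+
        then show ?thesis using C(1) by (intro add_mono order_refl) (rule mult_left_mono; assumption)+
      qed
      also have "\<dots> \<le> norm f + 2 * (C * (?H + 4 * (C * (?H + norm f))))"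
      proof -
        have "?E \<le> C * (?H + norm f)"
          by (rule order_trans[OF E(2)]) (use C(1) hH(3) in \<open>auto intro!: mult_left_mono\<close>)
        then have "C * (?H + 4 * ?E) \<le> C * (?H + 4 * (C * (?H + norm f)))"
          using C(1) by (intro mult_left_mono) auto
        then show ?thesis by linarith
      qed
      also have "\<dots> \<le> ?K * (?H + norm f)"
        using C(1) snorm_nonneg[of "Suc k" h] by (simp add: algebra_simps)
      finally show ?thesis .
    qed
    ultimately show ?thesis by blast
  qed
  moreover have "0 \<le> ?K" using C(1) by simp
  ultimately show ?case by blast
qed

section \<open>The domain of the square root is the form domain\<close>

lemma Cauchy_norm_le:
  fixes X :: "nat \<Rightarrow> 'b::real_normed_vector" and Y :: "nat \<Rightarrow> 'c::real_normed_vector"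
  assumes X: "Cauchy X" and le: "\<And>m n. norm (Y m - Y n) \<le> norm (X m - X n)"
  shows "Cauchy Y"
proof (rule metric_CauchyI)
  fix e :: real assume "0 < e"
  then obtain N where "\<And>m n. m \<ge> N \<Longrightarrow> n \<ge> N \<Longrightarrow> dist (X m) (X n) < e"
    using X metric_CauchyD by blast
  then show "\<exists>N. \<forall>m\<ge>N. \<forall>n\<ge>N. dist (Y m) (Y n) < e"
    unfolding dist_norm using le by (meson le_less_trans)
qed

lemma sqrt_graph_unique_value: "(f, g) \<in> sqrt_graph \<Longrightarrow> (f, g') \<in> sqrt_graph \<Longrightarrow> g = g'"
  using subspace_diff[OF subspace_sqrt_graph, of "(f, g)" "(f, g')"] sqrt_graph_single_valued by force

text \<open>Both squared norms are the value \<open>inner f (L f)\<close> of the form; the equality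
  is available here only on the domain of \<open>Lap\<close>.\<close>

lemma sqrt_graph_norm_Lap:
  assumes "(f, g) \<in> sqrt_graph" "f \<in> Domain Lap" "(f, f1) \<in> D1" "(f, f2) \<in> D2"
  shows "norm g = norm (f1, f2)"
proof -
  obtain h where h: "(f, h) \<in> Lap" using assms(2) by blast
  then obtain g' where "(f, g') \<in> sqrt_graph" "(g', h) \<in> sqrt_graph"
    using sqrt_graph_square op_graph_Lap by blast
  then have "(g, h) \<in> sqrt_graph" using sqrt_graph_unique_value assms(1) by blast
  then have "inner g g = inner f h" using sqrt_graph_symmetric assms(1) by blast
  also have "\<dots> = (norm f1)\<^sup>2 + (norm f2)\<^sup>2" using Lap_form[OF h assms(3,4)] by (simp add: inner_commute)
  finally show ?thesis by (simp add: norm_Pair norm_eq_sqrt_inner)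
qed

lemma sqrt_graph_norm_diff:
  assumes "(f, g) \<in> sqrt_graph" "(f', g') \<in> sqrt_graph" "f \<in> Domain Lap" "f' \<in> Domain Lap"
    "(f, f1) \<in> D1" "(f, f2) \<in> D2" "(f', f1') \<in> D1" "(f', f2') \<in> D2"
  shows "norm (g - g') = norm ((f1, f2) - (f1', f2'))"
proof -
  obtain h h' where "(f, h) \<in> Lap" "(f', h') \<in> Lap" using assms(3,4) by blast
  then have "(f - f', h - h') \<in> Lap" using subspace_diff[OF subspace_Lap] by fastforce
  then have "norm (g - g') = norm (f1 - f1', f2 - f2')"
    using subspace_diff[OF subspace_sqrt_graph assms(1,2)]
      subspace_diff[OF G1.subspace_gen assms(5,7)] subspace_diff[OF G2.subspace_gen assms(6,8)]
    by (intro sqrt_graph_norm_Lap) auto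
  then show ?thesis by simp
qed

text \<open>\<open>Domain Lap\<close> is a core of the root, and there the norms of the root and of
  the pair of derivatives agree, also on differences. A sequence converging for the root is thus
  Cauchy for the form, which is closed.\<close>

lemma sqrt_graph_form:
  assumes "(f, g) \<in> sqrt_graph"
  shows "\<exists>f1 f2. (f, f1) \<in> D1 \<and> (f, f2) \<in> D2 \<and> norm g = norm (f1, f2)"
proof -
  obtain F G where FG: "\<And>n. (F n, G n) \<in> sqrt_graph" "\<And>n. F n \<in> Domain Lap" "F \<longlonglongrightarrow> f" "G \<longlonglongrightarrow> g"
    using op_graph_core[OF assms] unfolding op_graph_Lap by blast
  have "\<exists>f1 f2. (F n, f1) \<in> D1 \<and> (F n, f2) \<in> D2" for n
    using FG(2)[of n] Lap_domain by (metis DomainE)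
  then obtain F1 F2 where F12: "\<And>n. (F n, F1 n) \<in> D1" "\<And>n. (F n, F2 n) \<in> D2" by metis
  have diff: "norm (G m - G n) = norm ((F1 m, F2 m) - (F1 n, F2 n))" for m n
    using sqrt_graph_norm_diff[OF FG(1,1) FG(2,2) F12(1,2) F12(1,2)] .
  have "Cauchy (\<lambda>n. (F1 n, F2 n))"
    using LIMSEQ_imp_Cauchy[OF FG(4)] by (rule Cauchy_norm_le) (simp only: diff order_refl)
  then obtain p where p: "(\<lambda>n. (F1 n, F2 n)) \<longlonglongrightarrow> p" using Cauchy_convergent convergentD by blast
  have F1: "F1 \<longlonglongrightarrow> fst p" and F2: "F2 \<longlonglongrightarrow> snd p" using tendsto_fst[OF p] tendsto_snd[OF p] by simp_all
  have "norm g = norm p"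
  proof (rule LIMSEQ_unique)
    show "(\<lambda>n. norm (G n)) \<longlonglongrightarrow> norm g" by (intro tendsto_intros FG)
    have "norm (G n) = norm (F1 n, F2 n)" for n
      using sqrt_graph_norm_Lap[OF FG(1,2) F12] .
    then show "(\<lambda>n. norm (G n)) \<longlonglongrightarrow> norm p" by (simp only:) (intro tendsto_intros p)
  qed
  then show ?thesis
    using G1.gen_limit[OF F12(1) FG(3) F1] G2.gen_limit[OF F12(2) FG(3) F2] by (metis prod.collapse)
qed

text \<open>The reverse passage: \<open>Domain Lap\<close> is a core of the form, and the root is
  closed.\<close>

lemma form_domain_sqrt:
  assumes "(f, f1) \<in> D1" "(f, f2) \<in> D2"
  shows "f \<in> Domain sqrt_graph"
proof -
  obtain F F1 F2 where F: "\<And>n. F n \<in> Domain Lap" "\<And>n. (F n, F1 n) \<in> D1" "\<And>n. (F n, F2 n) \<in> D2"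
    "F \<longlonglongrightarrow> f" "F1 \<longlonglongrightarrow> f1" "F2 \<longlonglongrightarrow> f2" using Lap_core[OF assms] by metis
  have "\<exists>g. (F n, g) \<in> sqrt_graph" for n
    using F(1)[of n] sqrt_graph_square op_graph_Lap by (auto simp: Domain_iff) (metis relcomp.cases prod.inject)
  then obtain G where G: "\<And>n. (F n, G n) \<in> sqrt_graph" by metis
  have diff: "norm (G m - G n) = norm ((F1 m, F2 m) - (F1 n, F2 n))" for m n
    using sqrt_graph_norm_diff[OF G G F(1,1) F(2,3) F(2,3)] .
  have "Cauchy (\<lambda>n. (F1 n, F2 n))" 
    by (rule LIMSEQ_imp_Cauchy[OF tendsto_Pair[OF F(5,6)]])
  then have "Cauchy G" by (rule Cauchy_norm_le) (simp only: diff order_refl)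
  then obtain g where "G \<longlonglongrightarrow> g" using Cauchy_convergent convergentD by blast
  then have "(f, g) \<in> sqrt_graph"
    using closed_sequentially[OF closed_sqrt_graph, of "\<lambda>n. (F n, G n)"] tendsto_Pair[OF F(4)] G by blast
  then show ?thesis by blast
qed

text \<open>The symmetry of the square root \<open>S\<close> makes \<open>k \<mapsto> \<parallel>S\<^sup>k f\<parallel>\<close> logarithmically convex.\<close>
lemma power_two_bound:
  assumes L: "(f, h) \<in> Lap" and g: "(h, g) \<in> sqrt_graph ^^ m"
  shows "norm h \<le> real m * norm f + norm g"
proof -
  obtain g1 where g1: "(f, g1) \<in> sqrt_graph" "(g1, h) \<in> sqrt_graph"
    using L sqrt_graph_square op_graph_Lap by blast
  obtain a where a: "a 0 = h" "a m = g" "\<And>i. i < m \<Longrightarrow> (a i, a (Suc i)) \<in> sqrt_graph"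
    using g relpow_fun_conv by metis
  \<comment> \<open>\<open>b i\<close> is the root applied \<open>i + 1\<close> times to
    \<open>f\<close>; thus \<open>b 1\<close> is \<open>h\<close> and \<open>b (Suc m)\<close> is
    \<open>g\<close>.\<close>
  define b where "b = case_nat g1 a"
  have b: "(b i, b (Suc i)) \<in> sqrt_graph" if "i \<le> m" for i
    using that g1(2) a by (cases i) (auto simp: b_def)
  \<comment> \<open>An additive form of convexity that can be carried along the chain: were it
    false, \<open>inner x z \<le> (norm f + norm y) * norm z\<close> would fall below the square of
    \<open>norm y\<close>, which equals \<open>inner x z\<close>.\<close>
  have step: "norm y \<le> norm f + norm z"
    if "(x, y) \<in> sqrt_graph" "(y, z) \<in> sqrt_graph" "norm x \<le> norm f + norm y" for x y z
  proof (rule ccontr)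
    assume "\<not> norm y \<le> norm f + norm z"
    then have *: "norm f + norm z < norm y" by simp
    have "norm y * norm y = inner x z"
      using sqrt_graph_symmetric[OF that(1,2)] by (simp flip: power2_eq_square add: power2_norm_eq_inner)
    also have "\<dots> \<le> norm x * norm z" by (rule norm_cauchy_schwarz)
    also have "\<dots> \<le> (norm f + norm y) * norm z" using that(3) by (intro mult_right_mono) auto
    also have "\<dots> \<le> norm f * norm y + norm y * norm z"
      using * norm_ge_zero[of f] mult_left_mono[of "norm z" "norm y" "norm f"] by (simp add: distrib_right)
    also have "\<dots> = (norm f + norm z) * norm y" by (simp add: algebra_simps)
    also have "\<dots> < norm y * norm y"
      using * norm_ge_zero[of f] norm_ge_zero[of z] by (intro mult_strict_right_mono) linarith+
    finally show False by simp
  qed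
  have b_step: "norm (b i) \<le> norm f + norm (b (Suc i))" if "i \<le> m" for i
    using that
  proof (induction i)
    case 0
    show ?case using step[of f g1 h] g1 a(1) by (simp add: b_def)
  next
    case (Suc i)
    then show ?case using step[OF b[of i] b[of "Suc i"]] by simp
  qed
  have "norm (b 1) \<le> real i * norm f + norm (b (Suc i))" if "i \<le> m" for i
    using that
  proof (induction i)
    case (Suc i)
    then show ?case using b_step[of "Suc i"] by (simp add: algebra_simps)
  qed simp
  from this[of m] show ?thesis using a by (simp add: b_def)
qed

section \<open>Powers of the square root\<close>

abbreviation words :: "nat \<Rightarrow> nat list set" where
  "words m \<equiv> {js. length js = m \<and> set js \<subseteq> {1, 2}}"

lemma finite_words: "finite (words m)"
  using finite_lists_length_eq[of "{1, 2 :: nat}" m] by (simp add: conj_commute)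

text \<open>The estimates differ in strength on purpose: the first bounds all derivatives up to
  order \<open>m\<close>, as \<open>Lap_regularity\<close> asks of its right-hand side; the second
  admits words of full length only, since that is all the norm of the theorem contains.\<close>

theorem sqrt_power_Sobolev:
  "Domain (sqrt_graph ^^ m) = Sob m \<and>
   (\<exists>C\<ge>0. \<forall>f g. (f, g) \<in> sqrt_graph ^^ m \<longrightarrow> snorm m f \<le> C * (norm f + norm g)) \<and>
   (\<exists>C\<ge>0. \<forall>f g. (f, g) \<in> sqrt_graph ^^ m \<longrightarrow> norm g \<le> C * (\<Sum>js\<in>words m. norm (wd js f)))"
proof (induction m rule: induct_nat_012)
  case 0
  have w: "words 0 = {[]}" by auto
  have "norm g \<le> 1 * (\<Sum>js\<in>words 0. norm (wd js f))" if "(f, g) \<in> sqrt_graph ^^ 0" for f g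
    unfolding w using that by simp
  moreover have "snorm 0 f \<le> 1 * (norm f + norm g)" for f g by simp
  moreover have "Domain (sqrt_graph ^^ 0) = Sob 0" by auto
  ultimately show ?case using zero_le_one by blast
next
  case 1
  have w: "words (Suc 0) = {[1], [2]}" by (auto simp: length_Suc_conv)
  have key: "(f, dd 1 f) \<in> D1 \<and> (f, dd 2 f) \<in> D2 \<and> norm g = norm (dd 1 f, dd 2 f)"
    if "(f, g) \<in> sqrt_graph" for f g
    using sqrt_graph_form[OF that] dd_D1 dd_D2 by metis
  have dom: "Domain sqrt_graph = Sob (Suc 0)"
  proof (intro set_eqI iffI)
    fix f assume "f \<in> Domain sqrt_graph"
    then obtain g where "(f, g) \<in> sqrt_graph" by blast
    then show "f \<in> Sob (Suc 0)" using key by (simp add: Sob_Suc_iff)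
  next
    fix f assume "f \<in> Sob (Suc 0)"
    then show "f \<in> Domain sqrt_graph" using form_domain_sqrt by (auto simp: Sob_Suc_iff)
  qed
  have b: "snorm (Suc 0) f \<le> 3 * (norm f + norm g)" if "(f, g) \<in> sqrt_graph" for f g
  proof -
    have "snorm (Suc 0) f = norm f + norm (dd 1 f) + norm (dd 2 f)" by (simp add: snorm.simps(2))
    moreover have "norm g = norm (dd 1 f, dd 2 f)" using key[OF that] by blast
    ultimately show ?thesis
      using norm_fst_le[of "dd 1 f" "dd 2 f"] norm_snd_le[of "dd 2 f" "dd 1 f"]
        norm_ge_zero[of f] norm_ge_zero[of "(dd 1 f, dd 2 f)"] by argo
  qed
  have c: "norm g \<le> 1 * (\<Sum>js\<in>words (Suc 0). norm (wd js f))" if "(f, g) \<in> sqrt_graph" for f g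
    unfolding w using key[OF that] norm_Pair_le[of "dd 1 f" "dd 2 f"] by simp
  have p: "sqrt_graph ^^ Suc 0 = sqrt_graph" by simp
  show ?case unfolding p
  proof (intro conjI dom)
    show "\<exists>C\<ge>0. \<forall>f g. (f, g) \<in> sqrt_graph \<longrightarrow> snorm (Suc 0) f \<le> C * (norm f + norm g)"
      by (rule exI[of _ 3]) (use b in auto)
    show "\<exists>C\<ge>0. \<forall>f g. (f, g) \<in> sqrt_graph \<longrightarrow> norm g \<le> C * (\<Sum>js\<in>words (Suc 0). norm (wd js f))"
      by (rule exI[of _ 1]) (intro conjI allI impI zero_le_one c)
  qed
next
  case (ge2 m)
  obtain C1 C2 where dom: "Domain (sqrt_graph ^^ m) = Sob m"
    and C1: "0 \<le> C1" "\<And>f g. (f, g) \<in> sqrt_graph ^^ m \<Longrightarrow> snorm m f \<le> C1 * (norm f + norm g)"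
    and C2: "0 \<le> C2" "\<And>f g. (f, g) \<in> sqrt_graph ^^ m \<Longrightarrow> norm g \<le> C2 * (\<Sum>js\<in>words m. norm (wd js f))"
    using ge2(1) by blast
  obtain C where C: "0 \<le> C" "\<And>f h. (f, h) \<in> Lap \<Longrightarrow> h \<in> Sob m \<Longrightarrow>
     f \<in> Sob (Suc (Suc m)) \<and> snorm (Suc (Suc m)) f \<le> C * (snorm m h + norm f)"
    using Lap_regularity[of m] by blast
  have split: "sqrt_graph ^^ Suc (Suc m) = Lap O sqrt_graph ^^ m"
  proof -
    have "sqrt_graph ^^ 2 = Lap"
      by (simp add: numeral_2_eq_2 sqrt_graph_square op_graph_Lap)
    moreover have "Suc (Suc m) = 2 + m" by simp
    ultimately show ?thesis by (simp only: relpow_add)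
  qed
  have lap: "(f, - (dd 1 (dd 1 f) + dd 2 (dd 2 f))) \<in> Lap \<and> dd 1 (dd 1 f) \<in> Sob m \<and> dd 2 (dd 2 f) \<in> Sob m"
    if f: "f \<in> Sob (Suc (Suc m))" for f
  proof -
    have "f \<in> Sob 2" using Sob_antimono[OF _ f, of 2] by simp
    moreover have "dd 1 (dd 1 f) \<in> Sob m" "dd 2 (dd 2 f) \<in> Sob m"
      using Sob_dd[OF f] Sob_dd by blast+
    ultimately show ?thesis using Lap_dd by blast
  qed
  have dom2: "Domain (sqrt_graph ^^ Suc (Suc m)) = Sob (Suc (Suc m))"
  proof (intro set_eqI iffI)
    fix f assume "f \<in> Domain (sqrt_graph ^^ Suc (Suc m))"
    then obtain h where "(f, h) \<in> Lap" "h \<in> Sob m" unfolding split using dom by blast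
    then show "f \<in> Sob (Suc (Suc m))" using C(2) by blast
  next
    fix f assume f: "f \<in> Sob (Suc (Suc m))"
    let ?h = "- (dd 1 (dd 1 f) + dd 2 (dd 2 f))"
    have "?h \<in> Sob m" using lap[OF f] Sob_add Sob_scale[of "dd 1 (dd 1 f) + dd 2 (dd 2 f)" m "- 1"] by simp
    then show "f \<in> Domain (sqrt_graph ^^ Suc (Suc m))" unfolding split using dom lap[OF f] by blast
  qed
  \<comment> \<open>\<open>power_two_bound\<close> removes the intermediate \<open>h\<close>:
    \<open>norm h + norm g\<close> is at most \<open>real m * norm f + 2 * norm g\<close>, whence
    the factor \<open>real m + 2\<close>.\<close>
  have b: "snorm (Suc (Suc m)) f \<le> C * (C1 * (real m + 2) + 1) * (norm f + norm g)"
    if fg: "(f, g) \<in> sqrt_graph ^^ Suc (Suc m)" for f g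
  proof -
    obtain h where h: "(f, h) \<in> Lap" "(h, g) \<in> sqrt_graph ^^ m" using fg unfolding split by blast
    have "h \<in> Sob m" using h(2) dom by blast
    then have "snorm (Suc (Suc m)) f \<le> C * (snorm m h + norm f)" using C(2) h(1) by blast
    also have "\<dots> \<le> C * (C1 * (norm h + norm g) + norm f)"
      using C(1) C1(2)[OF h(2)] by (intro mult_left_mono add_right_mono)
    also have "\<dots> \<le> C * (C1 * ((real m + 2) * (norm f + norm g)) + (norm f + norm g))"
    proof (intro mult_left_mono[OF _ C(1)] add_mono mult_left_mono[OF _ C1(1)])
      have "(real m + 2) * (norm f + norm g) = real m * norm f + real m * norm g + 2 * norm f + 2 * norm g"
        by (simp add: algebra_simps)
      moreover have "0 \<le> real m * norm g" by simp
      ultimately show "norm h + norm g \<le> (real m + 2) * (norm f + norm g)"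
        using power_two_bound[OF h] norm_ge_zero[of f] norm_ge_zero[of g] by linarith
    qed simp
    also have "\<dots> = C * (C1 * (real m + 2) + 1) * (norm f + norm g)" by (simp add: algebra_simps)
    finally show ?thesis .
  qed
  \<comment> \<open>Inserting \<open>h = - (D1 D1 f + D2 D2 f)\<close> turns a word of length
    \<open>m\<close> into two words ending in a repeated letter. Each is one summand of the sum over
    length \<open>m + 2\<close>, hence the factor 2 per word.\<close>
  have c: "norm g \<le> C2 * (real (card (words m)) * 2) * (\<Sum>js\<in>words (Suc (Suc m)). norm (wd js f))"
    if fg: "(f, g) \<in> sqrt_graph ^^ Suc (Suc m)" for f g
  proof -
    let ?S = "\<Sum>js\<in>words (Suc (Suc m)). norm (wd js f)"
    have f: "f \<in> Sob (Suc (Suc m))" using dom2 fg by blast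
    obtain h where h: "(f, h) \<in> Lap" "(h, g) \<in> sqrt_graph ^^ m" using fg unfolding split by blast
    have h_eq: "h = (- 1) *\<^sub>R (dd 1 (dd 1 f) + dd 2 (dd 2 f))" using lap[OF f] h(1) Lap_unique by force
    have "norm (wd js h) \<le> 2 * ?S" if js: "js \<in> words m" for js
    proof -
      have len: "length js = m" and set: "set js \<subseteq> {1, 2}" using js by blast+
      have s: "dd 1 (dd 1 f) \<in> Sob (length js)" "dd 2 (dd 2 f) \<in> Sob (length js)"
        using lap[OF f] unfolding len by blast+
      have "wd js h = - (wd js (dd 1 (dd 1 f)) + wd js (dd 2 (dd 2 f)))"
        unfolding h_eq wd_scale[OF Sob_add[OF s] set] wd_add[OF s set] by (rule scaleR_minus1_left)
      then have "norm (wd js h) = norm (wd js (dd 1 (dd 1 f)) + wd js (dd 2 (dd 2 f)))"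
        by (simp only: norm_minus_cancel)
      also have "\<dots> \<le> norm (wd js (dd 1 (dd 1 f))) + norm (wd js (dd 2 (dd 2 f)))"
        by (rule norm_triangle_ineq)
      finally have "norm (wd js h) \<le> norm (wd js (dd 1 (dd 1 f))) + norm (wd js (dd 2 (dd 2 f)))" .
      moreover have S: "norm (wd js (dd j (dd j f))) \<le> ?S" if j: "j \<in> {1, 2}" for j
      proof -
        have m: "js @ [j, j] \<in> words (Suc (Suc m))" using len set j by auto
        have "wd (js @ [j, j]) f = wd js (dd j (dd j f))"
          using wd_append[of "js @ [j]" j f] wd_append[of js j "dd j f"] by simp
        then show ?thesis
          using member_le_sum[OF m _ finite_words, of "\<lambda>js. norm (wd js f)"] by simp
      qed
      have "norm (wd js (dd 1 (dd 1 f))) \<le> ?S" "norm (wd js (dd 2 (dd 2 f))) \<le> ?S"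
        by (rule S, simp)+
      ultimately show ?thesis by linarith
    qed
    then have "(\<Sum>js\<in>words m. norm (wd js h)) \<le> real (card (words m)) * (2 * ?S)"
      by (rule sum_bounded_above)
    then have "C2 * (\<Sum>js\<in>words m. norm (wd js h)) \<le> C2 * (real (card (words m)) * (2 * ?S))"
      using C2(1) by (rule mult_left_mono)
    also have "\<dots> = C2 * (real (card (words m)) * 2) * ?S" by (simp only: mult.assoc)
    finally show ?thesis using C2(2)[OF h(2)] by (rule order_trans[rotated])
  qed
  have b0: "0 \<le> C * (C1 * (real m + 2) + 1)" using C(1) C1(1) by simp
  have c0: "0 \<le> C2 * (real (card (words m)) * 2)" using C2(1) by simp
  show ?case
    using dom2 b b0 c c0 by blast
qed

text \<open>Skewness carries the weak equation for \<open>f\<close> tested with \<open>J g\<close>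
  to the one for \<open>J f\<close> tested with \<open>g\<close>, with the same sign on both sides.
  So \<open>J\<close> commutes with the resolvent and hence with its roots. Applied to
  multiplication by \<open>\<i>\<close>.\<close>

lemma sqrt_graph_skew_commute:
  assumes J: "bounded_linear J" "\<And>x y. inner (J x) y = - inner x (J y)"
    "\<And>t x. J (U1 t x) = U1 t (J x)" "\<And>t x. J (U2 t x) = U2 t (J x)"
    and fg: "(f, g) \<in> sqrt_graph"
  shows "(J f, J g) \<in> sqrt_graph"
proof -
  have D1J: "(J f, J g) \<in> D1" if "(f, g) \<in> D1" for f g
    by (rule G1.gen_bounded_linear[OF that J(1)]) (simp add: J(3))
  have D2J: "(J f, J g) \<in> D2" if "(f, g) \<in> D2" for f g
    by (rule G2.gen_bounded_linear[OF that J(1)]) (simp add: J(4))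
  have LapJ: "(J f, J h) \<in> Lap" if L: "(f, h) \<in> Lap" for f h
  proof -
    obtain f1 f2 where f: "(f, f1) \<in> D1" "(f, f2) \<in> D2" using L by (rule Lap_domain)
    show ?thesis
    proof (rule LapI[OF D1J[OF f(1)] D2J[OF f(2)]])
      fix g g1 g2 assume "(g, g1) \<in> D1" "(g, g2) \<in> D2"
      then have "inner f1 (J g1) + inner f2 (J g2) = inner h (J g)"
        by (intro LapD[OF L f] D1J D2J)
      then show "inner (J f1) g1 + inner (J f2) g2 = inner (J h) g"
        unfolding J(2) by linarith
    qed
  qed
  have "res (J x) = J (res x)" for x
    using LapJ[OF res_Lap[of x]] by (simp add: res_iff bounded_linear.linear[OF J(1)] linear_diff)
  then have "(Blinfun J f, Blinfun J g) \<in> sqrt_graph"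
    by (intro sqrt_graph_commute fg) (simp add: bounded_linear_Blinfun_apply J(1))
  then show ?thesis by (simp add: bounded_linear_Blinfun_apply J(1))
qed

end

section \<open>The Hilbert space of square integrable functions\<close>

lemma borel_measurable_cnj [measurable (raw)]:
  "f \<in> borel_measurable M \<Longrightarrow> (\<lambda>x. cnj (f x)) \<in> borel_measurable M"
  by (rule borel_measurable_continuous_on[OF continuous_on_cnj[OF continuous_on_id]])

lemma sets_mu_l [simp, measurable_cong]: "sets mu_l = sets borel"
  and space_mu_l [simp]: "space mu_l = UNIV"
  by (simp_all add: mu_l_def)

lemma weight_measurable [measurable]:
  "(\<lambda>(a, b). if 0 < a then ennreal (1 / a\<^sup>2) else 0) \<in> borel_measurable (borel :: pt measure)"
  unfolding split_beta borel_prod[symmetric] by measurable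

lemma nn_integral_mu_l:
  assumes "F \<in> borel_measurable borel"
  shows "(\<integral>\<^sup>+p. F p \<partial>mu_l) = (\<integral>\<^sup>+p. (if 0 < fst p then ennreal (1 / (fst p)\<^sup>2) else 0) * F p \<partial>lborel)"
  using assms unfolding mu_l_def by (subst nn_integral_density) (simp_all add: split_beta)

interpretation mu_l: sigma_finite_measure mu_l
  unfolding mu_l_def
  by (subst sigma_finite_measure.sigma_finite_iff_density_finite[OF lborel.sigma_finite_measure_axioms]) (auto simp: split_beta)

lemma L2_iff: "f \<in> L2 \<longleftrightarrow> f \<in> borel_measurable borel \<and> integrable mu_l (\<lambda>p. (cmod (f p))\<^sup>2)"
  by (simp add: L2_def measurable_cong_sets[OF sets_mu_l refl])

lemma L2_measurable: "f \<in> L2 \<Longrightarrow> f \<in> borel_measurable borel"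
  by (simp add: L2_iff)

lemma L2_nn: "f \<in> L2 \<longleftrightarrow> f \<in> borel_measurable borel \<and> (\<integral>\<^sup>+p. ennreal ((cmod (f p))\<^sup>2) \<partial>mu_l) < \<infinity>"
  unfolding L2_iff by (auto simp: integrable_iff_bounded)

lemma nn_nrm: "f \<in> L2 \<Longrightarrow> (\<integral>\<^sup>+p. ennreal ((cmod (f p))\<^sup>2) \<partial>mu_l) = ennreal ((nrm f)\<^sup>2)"
  unfolding nrm_def L2_iff by (subst nn_integral_eq_integral) auto

lemma L2_zero: "(\<lambda>p. 0) \<in> L2" by (simp add: L2_iff)

lemma L2_add:
  assumes "f \<in> L2" "g \<in> L2"
  shows "(\<lambda>p. f p + g p) \<in> L2"
proof -
  have [measurable]: "f \<in> borel_measurable borel" "g \<in> borel_measurable borel"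
    using assms by (simp_all add: L2_iff)
  have "integrable mu_l (\<lambda>p. (cmod (f p + g p))\<^sup>2)"
  proof (rule Bochner_Integration.integrable_bound)
    show "integrable mu_l (\<lambda>p. 2 * (cmod (f p))\<^sup>2 + 2 * (cmod (g p))\<^sup>2)"
      using assms by (auto simp: L2_iff)
    have "(cmod (a + b))\<^sup>2 \<le> 2 * (cmod a)\<^sup>2 + 2 * (cmod b)\<^sup>2" for a b
    proof -
      have "(cmod (a + b))\<^sup>2 \<le> (cmod a + cmod b)\<^sup>2" by (intro power_mono norm_triangle_ineq) simp
      also have "\<dots> \<le> 2 * (cmod a)\<^sup>2 + 2 * (cmod b)\<^sup>2"
        using zero_le_power2[of "cmod a - cmod b"] by (simp add: power2_eq_square algebra_simps)
      finally show ?thesis .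
    qed
    then show "AE p in mu_l. norm ((cmod (f p + g p))\<^sup>2) \<le> norm (2 * (cmod (f p))\<^sup>2 + 2 * (cmod (g p))\<^sup>2)"
      by (simp add: abs_of_nonneg)
  qed measurable
  then show ?thesis by (simp add: L2_iff)
qed

lemma L2_cmult: "f \<in> L2 \<Longrightarrow> (\<lambda>p. c * f p) \<in> L2"
  by (auto simp: L2_iff norm_mult power_mult_distrib)

lemma L2_diff: "f \<in> L2 \<Longrightarrow> g \<in> L2 \<Longrightarrow> (\<lambda>p. f p - g p) \<in> L2"
  using L2_add[of f "\<lambda>p. -1 * g p"] L2_cmult[of g "-1"] by simp

lemma L2_inner_integrable:
  assumes "f \<in> L2" "g \<in> L2"
  shows "integrable mu_l (\<lambda>p. f p * cnj (g p))"
proof (rule Bochner_Integration.integrable_bound)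
  have [measurable]: "f \<in> borel_measurable borel" "g \<in> borel_measurable borel"
    using assms by (simp_all add: L2_iff)
  show "integrable mu_l (\<lambda>p. (cmod (f p))\<^sup>2 + (cmod (g p))\<^sup>2)" using assms by (auto simp: L2_iff)
  show "(\<lambda>p. f p * cnj (g p)) \<in> borel_measurable mu_l" by measurable
  have "a * b \<le> a\<^sup>2 + b\<^sup>2" for a b :: real
    using sum_squares_bound[of a b] zero_le_power2[of a] zero_le_power2[of b] by linarith
  then show "AE p in mu_l. norm (f p * cnj (g p)) \<le> norm ((cmod (f p))\<^sup>2 + (cmod (g p))\<^sup>2)"
    by (simp add: norm_mult abs_of_nonneg)
qed

lemma ae_eq_refl: "ae_eq f f" by (simp add: ae_eq_def)
lemma ae_eq_sym: "ae_eq f g \<Longrightarrow> ae_eq g f" unfolding ae_eq_def by (auto elim: AE_mp)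
lemma ae_eq_trans: "ae_eq f g \<Longrightarrow> ae_eq g h \<Longrightarrow> ae_eq f h"
  unfolding ae_eq_def by (auto elim: AE_mp)

lemma inner_L2_ae_eq:
  assumes "f \<in> L2" "f' \<in> L2" "g \<in> L2" "g' \<in> L2" "ae_eq f f'" "ae_eq g g'"
  shows "inner_L2 f g = inner_L2 f' g'"
proof -
  have [measurable]: "f \<in> borel_measurable borel" "g \<in> borel_measurable borel"
    "f' \<in> borel_measurable borel" "g' \<in> borel_measurable borel"
    using assms by (simp_all add: L2_iff)
  show ?thesis unfolding inner_L2_def
  proof (rule integral_cong_AE)
    show "AE p in mu_l. f p * cnj (g p) = f' p * cnj (g' p)"
      using assms(5,6) unfolding ae_eq_def by eventually_elim simp
  qed measurable
qed

lemma inner_L2_self: "Re (inner_L2 f f) = (\<integral>p. (cmod (f p))\<^sup>2 \<partial>mu_l)"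
  unfolding inner_L2_def
  by (simp only: complex_norm_square[symmetric] integral_complex_of_real Re_complex_of_real)

definition l2rel :: "fn \<Rightarrow> fn \<Rightarrow> bool" where
  "l2rel f g \<longleftrightarrow> f \<in> L2 \<and> g \<in> L2 \<and> ae_eq f g"

quotient_type l2 = fn / partial: l2rel
  morphisms rep_l2 abs_l2
proof (rule part_equivpI)
  show "\<exists>f. l2rel f f" using L2_zero ae_eq_refl unfolding l2rel_def by blast
  show "symp l2rel" by (auto simp: symp_def l2rel_def intro: ae_eq_sym)
  show "transp l2rel" by (auto simp: transp_def l2rel_def intro: ae_eq_trans)
qed

lemma l2rel_refl: "l2rel f f \<longleftrightarrow> f \<in> L2" by (auto simp: l2rel_def ae_eq_refl)

text \<open>With the real part as inner product the quotient is a real Hilbert space with the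
  original norm; the imaginary part is regained through \<open>mul_i\<close>.\<close>

instantiation l2 :: real_inner
begin

lift_definition zero_l2 :: l2 is "\<lambda>p. 0"
  by (simp add: l2rel_refl L2_zero)
lift_definition plus_l2 :: "l2 \<Rightarrow> l2 \<Rightarrow> l2" is "\<lambda>f g p. f p + g p"
  by (auto simp: l2rel_def ae_eq_def intro: L2_add elim!: AE_mp)
lift_definition minus_l2 :: "l2 \<Rightarrow> l2 \<Rightarrow> l2" is "\<lambda>f g p. f p - g p"
  by (auto simp: l2rel_def ae_eq_def intro: L2_diff elim!: AE_mp)
lift_definition uminus_l2 :: "l2 \<Rightarrow> l2" is "\<lambda>f p. - 1 * f p"
  by (auto simp: l2rel_def ae_eq_def intro: L2_cmult[of _ "-1", simplified] elim!: AE_mp)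
lift_definition scaleR_l2 :: "real \<Rightarrow> l2 \<Rightarrow> l2" is "\<lambda>r f p. complex_of_real r * f p"
  by (auto simp: l2rel_def ae_eq_def intro: L2_cmult elim!: AE_mp)
lift_definition inner_l2 :: "l2 \<Rightarrow> l2 \<Rightarrow> real" is "\<lambda>f g. Re (inner_L2 f g)"
  unfolding l2rel_def using inner_L2_ae_eq by metis

definition norm_l2 :: "l2 \<Rightarrow> real" where "norm_l2 x = sqrt (inner x x)"
definition dist_l2 :: "l2 \<Rightarrow> l2 \<Rightarrow> real" where "dist_l2 x y = norm (x - y)"
definition sgn_l2 :: "l2 \<Rightarrow> l2" where "sgn_l2 x = scaleR (inverse (norm x)) x"
definition uniformity_l2 :: "(l2 \<times> l2) filter" where
  "uniformity_l2 = (INF e\<in>{0<..}. principal {(x, y). dist x y < e})"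
definition open_l2 :: "l2 set \<Rightarrow> bool" where
  "open_l2 U \<longleftrightarrow> (\<forall>x\<in>U. \<forall>\<^sub>F (x', y) in uniformity. x' = x \<longrightarrow> y \<in> U)"

instance
proof
  fix x y z :: l2 and r s :: real and U :: "l2 set"
  show "x + y + z = x + (y + z)" by transfer (simp add: l2rel_refl L2_add add.assoc)
  show "x + y = y + x" by transfer (simp add: l2rel_refl L2_add add.commute)
  show "0 + x = x" by transfer (simp add: l2rel_refl)
  show "- x + x = 0" by transfer (simp add: l2rel_refl L2_zero)
  show "x - y = x + - y" by transfer (simp add: l2rel_refl L2_diff)
  show "r *\<^sub>R (x + y) = r *\<^sub>R x + r *\<^sub>R y"
    by transfer (auto simp: l2rel_refl ring_distribs intro!: L2_add L2_cmult)
  show "(r + s) *\<^sub>R x = r *\<^sub>R x + s *\<^sub>R x"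
    by transfer (auto simp: l2rel_refl ring_distribs intro!: L2_add L2_cmult)
  show "r *\<^sub>R s *\<^sub>R x = (r * s) *\<^sub>R x"
    by transfer (auto simp: l2rel_refl mult.assoc intro!: L2_cmult)
  show "1 *\<^sub>R x = x" by transfer (simp add: l2rel_refl)
  show "inner x y = inner y x"
  proof transfer
    fix f g assume "l2rel f f" "l2rel g g"
    have "inner_L2 g f = cnj (inner_L2 f g)"
      unfolding inner_L2_def by (subst Bochner_Integration.integral_cnj[symmetric]) (simp add: mult.commute)
    then show "Re (inner_L2 f g) = Re (inner_L2 g f)" by simp
  qed
  show "inner (x + y) z = inner x z + inner y z"
    by transfer (simp add: l2rel_refl inner_L2_def distrib_right L2_inner_integrable)
  show "inner (r *\<^sub>R x) y = r * inner x y"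
    by transfer (simp add: l2rel_refl inner_L2_def L2_inner_integrable mult.assoc)
  note inner_self = inner_L2_self
  show "0 \<le> inner x x" by transfer (simp add: inner_self)
  show "inner x x = 0 \<longleftrightarrow> x = 0"
  proof transfer
    fix f assume f: "l2rel f f"
    then have "(\<integral>p. (cmod (f p))\<^sup>2 \<partial>mu_l) = 0 \<longleftrightarrow> (AE p in mu_l. (cmod (f p))\<^sup>2 = 0)"
      by (intro integral_nonneg_eq_0_iff_AE) (auto simp: l2rel_refl L2_iff)
    then show "Re (inner_L2 f f) = 0 \<longleftrightarrow> l2rel f (\<lambda>p. 0)"
      using f by (simp add: inner_self l2rel_def L2_zero ae_eq_def)
  qed
  show "norm x = sqrt (inner x x)" by (rule norm_l2_def)
  show "dist x y = norm (x - y)" by (rule dist_l2_def)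
  show "sgn x = scaleR (inverse (norm x)) x" by (rule sgn_l2_def)
  show "uniformity = (INF e\<in>{0<..}. principal {(x :: l2, y). dist x y < e})" by (rule uniformity_l2_def)
  show "open U \<longleftrightarrow> (\<forall>x\<in>U. \<forall>\<^sub>F (x', y) in uniformity. x' = x \<longrightarrow> y \<in> U)" by (rule open_l2_def)
qed

end

lemma abs_l2_eq_iff: "f \<in> L2 \<Longrightarrow> g \<in> L2 \<Longrightarrow> abs_l2 f = abs_l2 g \<longleftrightarrow> ae_eq f g"
  using Quotient3_rel[OF Quotient3_l2, of f g] by (auto simp: l2rel_refl) (auto simp: l2rel_def)

lemma abs_rep_l2 [simp]: "abs_l2 (rep_l2 x) = x"
  by (rule Quotient3_abs_rep[OF Quotient3_l2])

lemma rep_l2_L2 [simp]: "rep_l2 x \<in> L2"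
  using Quotient3_rep_reflp[OF Quotient3_l2, of x] by (simp add: l2rel_refl)

lemma inner_abs_l2: "f \<in> L2 \<Longrightarrow> g \<in> L2 \<Longrightarrow> inner (abs_l2 f) (abs_l2 g) = Re (inner_L2 f g)"
  by (simp add: inner_l2.abs_eq l2rel_refl)

lemma norm_abs_l2: "f \<in> L2 \<Longrightarrow> norm (abs_l2 f) = nrm f"
  unfolding norm_l2_def nrm_def by (simp add: inner_abs_l2 inner_L2_self)

lemma diff_abs_l2: "f \<in> L2 \<Longrightarrow> g \<in> L2 \<Longrightarrow> abs_l2 f - abs_l2 g = abs_l2 (\<lambda>p. f p - g p)"
  by (simp add: minus_l2.abs_eq l2rel_refl)

lemma scaleR_abs_l2: "f \<in> L2 \<Longrightarrow> r *\<^sub>R abs_l2 f = abs_l2 (\<lambda>p. complex_of_real r * f p)"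
  by (simp add: scaleR_l2.abs_eq l2rel_refl)

text \<open>The pointwise half of the Riesz--Fischer theorem. The weights \<open>2^k\<close> leave
  the sum of the integrals finite, and \<open>x \<le> c + x^2 / c\<close> with
  \<open>c = (1/2)^k\<close> turns the weighted square sum into absolute convergence.\<close>

lemma L2_fast_Cauchy_converges:
  assumes f: "\<And>k. f k \<in> L2" and fast: "\<And>k. nrm (\<lambda>p. f (Suc k) p - f k p) \<le> (1/2)^k"
  shows "\<exists>F. F \<in> borel_measurable borel \<and> (AE p in mu_l. (\<lambda>k. f k p) \<longlonglongrightarrow> F p)"
proof -
  have [measurable]: "f k \<in> borel_measurable borel" for k using f by (rule L2_measurable)
  define d where "d k p = f (Suc k) p - f k p" for k p
  have [measurable]: "d k \<in> borel_measurable borel" for k unfolding d_def by measurable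
  have dL2: "d k \<in> L2" for k unfolding d_def by (intro L2_diff f)
  have d_nn: "(\<integral>\<^sup>+p. ennreal (2^k * (cmod (d k p))\<^sup>2) \<partial>mu_l) \<le> ennreal ((1/2)^k)" for k
  proof -
    have "(\<integral>\<^sup>+p. ennreal (2^k * (cmod (d k p))\<^sup>2) \<partial>mu_l) = ennreal (2^k) * (\<integral>\<^sup>+p. ennreal ((cmod (d k p))\<^sup>2) \<partial>mu_l)"
      by (subst nn_integral_cmult[symmetric]) (auto simp: ennreal_mult')
    also have "\<dots> = ennreal (2^k * (nrm (d k))\<^sup>2)" by (simp add: nn_nrm[OF dL2] ennreal_mult')
    also have "\<dots> \<le> ennreal ((1/2)^k)"
    proof (rule ennreal_leI)
      have "(nrm (d k))\<^sup>2 \<le> ((1/2)^k)\<^sup>2"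
        using fast[of k] unfolding d_def by (intro power_mono) (auto simp: nrm_def)
      then have "2^k * (nrm (d k))\<^sup>2 \<le> 2^k * ((1/2)^k)\<^sup>2" by (intro mult_left_mono) auto
      also have "\<dots> = (1/2)^k" by (simp add: power2_eq_square power_mult_distrib[symmetric] flip: mult.assoc)
      finally show "2^k * (nrm (d k))\<^sup>2 \<le> (1/2)^k" .
    qed
    finally show ?thesis .
  qed
  have "(\<integral>\<^sup>+p. (\<Sum>k. ennreal (2^k * (cmod (d k p))\<^sup>2)) \<partial>mu_l) = (\<Sum>k. \<integral>\<^sup>+p. ennreal (2^k * (cmod (d k p))\<^sup>2) \<partial>mu_l)"
    by (rule nn_integral_suminf) measurable
  also have "\<dots> \<le> (\<Sum>k. ennreal ((1/2)^k))" by (intro suminf_le d_nn) auto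
  also have "\<dots> = ennreal (\<Sum>k. (1/2)^k)" by (rule suminf_ennreal2) (auto intro: summable_geometric)
  also have "\<dots> < \<infinity>" by simp
  finally have "AE p in mu_l. (\<Sum>k. ennreal (2^k * (cmod (d k p))\<^sup>2)) \<noteq> \<infinity>"
    by (intro nn_integral_PInf_AE) auto
  then have "AE p in mu_l. (\<lambda>k. f k p) \<longlonglongrightarrow> lim (\<lambda>k. f k p)"
  proof eventually_elim
    case (elim p)
    then have "summable (\<lambda>k. 2^k * (cmod (d k p))\<^sup>2)"
      by (intro summable_suminf_not_top) auto
    then have s: "summable (\<lambda>k. (1/2)^k + 2^k * (cmod (d k p))\<^sup>2)"
      by (intro summable_add summable_geometric) auto
    have le: "cmod (d k p) \<le> (1/2)^k + 2^k * (cmod (d k p))\<^sup>2" for k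
    proof -
      have "0 \<le> 2^k * (cmod (d k p) - (1/2)^k)\<^sup>2" by simp
      also have "\<dots> = 2^k * (cmod (d k p))\<^sup>2 - 2 * cmod (d k p) * (2^k * (1/2)^k) + (2^k * (1/2)^k) * (1/2)^k"
        by (simp add: power2_eq_square algebra_simps)
      also have "2^k * (1/2)^k = (1::real)" by (simp add: power_one_over)
      finally show ?thesis using norm_ge_zero[of "d k p"] by linarith
    qed
    have "summable (\<lambda>k. d k p)"
      by (rule summable_comparison_test'[OF s, of 0]) (use le in auto)
    then have "(\<lambda>n. \<Sum>k<n. d k p) \<longlonglongrightarrow> (\<Sum>k. d k p)" by (rule summable_LIMSEQ)
    moreover have "(\<Sum>k<n. d k p) = f n p - f 0 p" for n
      unfolding d_def by (rule sum_lessThan_telescope)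
    ultimately have "(\<lambda>n. (f n p - f 0 p) + f 0 p) \<longlonglongrightarrow> (\<Sum>k. d k p) + f 0 p"
      by (intro tendsto_add) simp_all
    then have "convergent (\<lambda>k. f k p)" by (auto simp: convergent_def)
    then show ?case by (simp add: convergent_LIMSEQ_iff)
  qed
  moreover have "(\<lambda>p. lim (\<lambda>k. f k p)) \<in> borel_measurable borel" by measurable
  ultimately show ?thesis by blast
qed

instance l2 :: banach
proof
  fix X :: "nat \<Rightarrow> l2" assume X: "Cauchy X"
  have "\<exists>n. \<forall>k. (\<forall>i\<ge>n k. \<forall>j\<ge>n k. norm (X i - X j) < (1/2)^k) \<and> n k < n (Suc k)"
  proof (rule dependent_nat_choice)
    show "\<exists>n. \<forall>i\<ge>n. \<forall>j\<ge>n. norm (X i - X j) < (1/2)^0"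
      using X metric_CauchyD[of X 1] by (auto simp: dist_norm)
    fix n k
    obtain N where N: "\<forall>i\<ge>N. \<forall>j\<ge>N. norm (X i - X j) < (1/2)^(Suc k)"
      using metric_CauchyD[OF X, of "(1/2)^(Suc k)"] by (auto simp: dist_norm)
    show "\<exists>n'. (\<forall>i\<ge>n'. \<forall>j\<ge>n'. norm (X i - X j) < (1/2)^(Suc k)) \<and> n < n'"
      by (rule exI[of _ "max N (Suc n)"]) (use N in auto)
  qed
  then obtain r where r: "\<And>k i j. i \<ge> r k \<Longrightarrow> j \<ge> r k \<Longrightarrow> norm (X i - X j) < (1/2)^k"
    and "\<And>k. r k < r (Suc k)" by blast
  then have mono: "strict_mono r" by (simp add: strict_mono_Suc_iff)
  define f where "f k = rep_l2 (X (r k))" for k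
  have f: "f k \<in> L2" "abs_l2 (f k) = X (r k)" for k by (simp_all add: f_def)
  have [measurable]: "f k \<in> borel_measurable borel" for k using f by (intro L2_measurable)
  have nrm_f: "nrm (\<lambda>p. f i p - f j p) = norm (X (r i) - X (r j))" for i j
    by (simp add: norm_abs_l2[symmetric] L2_diff diff_abs_l2[symmetric] f)
  have "nrm (\<lambda>p. f (Suc k) p - f k p) \<le> (1/2)^k" for k
    unfolding nrm_f using r[of k "r (Suc k)" "r k"] strict_monoD[OF mono, of k "Suc k"] by simp
  then obtain F where [measurable]: "F \<in> borel_measurable borel"
    and F: "AE p in mu_l. (\<lambda>k. f k p) \<longlonglongrightarrow> F p"
    using L2_fast_Cauchy_converges[of f] f(1) by blast
  \<comment> \<open>Fatou's lemma in \<open>j\<close> compares \<open>F\<close> with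
    \<open>f k\<close> before \<open>F\<close> is known to be square integrable.\<close>
  have bound: "(\<integral>\<^sup>+p. ennreal ((cmod (F p - f k p))\<^sup>2) \<partial>mu_l) \<le> ennreal (((1/2)^k)\<^sup>2)" for k
  proof -
    have "(\<integral>\<^sup>+p. ennreal ((cmod (F p - f k p))\<^sup>2) \<partial>mu_l)
        = (\<integral>\<^sup>+p. liminf (\<lambda>j. ennreal ((cmod (f j p - f k p))\<^sup>2)) \<partial>mu_l)"
    proof (rule nn_integral_cong_AE)
      show "AE p in mu_l. ennreal ((cmod (F p - f k p))\<^sup>2) = liminf (\<lambda>j. ennreal ((cmod (f j p - f k p))\<^sup>2))"
        using F
      proof eventually_elim
        case (elim p)
        then have "(\<lambda>j. ennreal ((cmod (f j p - f k p))\<^sup>2)) \<longlonglongrightarrow> ennreal ((cmod (F p - f k p))\<^sup>2)"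
          by (intro tendsto_intros)
        from lim_imp_Liminf[OF _ this] show ?case by simp
      qed
    qed
    also have "\<dots> \<le> liminf (\<lambda>j. \<integral>\<^sup>+p. ennreal ((cmod (f j p - f k p))\<^sup>2) \<partial>mu_l)"
      by (rule nn_integral_liminf) measurable
    also have "\<dots> \<le> ennreal (((1/2)^k)\<^sup>2)"
    proof (rule Liminf_le)
      show "\<forall>\<^sub>F j in sequentially. (\<integral>\<^sup>+p. ennreal ((cmod (f j p - f k p))\<^sup>2) \<partial>mu_l) \<le> ennreal (((1/2)^k)\<^sup>2)"
      proof (rule eventually_sequentiallyI)
        fix j assume "k \<le> j"
        then have "nrm (\<lambda>p. f j p - f k p) \<le> (1/2)^k"
          unfolding nrm_f using r[of k "r j" "r k"] strict_mono_less_eq[OF mono] by (simp add: less_imp_le)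
        then have "(nrm (\<lambda>p. f j p - f k p))\<^sup>2 \<le> ((1/2)^k)\<^sup>2"
          by (intro power_mono) (auto simp: nrm_def)
        then show "(\<integral>\<^sup>+p. ennreal ((cmod (f j p - f k p))\<^sup>2) \<partial>mu_l) \<le> ennreal (((1/2)^k)\<^sup>2)"
          using nn_nrm[OF L2_diff[OF f(1) f(1)], of j k] by (simp add: ennreal_leI)
      qed
    qed simp
    finally show ?thesis .
  qed
  have FfL2: "(\<lambda>p. F p - f k p) \<in> L2" for k
    unfolding L2_nn using bound[of k] by (auto intro: le_less_trans)
  have FL2: "F \<in> L2" using L2_add[OF FfL2[of 0] f(1)[of 0]] by simp
  have "norm (X (r k) - abs_l2 F) \<le> (1/2)^k" for k
  proof -
    have "ennreal ((nrm (\<lambda>p. F p - f k p))\<^sup>2) \<le> ennreal (((1/2)^k)\<^sup>2)"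
      using bound[of k] nn_nrm[OF FfL2[of k]] by simp
    then have "(nrm (\<lambda>p. F p - f k p))\<^sup>2 \<le> ((1/2)^k)\<^sup>2" by (subst (asm) ennreal_le_iff) auto
    then have "nrm (\<lambda>p. F p - f k p) \<le> (1/2)^k" by (rule power2_le_imp_le) simp
    moreover have "nrm (\<lambda>p. F p - f k p) = norm (abs_l2 F - X (r k))"
      by (simp add: norm_abs_l2[symmetric] FfL2 diff_abs_l2[symmetric] f FL2)
    ultimately show ?thesis by (simp add: norm_minus_commute)
  qed
  then have "(\<lambda>k. X (r k) - abs_l2 F) \<longlonglongrightarrow> 0"
    by (intro Lim_null_comparison[OF _ LIMSEQ_power_zero[of "1/2::real"]]) auto
  then have "(X \<circ> r) \<longlonglongrightarrow> abs_l2 F" by (simp add: LIM_zero_iff o_def)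
  then have "X \<longlonglongrightarrow> abs_l2 F" using Cauchy_converges_subseq X mono by blast
  then show "convergent X" by (auto simp: convergent_def)
qed

section \<open>The regular representation\<close>

text \<open>The product of \<open>g\<close> and \<open>p\<close> in the group, so
  \<open>UL g\<close> is composition with a left translation.\<close>

definition aff :: "pt \<Rightarrow> pt \<Rightarrow> pt" where
  "aff g p = (fst g * fst p, fst g * snd p + snd g)"

lemma UL_aff: "UL g f p = f (aff g p)"
  by (simp add: UL_def aff_def split_beta)

lemma UL1_aff: "UL1 t f p = f (aff (exp t, 0) p)"
  by (simp add: UL1_def aff_def split_beta)

lemma UL2_aff: "UL2 t f p = f (aff (1, t) p)"
  by (simp add: UL2_def aff_def split_beta)

lemma aff_measurable [measurable]: "aff g \<in> borel_measurable borel"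
  unfolding aff_def borel_prod[symmetric] by measurable

text \<open>Left invariance: the dilation scales Lebesgue measure on the plane by
  \<open>(fst g)\<^sup>2\<close>, and the weight at \<open>aff g p\<close> carries the inverse
  factor.\<close>

lemma nn_integral_aff:
  assumes g: "0 < fst g" and F [measurable]: "F \<in> borel_measurable borel"
  shows "(\<integral>\<^sup>+p. F (aff g p) \<partial>mu_l) = (\<integral>\<^sup>+p. F p \<partial>mu_l)"
proof -
  define w :: "pt \<Rightarrow> ennreal" where "w p = (if 0 < fst p then ennreal (1 / (fst p)\<^sup>2) else 0)" for p
  have [measurable]: "w \<in> borel_measurable borel"
    unfolding w_def borel_prod[symmetric] by measurable
  have aff: "aff g = (\<lambda>p. (0, snd g) + fst g *\<^sub>R p)"
    by (auto simp: aff_def fun_eq_iff)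
  have "(\<integral>\<^sup>+p. F p \<partial>mu_l) = (\<integral>\<^sup>+p. w p * F p \<partial>lborel)"
    unfolding w_def by (rule nn_integral_mu_l) measurable
  also have "\<dots> = (\<integral>\<^sup>+p. w p * F p \<partial>density (distr lborel borel (aff g)) (\<lambda>_. ennreal (\<bar>fst g\<bar> ^ DIM(pt))))"
    unfolding aff using g by (subst lborel_affine[of "fst g" "(0, snd g)"]) auto
  also have "\<dots> = (\<integral>\<^sup>+p. ennreal ((fst g)\<^sup>2) * (w (aff g p) * F (aff g p)) \<partial>lborel)"
    using g by (subst nn_integral_density) (auto simp: nn_integral_distr power2_eq_square)
  also have "\<dots> = (\<integral>\<^sup>+p. w p * F (aff g p) \<partial>lborel)"
  proof (rule nn_integral_cong)
    fix p
    have "ennreal ((fst g)\<^sup>2) * w (aff g p) = w p"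
      using g by (auto simp: w_def aff_def zero_less_mult_iff power_mult_distrib ennreal_mult'[symmetric])
    then show "ennreal ((fst g)\<^sup>2) * (w (aff g p) * F (aff g p)) = w p * F (aff g p)"
      by (simp flip: mult.assoc)
  qed
  also have "\<dots> = (\<integral>\<^sup>+p. F (aff g p) \<partial>mu_l)"
    unfolding w_def by (rule nn_integral_mu_l[symmetric]) measurable
  finally show ?thesis by simp
qed

lemma aff_measurable_mu_l: "aff g \<in> measurable mu_l mu_l"
  by (simp add: measurable_cong_sets[OF sets_mu_l sets_mu_l])

lemma distr_aff:
  assumes "0 < fst g"
  shows "distr mu_l mu_l (aff g) = mu_l"
proof (rule measure_eqI)
  fix A assume "A \<in> sets (distr mu_l mu_l (aff g))"
  then have A [measurable]: "A \<in> sets borel" by simp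
  have "emeasure (distr mu_l mu_l (aff g)) A = (\<integral>\<^sup>+p. indicator A (aff g p) \<partial>mu_l)"
    using nn_integral_distr[OF aff_measurable_mu_l, where f = "indicator A"] by simp
  also have "\<dots> = (\<integral>\<^sup>+p. indicator A p \<partial>mu_l)" by (rule nn_integral_aff[OF assms]) measurable
  finally show "emeasure (distr mu_l mu_l (aff g)) A = emeasure mu_l A" by simp
qed simp

lemma UL_measurable: "f \<in> borel_measurable borel \<Longrightarrow> UL g f \<in> borel_measurable borel"
  unfolding UL_aff[abs_def] by (rule measurable_compose[OF aff_measurable])

lemma L2_UL:
  assumes "f \<in> L2" "0 < fst g"
  shows "UL g f \<in> L2"
proof -
  have [measurable]: "f \<in> borel_measurable borel" using assms by (simp add: L2_iff)
  have "(\<integral>\<^sup>+p. ennreal ((cmod (f (aff g p)))\<^sup>2) \<partial>mu_l) = (\<integral>\<^sup>+p. ennreal ((cmod (f p))\<^sup>2) \<partial>mu_l)"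
    by (rule nn_integral_aff[OF assms(2)]) measurable
  then show ?thesis using assms(1) UL_measurable[of f g] unfolding L2_nn UL_aff by simp
qed

lemma ae_eq_UL:
  assumes "ae_eq f h" "0 < fst g" "f \<in> borel_measurable borel" "h \<in> borel_measurable borel"
  shows "ae_eq (UL g f) (UL g h)"
proof -
  have [measurable]: "f \<in> borel_measurable borel" "h \<in> borel_measurable borel" by fact+
  have "AE p in distr mu_l mu_l (aff g). f p = h p"
    unfolding distr_aff[OF assms(2)] using assms(1) by (simp add: ae_eq_def)
  then have "AE p in mu_l. f (aff g p) = h (aff g p)"
    by (rule AE_distrD[OF aff_measurable_mu_l])
  then show ?thesis by (simp add: ae_eq_def UL_aff)
qed

lemma inner_UL:
  assumes "f \<in> L2" "h \<in> L2" "0 < fst g"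
  shows "inner_L2 (UL g f) (UL g h) = inner_L2 f h"
proof -
  have [measurable]: "f \<in> borel_measurable borel" "h \<in> borel_measurable borel"
    using assms by (simp_all add: L2_iff)
  have "(\<integral>p. f p * cnj (h p) \<partial>mu_l) = (\<integral>p. f p * cnj (h p) \<partial>distr mu_l mu_l (aff g))"
    by (simp only: distr_aff[OF assms(3)])
  also have "\<dots> = (\<integral>p. f (aff g p) * cnj (h (aff g p)) \<partial>mu_l)"
    by (rule integral_distr[OF aff_measurable_mu_l]) (simp add: measurable_cong_sets[OF sets_mu_l refl])
  finally show ?thesis by (simp add: inner_L2_def UL_aff)
qed

lemma UL1_UL: "UL1 t f = UL (exp t, 0) f" by (rule ext) (simp add: UL1_aff UL_aff)
lemma UL2_UL: "UL2 t f = UL (1, t) f" by (rule ext) (simp add: UL2_aff UL_aff)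

lift_definition u1 :: "real \<Rightarrow> l2 \<Rightarrow> l2" is UL1
  by (auto simp: l2rel_def UL1_UL intro!: L2_UL ae_eq_UL L2_measurable)
lift_definition u2 :: "real \<Rightarrow> l2 \<Rightarrow> l2" is UL2
  by (auto simp: l2rel_def UL2_UL intro!: L2_UL ae_eq_UL L2_measurable)

lemma u1_abs: "f \<in> L2 \<Longrightarrow> u1 t (abs_l2 f) = abs_l2 (UL1 t f)" by (simp add: u1.abs_eq l2rel_refl)
lemma u2_abs: "f \<in> L2 \<Longrightarrow> u2 t (abs_l2 f) = abs_l2 (UL2 t f)" by (simp add: u2.abs_eq l2rel_refl)

lemma L2_UL1: "f \<in> L2 \<Longrightarrow> UL1 t f \<in> L2" by (simp add: UL1_UL L2_UL)
lemma L2_UL2: "f \<in> L2 \<Longrightarrow> UL2 t f \<in> L2" by (simp add: UL2_UL L2_UL)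

lemma l2_cases:
  obtains f where "f \<in> L2" "x = abs_l2 f"
  using rep_l2_L2[of x] abs_rep_l2[of x] by metis

lemma add_abs_l2: "f \<in> L2 \<Longrightarrow> g \<in> L2 \<Longrightarrow> abs_l2 f + abs_l2 g = abs_l2 (\<lambda>p. f p + g p)"
  by (simp add: plus_l2.abs_eq l2rel_refl)

lemma norm_UL: "f \<in> L2 \<Longrightarrow> 0 < fst g \<Longrightarrow> norm (abs_l2 (UL g f)) = norm (abs_l2 f)"
  by (simp add: norm_eq_sqrt_inner inner_abs_l2 L2_UL inner_UL)

section \<open>Strong continuity\<close>

text \<open>Isometries are equicontinuous, so strong continuity passes to limits by splitting the
  error into three; it is then enough to check indicators of boxes.\<close>

lemma closed_isometry_tendsto:
  fixes U :: "real \<Rightarrow> 'a::real_normed_vector \<Rightarrow> 'a"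
  assumes U_diff: "\<And>t x y. U t (x - y) = U t x - U t y" and norm_U: "\<And>t x. norm (U t x) = norm x"
  shows "closed {x. ((\<lambda>t. U t x) \<longlongrightarrow> x) (at 0)}"
proof -
  have "((\<lambda>t. U t x) \<longlongrightarrow> x) (at 0)" if x: "x \<in> closure {x. ((\<lambda>t. U t x) \<longlongrightarrow> x) (at 0)}" for x
  proof (rule tendstoI)
    fix e :: real assume e: "0 < e"
    then obtain y where y: "((\<lambda>t. U t y) \<longlongrightarrow> y) (at 0)" "dist y x < e / 3"
      using x unfolding closure_approachable by (metis divide_pos_pos mem_Collect_eq zero_less_numeral)
    have "\<forall>\<^sub>F t in at 0. dist (U t y) y < e / 3" by (rule tendstoD[OF y(1)]) (use e in simp)
    then show "\<forall>\<^sub>F t in at 0. dist (U t x) x < e"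
    proof eventually_elim
      case (elim t)
      have "norm (U t x - x) = norm (U t (x - y) + (U t y - y) + (y - x))" by (simp add: U_diff)
      also have "\<dots> \<le> norm (U t (x - y)) + norm (U t y - y) + norm (y - x)"
        using norm_triangle_ineq[of "U t (x - y) + (U t y - y)" "y - x"]
          norm_triangle_ineq[of "U t (x - y)" "U t y - y"] by linarith
      also have "\<dots> < e" using y(2) elim by (simp add: norm_U dist_norm norm_minus_commute)
      finally show ?case by (simp add: dist_norm)
    qed
  qed
  then show ?thesis using closure_subset_eq by blast
qed

lemma AE_mu_l_pos: "AE p in mu_l. 0 < fst p"
  unfolding mu_l_def by (subst AE_density) (auto simp: split_beta)

lemma AE_mu_l_lborel:
  assumes "AE p in lborel. P p"
  shows "AE p in mu_l. P p"
  unfolding mu_l_def using assms by (subst AE_density) (auto elim: AE_mp)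

lemma mem_box_pt: "p \<in> box a b \<longleftrightarrow> fst a < fst p \<and> fst p < fst b \<and> snd a < snd p \<and> snd p < snd b" for p a b :: pt
  by (cases p; cases a; cases b) (auto simp: box_def Basis_prod_def)

lemma mem_cbox_pt: "p \<in> cbox a b \<longleftrightarrow> fst a \<le> fst p \<and> fst p \<le> fst b \<and> snd a \<le> snd p \<and> snd p \<le> snd b" for p a b :: pt
  by (cases p; cases a; cases b) (auto simp: cbox_def Basis_prod_def)

lemma emeasure_mu_l_cbox:
  assumes "0 < fst a"
  shows "emeasure mu_l (cbox a b) < \<infinity>"
proof -
  have "emeasure mu_l (cbox a b) = (\<integral>\<^sup>+p. indicator (cbox a b) p \<partial>mu_l)" by simp
  also have "\<dots> = (\<integral>\<^sup>+p. (if 0 < fst p then ennreal (1 / (fst p)\<^sup>2) else 0) * indicator (cbox a b) p \<partial>lborel)"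
    by (rule nn_integral_mu_l) measurable
  also have "\<dots> \<le> (\<integral>\<^sup>+p. ennreal (1 / (fst a)\<^sup>2) * indicator (cbox a b) p \<partial>lborel)"
  proof (rule nn_integral_mono)
    fix p :: pt
    have "1 / (fst p)\<^sup>2 \<le> 1 / (fst a)\<^sup>2" if "fst a \<le> fst p"
      using that assms by (intro divide_left_mono power_mono mult_pos_pos) auto
    then show "(if 0 < fst p then ennreal (1 / (fst p)\<^sup>2) else 0) * indicator (cbox a b) p
        \<le> ennreal (1 / (fst a)\<^sup>2) * indicator (cbox a b) p"
      by (auto simp: mem_cbox_pt indicator_def intro!: ennreal_leI)
  qed
  also have "\<dots> = ennreal (1 / (fst a)\<^sup>2) * emeasure lborel (cbox a b)"
    by (subst nn_integral_cmult_indicator) auto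
  also have "\<dots> < \<infinity>" 
    using emeasure_bounded_finite[OF bounded_cbox[of a b]] by (simp add: ennreal_mult_less_top)
  finally show ?thesis .
qed

lemma L2_indicator:
  assumes [measurable]: "A \<in> sets borel" and "A \<subseteq> cbox a b" "0 < fst a"
  shows "(\<lambda>p. c * indicator A p :: complex) \<in> L2"
proof -
  have "emeasure mu_l A \<le> emeasure mu_l (cbox a b)" using assms by (intro emeasure_mono) auto
  then have "emeasure mu_l A < \<infinity>" using emeasure_mu_l_cbox[OF assms(3), of b] by (rule le_less_trans)
  then have "integrable mu_l (indicator A :: pt \<Rightarrow> real)" by (simp add: integrable_indicator_iff less_top)
  then have "integrable mu_l (\<lambda>p. (cmod c)\<^sup>2 * indicator A p)" by simp
  moreover have "(cmod (c * indicator A p))\<^sup>2 = (cmod c)\<^sup>2 * indicator A p" for p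
    by (simp add: norm_mult power_mult_distrib indicator_def)
  ultimately show ?thesis by (simp add: L2_iff)
qed

text \<open>Dominated convergence: the translated indicators converge off the boundary of the box, a
  null set, and for parameters of modulus at most 1 all are supported in one compact box
  \<open>K\<close>, which keeps away from \<open>fst p = 0\<close>, where the weight is
  unbounded.\<close>

lemma UL_box_tendsto:
  fixes s t :: "nat \<Rightarrow> real" and a b :: pt and c :: complex
  assumes a: "0 < fst a" and s: "s \<longlonglongrightarrow> 0" and t: "t \<longlonglongrightarrow> 0"
  defines "f \<equiv> \<lambda>p. c * indicator (box a b) p :: complex"
  shows "(\<lambda>n. abs_l2 (UL (exp (s n), t n) f)) \<longlonglongrightarrow> abs_l2 f"
proof -
  define M where "M = exp 1 * (\<bar>snd a\<bar> + \<bar>snd b\<bar> + 1)"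
  define K where "K = cbox (exp (- 1) * fst a, - M) (exp 1 * fst b, M)"
  have K_mem: "p \<in> K" if "aff (exp \<sigma>, \<tau>) p \<in> box a b" "\<bar>\<sigma>\<bar> \<le> 1" "\<bar>\<tau>\<bar> \<le> 1" for \<sigma> \<tau> p
  proof -
    have e: "exp \<sigma> \<le> exp 1" "exp (- \<sigma>) \<le> exp 1" "exp (- 1) \<le> exp (- \<sigma>)" using that(2) by auto
    have x: "fst a < exp \<sigma> * fst p" "exp \<sigma> * fst p < fst b"
      and y: "snd a < exp \<sigma> * snd p + \<tau>" "exp \<sigma> * snd p + \<tau> < snd b"
      using that(1) by (auto simp: mem_box_pt aff_def)
    have "exp (- \<sigma>) * fst a \<le> exp (- \<sigma>) * (exp \<sigma> * fst p)" "exp (- \<sigma>) * (exp \<sigma> * fst p) \<le> exp (- \<sigma>) * fst b"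
      using x by (auto intro!: mult_left_mono)
    then have "exp (- \<sigma>) * fst a \<le> fst p" "fst p \<le> exp (- \<sigma>) * fst b"
      by (simp_all add: exp_minus field_simps)
    moreover have "exp (- 1) * fst a \<le> exp (- \<sigma>) * fst a" using e(3) a by (intro mult_right_mono) auto
    moreover have "exp (- \<sigma>) * fst b \<le> exp 1 * fst b" using e(2) x a by (intro mult_right_mono) auto
    moreover have "\<bar>snd p\<bar> \<le> M"
    proof -
      have "\<bar>exp \<sigma> * snd p\<bar> \<le> \<bar>snd a\<bar> + \<bar>snd b\<bar> + 1" using y that(3) by linarith
      then have "exp (- \<sigma>) * \<bar>exp \<sigma> * snd p\<bar> \<le> exp 1 * (\<bar>snd a\<bar> + \<bar>snd b\<bar> + 1)"
        using e(2) by (intro mult_mono) auto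
      then show ?thesis by (simp add: M_def abs_mult exp_minus field_simps)
    qed
    ultimately show ?thesis by (auto simp: K_def mem_cbox_pt)
  qed
  have K0: "0 < fst (exp (- 1) * fst a, - M)" using a by simp
  have boxK: "box a b \<subseteq> K"
    using K_mem[of 0 0] by (auto simp: aff_def)
  have fL2: "f \<in> L2" unfolding f_def by (rule L2_indicator[OF _ boxK[unfolded K_def] K0]) simp
  have [measurable]: "f \<in> borel_measurable borel" using fL2 by (rule L2_measurable)
  have UfL2: "UL (exp (s n), t n) f \<in> L2" for n by (rule L2_UL[OF fL2]) simp
  define q where "q n p = (cmod (f (aff (exp (s n), t n) p) - f p))\<^sup>2" for n p
  obtain N1 N2 where N: "\<And>n. n \<ge> N1 \<Longrightarrow> \<bar>s n\<bar> < 1" "\<And>n. n \<ge> N2 \<Longrightarrow> \<bar>t n\<bar> < 1"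
    using LIMSEQ_D[OF s, of 1] LIMSEQ_D[OF t, of 1] by auto
  define N where "N = max N1 N2"
  have "(\<lambda>n. \<integral>p. q (n + N) p \<partial>mu_l) \<longlonglongrightarrow> (\<integral>p. 0 \<partial>mu_l)"
  proof (rule integral_dominated_convergence)
    show "integrable mu_l (\<lambda>p. (cmod c)\<^sup>2 * indicator K p)"
      using emeasure_mu_l_cbox[OF K0, of "(exp 1 * fst b, M)"]
      by (simp add: K_def integrable_indicator_iff less_top)
    show "q (n + N) \<in> borel_measurable mu_l" for n
      unfolding q_def by (simp add: measurable_cong_sets[OF sets_mu_l refl])
    show "AE p in mu_l. norm (q (n + N) p) \<le> (cmod c)\<^sup>2 * indicator K p" for n
    proof (rule AE_I2)
      fix p
      have "n + N \<ge> N1" "n + N \<ge> N2" by (simp_all add: N_def)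
      then have "\<bar>s (n + N)\<bar> \<le> 1" "\<bar>t (n + N)\<bar> \<le> 1" using N less_imp_le by blast+
      then have "aff (exp (s (n + N)), t (n + N)) p \<in> box a b \<Longrightarrow> p \<in> K" using K_mem by blast
      then show "norm (q (n + N) p) \<le> (cmod c)\<^sup>2 * indicator K p"
        using boxK unfolding q_def f_def by (auto simp: indicator_def norm_minus_commute)
    qed
    have "AE p in lborel. p \<notin> cbox a b - box a b"
    proof (rule AE_not_in)
      have "cbox a b - box a b \<in> null_sets lebesgue"
        using negligible_frontier_interval[of a b] by (simp add: negligible_iff_null_sets)
      then show "cbox a b - box a b \<in> null_sets lborel" by (simp add: null_sets_completion_iff)
    qed
    then have "AE p in mu_l. p \<notin> cbox a b - box a b" by (rule AE_mu_l_lborel)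
    then show "AE p in mu_l. (\<lambda>n. q (n + N) p) \<longlonglongrightarrow> 0"
    proof eventually_elim
      case (elim p)
      have "(\<lambda>n. aff (exp (s n), t n) p) \<longlonglongrightarrow> (exp 0 * fst p, exp 0 * snd p + 0)"
        unfolding aff_def by (intro tendsto_intros) (auto intro: tendsto_eq_intros s t)
      then have lim: "(\<lambda>n. aff (exp (s n), t n) p) \<longlonglongrightarrow> p" by simp
      have "\<forall>\<^sub>F n in sequentially. f (aff (exp (s n), t n) p) = f p"
      proof (cases "p \<in> box a b")
        case True
        then have "\<forall>\<^sub>F n in sequentially. aff (exp (s n), t n) p \<in> box a b"
          using topological_tendstoD[OF lim open_box] by blast
        then show ?thesis by eventually_elim (simp add: f_def True)
      next
        case False
        then have "p \<in> - cbox a b" using elim by simp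
        then have "\<forall>\<^sub>F n in sequentially. aff (exp (s n), t n) p \<in> - cbox a b"
          using topological_tendstoD[OF lim open_Compl[OF closed_cbox]] by blast
        then show ?thesis
          by eventually_elim (use False box_subset_cbox[of a b] in \<open>auto simp: f_def indicator_def\<close>)
      qed
      then have "\<forall>\<^sub>F n in sequentially. q n p = 0" by eventually_elim (simp add: q_def)
      then have "(\<lambda>n. q n p) \<longlonglongrightarrow> 0" by (rule tendsto_eventually)
      then show ?case by (rule LIMSEQ_ignore_initial_segment)
    qed
  qed simp
  then have "(\<lambda>n. \<integral>p. q n p \<partial>mu_l) \<longlonglongrightarrow> 0" by (simp add: LIMSEQ_offset)
  then have "(\<lambda>n. sqrt (\<integral>p. q n p \<partial>mu_l)) \<longlonglongrightarrow> sqrt 0" by (rule tendsto_real_sqrt)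
  moreover have "sqrt (\<integral>p. q n p \<partial>mu_l) = norm (abs_l2 (UL (exp (s n), t n) f) - abs_l2 f)" for n
    unfolding diff_abs_l2[OF UfL2 fL2] norm_abs_l2[OF L2_diff[OF UfL2 fL2]]
    by (simp add: nrm_def q_def UL_aff)
  ultimately have "(\<lambda>n. norm (abs_l2 (UL (exp (s n), t n) f) - abs_l2 f)) \<longlonglongrightarrow> 0" by simp
  then show ?thesis by (simp add: tendsto_norm_zero_iff LIM_zero_iff)
qed

text \<open>Boxes form an intersection-stable generator, so the integrals vanish over all Borel
  sets. The cut-off to \<open>\<Omega> n\<close>, a box of finite measure, makes \<open>f\<close>
  integrable there, and these boxes exhaust the group.\<close>

lemma ae_zero_of_box_integrals:
  assumes f: "f \<in> L2"
    and zero: "\<And>a b. 0 < fst a \<Longrightarrow> (\<integral>p. f p * cnj (indicator (box a b) p) \<partial>mu_l) = 0"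
  shows "ae_eq f (\<lambda>p. 0)"
proof -
  have [measurable]: "f \<in> borel_measurable borel" using f by (rule L2_measurable)
  define \<Omega> :: "nat \<Rightarrow> pt set" where "\<Omega> n = box (1 / Suc n, - real (Suc n)) (real (Suc n), real (Suc n))" for n
  have on_\<Omega>: "AE p in mu_l. p \<in> \<Omega> n \<longrightarrow> f p = 0" for n
  proof -
    have [measurable]: "\<Omega> n \<in> sets borel" by (simp add: \<Omega>_def)
    define h where "h p = f p * cnj (indicator (\<Omega> n) p)" for p
    have "(\<lambda>p. 1 * indicator (\<Omega> n) p :: complex) \<in> L2"
      by (rule L2_indicator[of _ "(1 / Suc n, - real (Suc n))" "(real (Suc n), real (Suc n))"])
        (use box_subset_cbox in \<open>auto simp: \<Omega>_def\<close>)
    then have h: "integrable mu_l h"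
      unfolding h_def using L2_inner_integrable[OF f] by simp
    have "set_lebesgue_integral mu_l B h = 0" if "B \<in> sets borel" for B
    proof -
      let ?G = "range (\<lambda>(a, b). box a b :: pt set)"
      have B: "B \<in> sigma_sets UNIV ?G" using that unfolding borel_eq_box by simp
      have Int: "box a b \<inter> box c d = box (max (fst a) (fst c), max (snd a) (snd c)) (min (fst b) (fst d), min (snd b) (snd d))"
        for a b c d :: pt by (auto simp: mem_box_pt)
      have meas: "B \<in> sets mu_l" if "B \<in> sigma_sets UNIV ?G" for B
        using that by (simp add: borel_eq_box)
      have sint: "set_integrable mu_l B h" if "B \<in> sigma_sets UNIV ?G" for B
        unfolding set_integrable_def using h meas[OF that] by (rule integrable_mult_indicator[rotated])
      have \<Omega>0: "set_lebesgue_integral mu_l UNIV h = 0"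
        using zero[of "(1 / Suc n, - real (Suc n))"] by (simp add: set_lebesgue_integral_def h_def \<Omega>_def)
      have "Int_stable ?G"
      proof (rule Int_stableI)
        fix A B assume "A \<in> ?G" "B \<in> ?G"
        then obtain a b c d where "A = box a b" "B = box c d" by auto
        then show "A \<inter> B \<in> ?G" unfolding Int by (metis (no_types) Int case_prod_conv rangeI)
      qed
      moreover have "?G \<subseteq> Pow UNIV" by simp
      ultimately show ?thesis using B
      proof (induction rule: sigma_sets_induct_disjoint)
        case (basic A)
        then obtain a b where A: "A = box a b" by auto
        have "set_lebesgue_integral mu_l A h = (\<integral>p. f p * cnj (indicator (A \<inter> \<Omega> n) p) \<partial>mu_l)"
          unfolding set_lebesgue_integral_def h_def
          by (rule Bochner_Integration.integral_cong) (auto simp: indicator_def)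
        \<comment> \<open>Intersecting with \<open>\<Omega> n\<close> keeps the left edge positive,
          as \<open>zero\<close> demands.\<close>
        also have "\<dots> = 0" unfolding A \<Omega>_def Int by (rule zero) (simp add: less_max_iff_disj)
        finally show ?case .
      next
        case empty
        then show ?case by (simp add: set_lebesgue_integral_def)
      next
        case (compl A)
        have "UNIV - A \<in> sigma_sets UNIV ?G" using compl(1) by (rule sigma_sets.Compl)
        then have "set_lebesgue_integral mu_l (A \<union> (UNIV - A)) h
            = set_lebesgue_integral mu_l A h + set_lebesgue_integral mu_l (UNIV - A) h"
          using compl(1) by (intro set_integral_Un sint) auto
        then show ?case using compl(2) \<Omega>0 by (simp add: Un_Diff_cancel)
      next
        case (union A)
        have "(\<Union>i. A i) \<in> sigma_sets UNIV ?G" using union(2) by (intro sigma_sets.Union) auto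
        moreover have mA: "A i \<in> sigma_sets UNIV ?G" for i using union(2) by blast
        moreover have "A i \<inter> A j = {}" if "i \<noteq> j" for i j
          using union(1) that by (simp add: disjoint_family_on_def)
        ultimately have "set_lebesgue_integral mu_l (\<Union>i. A i) h = (\<Sum>i. set_lebesgue_integral mu_l (A i) h)"
          by (intro lebesgue_integral_countable_add meas sint)
        then show ?case using union(3) by simp
      qed
    qed
    then have "AE p in mu_l. h p = 0" by (intro mu_l.density_zero[OF h]) simp
    then show ?thesis by eventually_elim (auto simp: h_def)
  qed
  have "AE p in mu_l. \<forall>n. p \<in> \<Omega> n \<longrightarrow> f p = 0" unfolding AE_all_countable using on_\<Omega> by blast
  then have "AE p in mu_l. f p = 0" using AE_mu_l_pos
  proof eventually_elim
    case (elim p)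
    obtain n where n: "max (max (1 / fst p) (fst p)) \<bar>snd p\<bar> < real n" using reals_Archimedean2 by blast
    then have "1 / fst p < real (Suc n)" "fst p < real (Suc n)" "\<bar>snd p\<bar> < real (Suc n)" by auto
    then have "p \<in> \<Omega> n" using elim(2) by (auto simp: \<Omega>_def mem_box_pt field_simps)
    then show ?case using elim(1) by blast
  qed
  then show ?thesis by (simp add: ae_eq_def)
qed

text \<open>Orthogonality concerns real parts only; the coefficients 1 and \<open>\<i>\<close>
  recover the complex integral.\<close>

lemma l2_boxes_total:
  fixes V :: "l2 set"
  assumes V: "subspace V" "closed V"
    and box: "\<And>a b c. 0 < fst a \<Longrightarrow> abs_l2 (\<lambda>p. c * indicator (box a b) p) \<in> V"
  shows "V = UNIV"
proof -
  have "closure V = UNIV"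
  proof (rule dense_by_orthogonality[OF V(1)])
    fix u assume u: "\<And>q. q \<in> V \<Longrightarrow> inner u q = 0"
    obtain f where f: "f \<in> L2" "u = abs_l2 f" by (rule l2_cases)
    have "(\<integral>p. f p * cnj (indicator (box a b) p) \<partial>mu_l) = 0" if a: "0 < fst a" for a b
    proof -
      define z where "z = (\<integral>p. f p * cnj (indicator (box a b) p) \<partial>mu_l)"
      have i: "(\<lambda>p. c * indicator (box a b) p :: complex) \<in> L2" for c
        by (rule L2_indicator[OF _ box_subset_cbox a]) simp
      have "Re (cnj c * z) = 0" for c
      proof -
        have "inner u (abs_l2 (\<lambda>p. c * indicator (box a b) p)) = 0" using u box[OF a] by blast
        then have "Re (\<integral>p. f p * cnj (c * indicator (box a b) p) \<partial>mu_l) = 0"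
          using f i by (simp add: inner_abs_l2 inner_L2_def)
        also have "(\<integral>p. f p * cnj (c * indicator (box a b) p) \<partial>mu_l) = cnj c * z"
          unfolding z_def by (subst integral_mult_right_zero[symmetric]) (simp add: mult.left_commute)
        finally show ?thesis .
      qed
      from this[of 1] this[of \<i>] have "z = 0" by (simp add: complex_eq_iff)
      then show ?thesis by (simp add: z_def)
    qed
    then have "ae_eq f (\<lambda>p. 0)" using ae_zero_of_box_integrals[OF f(1)] by blast
    then show "u = 0" using f abs_l2_eq_iff[OF f(1) L2_zero] by (simp add: zero_l2_def)
  qed
  then show ?thesis using V(2) closure_closed by blast
qed

text \<open>Phrased for a curve in the group so that dilations and translations are both instances;
  \<open>box\<close> provides the continuity on a total set.\<close>

lemma u_isometry_group:
  fixes u :: "real \<Rightarrow> l2 \<Rightarrow> l2" and \<gamma> :: "real \<Rightarrow> pt"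
  assumes u: "\<And>t f. f \<in> L2 \<Longrightarrow> u t (abs_l2 f) = abs_l2 (UL (\<gamma> t) f)"
    and \<gamma>_pos: "\<And>t. 0 < fst (\<gamma> t)"
    and \<gamma>_group: "\<And>s t p. aff (\<gamma> (s + t)) p = aff (\<gamma> t) (aff (\<gamma> s) p)" and \<gamma>_0: "\<And>p. aff (\<gamma> 0) p = p"
    and box: "\<And>a b c X. 0 < fst a \<Longrightarrow> X \<longlonglongrightarrow> 0 \<Longrightarrow>
      (\<lambda>n. abs_l2 (UL (\<gamma> (X n)) (\<lambda>p. c * indicator (box a b) p))) \<longlonglongrightarrow> abs_l2 (\<lambda>p. c * indicator (box a b) p)"
  shows "isometry_group u"
proof -
  have add: "u t (x + y) = u t x + u t y" for t x y
  proof -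
    obtain f g where "f \<in> L2" "x = abs_l2 f" "g \<in> L2" "y = abs_l2 g" by (metis l2_cases)
    then show ?thesis by (simp add: u add_abs_l2 L2_add L2_UL \<gamma>_pos) (simp add: UL_aff[abs_def])
  qed
  have scale: "u t (r *\<^sub>R x) = r *\<^sub>R u t x" for t r x
  proof -
    obtain f where "f \<in> L2" "x = abs_l2 f" by (metis l2_cases)
    then show ?thesis by (simp add: u scaleR_abs_l2 L2_cmult L2_UL \<gamma>_pos) (simp add: UL_aff[abs_def])
  qed
  have norm: "norm (u t x) = norm x" for t x
  proof -
    obtain f where "f \<in> L2" "x = abs_l2 f" by (metis l2_cases)
    then show ?thesis by (simp add: u norm_UL \<gamma>_pos)
  qed
  have "linear (u t)" for t by (rule linearI) (rule add scale)+
  then have diff: "u t (x - y) = u t x - u t y" for t x y by (rule linear_diff)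
  let ?V = "{x. ((\<lambda>t. u t x) \<longlongrightarrow> x) (at 0)}"
  have "?V = UNIV"
  proof (rule l2_boxes_total)
    show "closed ?V" using diff norm by (rule closed_isometry_tendsto)
    show "subspace ?V"
    proof (rule subspaceI)
      show "0 \<in> ?V" using linear_0[OF \<open>\<And>t. linear (u t)\<close>] by simp
    qed (auto simp: add scale intro: tendsto_add tendsto_scaleR)
    fix a b :: pt and c assume a: "0 < fst a"
    have i: "(\<lambda>p. c * indicator (box a b) p :: complex) \<in> L2"
      by (rule L2_indicator[OF _ box_subset_cbox a]) simp
    show "abs_l2 (\<lambda>p. c * indicator (box a b) p) \<in> ?V"
      unfolding mem_Collect_eq tendsto_at_iff_sequentially comp_def using box[OF a] i by (simp add: u)
  qed
  then show ?thesis
  proof (unfold_locales)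
    show "u (s + t) x = u s (u t x)" for s t x
    proof -
      obtain f where "f \<in> L2" "x = abs_l2 f" by (metis l2_cases)
      then show ?thesis by (simp add: u L2_UL \<gamma>_pos) (simp add: UL_aff[abs_def] \<gamma>_group)
    qed
    show "u 0 x = x" for x
    proof -
      obtain f where "f \<in> L2" "x = abs_l2 f" by (metis l2_cases)
      then show ?thesis by (simp add: u) (simp add: UL_aff[abs_def] \<gamma>_0)
    qed
  qed (auto simp: add scale norm)
qed

interpretation reg: affine_rep u1 u2
proof (intro affine_rep.intro affine_rep_axioms.intro)
  show "isometry_group u1"
  proof (rule u_isometry_group[of _ "\<lambda>t. (exp t, 0)"])
    show "(\<lambda>n. abs_l2 (UL (exp (X n), 0) (\<lambda>p. c * indicator (box a b) p))) \<longlonglongrightarrow> abs_l2 (\<lambda>p. c * indicator (box a b) p)"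
      if "0 < fst a" "X \<longlonglongrightarrow> 0" for a b c X
      using UL_box_tendsto[OF that(1,2) tendsto_const] .
  qed (simp_all add: u1_abs UL1_UL aff_def exp_add)
  show "isometry_group u2"
  proof (rule u_isometry_group[of _ "\<lambda>t. (1, t)"])
    show "(\<lambda>n. abs_l2 (UL (1, X n) (\<lambda>p. c * indicator (box a b) p))) \<longlonglongrightarrow> abs_l2 (\<lambda>p. c * indicator (box a b) p)"
      if "0 < fst a" "X \<longlonglongrightarrow> 0" for a b c X
      using UL_box_tendsto[OF that(1) tendsto_const that(2)] by simp
  qed (simp_all add: u2_abs UL2_UL aff_def)
  show "u1 s (u2 t x) = u2 (exp (- s) * t) (u1 s x)" for s t x
  proof -
    obtain f where f: "f \<in> L2" "x = abs_l2 f" by (metis l2_cases)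
    then show ?thesis
      by (simp add: u1_abs u2_abs L2_UL1 L2_UL2)
        (simp add: UL1_def UL2_def split_beta' distrib_left flip: mult.assoc exp_add)
  qed
qed

section \<open>Garding vectors\<close>

interpretation mu_l_pair: pair_sigma_finite mu_l mu_l ..

lemma aff_pair_measurable [measurable]:
  "(\<lambda>x. aff (fst x) (snd x)) \<in> borel_measurable (mu_l \<Otimes>\<^sub>M mu_l)"
proof -
  have "(\<lambda>x. aff (fst x) (snd x)) \<in> borel_measurable (borel \<Otimes>\<^sub>M borel)"
    unfolding aff_def borel_prod[symmetric] by measurable
  then show ?thesis by (simp cong: measurable_cong_sets)
qed

locale garding_weight =
  fixes w :: "pt \<Rightarrow> real" and f :: fn
  assumes w: "integrable mu_l w" and w_pos: "\<And>g. fst g \<le> 0 \<Longrightarrow> w g = 0" and f: "f \<in> L2"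
begin

lemma w_measurable [measurable]: "w \<in> borel_measurable borel"
  using borel_measurable_integrable[OF w] by (simp cong: measurable_cong_sets)

lemma f_measurable [measurable]: "f \<in> borel_measurable borel"
  using f by (rule L2_measurable)

lemma nn_w: "(\<integral>\<^sup>+g. ennreal \<bar>w g\<bar> \<partial>mu_l) < \<infinity>"
  using w by (simp add: integrable_iff_bounded)

lemma nn_orbit: "ennreal \<bar>w g\<bar> * (\<integral>\<^sup>+p. ennreal ((cmod (f (aff g p)))\<^sup>2) \<partial>mu_l)
    = ennreal \<bar>w g\<bar> * ennreal ((nrm f)\<^sup>2)"
proof (cases "fst g \<le> 0")
  case False
  then have "(\<integral>\<^sup>+p. ennreal ((cmod (f (aff g p)))\<^sup>2) \<partial>mu_l) = (\<integral>\<^sup>+p. ennreal ((cmod (f p))\<^sup>2) \<partial>mu_l)"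
    by (intro nn_integral_aff[of g "\<lambda>p. ennreal ((cmod (f p))\<^sup>2)"]) auto
  then show ?thesis using nn_nrm[OF f] by simp
qed (simp add: w_pos)

lemma garding_vec_measurable: "garding_vec w f \<in> borel_measurable borel"
proof -
  have "(\<lambda>p. \<integral>g. complex_of_real (w g) * f (aff g p) \<partial>mu_l) \<in> borel_measurable borel"
  proof (rule mu_l.borel_measurable_lebesgue_integral)
    have "(\<lambda>x. aff (snd x) (fst x)) \<in> borel_measurable (borel \<Otimes>\<^sub>M borel)"
      unfolding aff_def borel_prod[symmetric] by measurable
    then have [measurable]: "(\<lambda>x. aff (snd x) (fst x)) \<in> borel_measurable (borel \<Otimes>\<^sub>M mu_l)"
      by (simp cong: measurable_cong_sets)
    show "(\<lambda>(p, g). complex_of_real (w g) * f (aff g p)) \<in> borel_measurable (borel \<Otimes>\<^sub>M mu_l)"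
      unfolding split_beta by measurable
  qed
  then show ?thesis by (simp add: garding_vec_def UL_aff)
qed

text \<open>Cauchy--Schwarz with respect to the measure \<open>|w| d\<mu>\<close>.\<close>
lemma garding_vec_pointwise:
  "ennreal ((cmod (garding_vec w f p))\<^sup>2) \<le>
    (\<integral>\<^sup>+g. ennreal \<bar>w g\<bar> \<partial>mu_l) * (\<integral>\<^sup>+g. ennreal \<bar>w g\<bar> * ennreal ((cmod (f (aff g p)))\<^sup>2) \<partial>mu_l)"
proof -
  have [measurable]: "(\<lambda>g. aff g p) \<in> borel_measurable borel"
    unfolding aff_def borel_prod[symmetric] by measurable
  let ?A = "\<lambda>g. ennreal (sqrt \<bar>w g\<bar>)" and ?B = "\<lambda>g. ennreal (sqrt \<bar>w g\<bar> * cmod (f (aff g p)))"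
  have "ennreal (cmod (garding_vec w f p)) \<le> (\<integral>\<^sup>+g. ennreal (cmod (complex_of_real (w g) * f (aff g p))) \<partial>mu_l)"
  proof (cases "integrable mu_l (\<lambda>g. complex_of_real (w g) * f (aff g p))")
    case True
    then show ?thesis unfolding garding_vec_def UL_aff by (rule integral_norm_bound_ennreal)
  next
    case False
    then show ?thesis by (simp add: garding_vec_def UL_aff not_integrable_integral_eq)
  qed
  also have "\<dots> = (\<integral>\<^sup>+g. ?A g * ?B g \<partial>mu_l)"
    by (rule nn_integral_cong) (simp add: norm_mult ennreal_mult'[symmetric] flip: mult.assoc)
  finally have "(ennreal (cmod (garding_vec w f p)))\<^sup>2 \<le> (\<integral>\<^sup>+g. ?A g * ?B g \<partial>mu_l)\<^sup>2"
    by (rule power_mono) simp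
  also have "\<dots> \<le> (\<integral>\<^sup>+g. (?A g)\<^sup>2 \<partial>mu_l) * (\<integral>\<^sup>+g. (?B g)\<^sup>2 \<partial>mu_l)"
    by (rule Cauchy_Schwarz_nn_integral) measurable
  also have "(\<lambda>g. (?A g)\<^sup>2) = (\<lambda>g. ennreal \<bar>w g\<bar>)"
    by (simp add: ennreal_power)
  also have "(\<lambda>g. (?B g)\<^sup>2) = (\<lambda>g. ennreal \<bar>w g\<bar> * ennreal ((cmod (f (aff g p)))\<^sup>2))"
    by (simp add: ennreal_power power_mult_distrib ennreal_mult')
  finally show ?thesis by (simp add: ennreal_power)
qed

text \<open>The pointwise bound, Tonelli's theorem and left invariance bound the squared norm by
  that of \<open>f\<close> times the squared integral of the modulus of \<open>w\<close>.\<close>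

lemma garding_vec_L2: "garding_vec w f \<in> L2"
proof -
  let ?W = "\<integral>\<^sup>+g. ennreal \<bar>w g\<bar> \<partial>mu_l"
  let ?F = "\<lambda>g p. ennreal \<bar>w g\<bar> * ennreal ((cmod (f (aff g p)))\<^sup>2)"
  have F [measurable]: "case_prod ?F \<in> borel_measurable (mu_l \<Otimes>\<^sub>M mu_l)"
    unfolding split_beta by measurable
  have "(\<integral>\<^sup>+p. ennreal ((cmod (garding_vec w f p))\<^sup>2) \<partial>mu_l) \<le> (\<integral>\<^sup>+p. ?W * (\<integral>\<^sup>+g. ?F g p \<partial>mu_l) \<partial>mu_l)"
    by (intro nn_integral_mono garding_vec_pointwise)
  also have "\<dots> = ?W * (\<integral>\<^sup>+p. (\<integral>\<^sup>+g. ?F g p \<partial>mu_l) \<partial>mu_l)"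
    by (rule nn_integral_cmult) measurable
  also have "(\<integral>\<^sup>+p. (\<integral>\<^sup>+g. ?F g p \<partial>mu_l) \<partial>mu_l) = (\<integral>\<^sup>+g. (\<integral>\<^sup>+p. ?F g p \<partial>mu_l) \<partial>mu_l)"
    by (rule mu_l_pair.Fubini') (rule F)
  also have "\<dots> = (\<integral>\<^sup>+g. ennreal \<bar>w g\<bar> * ennreal ((nrm f)\<^sup>2) \<partial>mu_l)"
  proof (rule nn_integral_cong)
    fix g
    have "(\<integral>\<^sup>+p. ?F g p \<partial>mu_l) = ennreal \<bar>w g\<bar> * (\<integral>\<^sup>+p. ennreal ((cmod (f (aff g p)))\<^sup>2) \<partial>mu_l)"
      by (rule nn_integral_cmult) measurable
    then show "(\<integral>\<^sup>+p. ?F g p \<partial>mu_l) = ennreal \<bar>w g\<bar> * ennreal ((nrm f)\<^sup>2)" using nn_orbit by simp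
  qed
  also have "\<dots> = ?W * ennreal ((nrm f)\<^sup>2)" by (rule nn_integral_multc) measurable
  also have "?W * (?W * ennreal ((nrm f)\<^sup>2)) < \<infinity>" using nn_w by (simp add: ennreal_mult_less_top)
  finally show ?thesis using garding_vec_measurable by (simp add: L2_nn)
qed

text \<open>By Fubini's theorem the pointwise integral is the weak vector integral of the orbit; the
  double integral is dominated by \<open>\<bar>w\<bar>\<close> times the sum of the squares of
  \<open>f\<close> and \<open>h\<close>.\<close>

lemma garding_vec_inner:
  assumes h: "h \<in> L2"
  shows "integrable mu_l (\<lambda>g. w g * Re (inner_L2 (UL g f) h))"
    and "Re (inner_L2 (garding_vec w f) h) = (\<integral>g. w g * Re (inner_L2 (UL g f) h) \<partial>mu_l)"
proof -
  have [measurable]: "h \<in> borel_measurable borel" using h by (rule L2_measurable)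
  let ?H = "\<lambda>g p. complex_of_real (w g) * f (aff g p) * cnj (h p)"
  have H [measurable]: "case_prod ?H \<in> borel_measurable (mu_l \<Otimes>\<^sub>M mu_l)"
    unfolding split_beta by measurable
  have int: "integrable (mu_l \<Otimes>\<^sub>M mu_l) (case_prod ?H)"
    unfolding integrable_iff_bounded
  proof
    have "(\<integral>\<^sup>+x. ennreal (cmod (case_prod ?H x)) \<partial>(mu_l \<Otimes>\<^sub>M mu_l))
        = (\<integral>\<^sup>+g. (\<integral>\<^sup>+p. ennreal (cmod (?H g p)) \<partial>mu_l) \<partial>mu_l)"
      by (subst mu_l.nn_integral_fst[symmetric]) auto
    also have "\<dots> \<le> (\<integral>\<^sup>+g. ennreal \<bar>w g\<bar> * (ennreal ((nrm f)\<^sup>2) + ennreal ((nrm h)\<^sup>2)) \<partial>mu_l)"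
    proof (rule nn_integral_mono)
      fix g
      have ab: "a * b \<le> a\<^sup>2 + b\<^sup>2" for a b :: real
        using sum_squares_bound[of a b] zero_le_power2[of a] zero_le_power2[of b] by linarith
      have "(\<integral>\<^sup>+p. ennreal (cmod (?H g p)) \<partial>mu_l)
          \<le> (\<integral>\<^sup>+p. ennreal \<bar>w g\<bar> * (ennreal ((cmod (f (aff g p)))\<^sup>2) + ennreal ((cmod (h p))\<^sup>2)) \<partial>mu_l)"
        by (intro nn_integral_mono)
          (auto simp: norm_mult mult.assoc ennreal_mult'[symmetric] ab simp flip: ennreal_plus intro!: ennreal_leI mult_left_mono)
      also have "\<dots> = ennreal \<bar>w g\<bar> * (\<integral>\<^sup>+p. ennreal ((cmod (f (aff g p)))\<^sup>2) \<partial>mu_l)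
          + ennreal \<bar>w g\<bar> * (\<integral>\<^sup>+p. ennreal ((cmod (h p))\<^sup>2) \<partial>mu_l)"
        by (subst nn_integral_cmult, measurable, subst nn_integral_add, measurable) (simp add: distrib_left)
      also have "\<dots> = ennreal \<bar>w g\<bar> * (ennreal ((nrm f)\<^sup>2) + ennreal ((nrm h)\<^sup>2))"
        by (simp add: nn_orbit nn_nrm[OF h] distrib_left)
      finally show "(\<integral>\<^sup>+p. ennreal (cmod (?H g p)) \<partial>mu_l)
        \<le> ennreal \<bar>w g\<bar> * (ennreal ((nrm f)\<^sup>2) + ennreal ((nrm h)\<^sup>2))" .
    qed
    also have "\<dots> = (\<integral>\<^sup>+g. ennreal \<bar>w g\<bar> \<partial>mu_l) * (ennreal ((nrm f)\<^sup>2) + ennreal ((nrm h)\<^sup>2))"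
      by (rule nn_integral_multc) measurable
    also have "\<dots> < \<infinity>" using nn_w by (simp add: ennreal_mult_less_top)
    finally show "(\<integral>\<^sup>+x. ennreal (cmod (case_prod ?H x)) \<partial>(mu_l \<Otimes>\<^sub>M mu_l)) < \<infinity>" .
  qed (rule H)
  have inner_p: "(\<integral>p. ?H g p \<partial>mu_l) = complex_of_real (w g) * inner_L2 (UL g f) h" for g
    unfolding inner_L2_def UL_aff by (simp add: mult.assoc)
  have inner_g: "(\<integral>g. ?H g p \<partial>mu_l) = garding_vec w f p * cnj (h p)" for p
    unfolding garding_vec_def UL_aff by simp
  have i: "integrable mu_l (\<lambda>g. complex_of_real (w g) * inner_L2 (UL g f) h)"
    using mu_l_pair.integrable_fst[OF int] unfolding inner_p .
  have "integrable mu_l (\<lambda>g. Re (complex_of_real (w g) * inner_L2 (UL g f) h))" using i by (rule integrable_Re)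
  then show "integrable mu_l (\<lambda>g. w g * Re (inner_L2 (UL g f) h))" by simp
  have "inner_L2 (garding_vec w f) h = (\<integral>g. complex_of_real (w g) * inner_L2 (UL g f) h \<partial>mu_l)"
    using mu_l_pair.Fubini_integral[OF int] unfolding inner_p inner_g by (simp add: inner_L2_def)
  then have "Re (inner_L2 (garding_vec w f) h) = (\<integral>g. Re (complex_of_real (w g) * inner_L2 (UL g f) h) \<partial>mu_l)"
    using Bochner_Integration.integral_Re[OF i] by simp
  then show "Re (inner_L2 (garding_vec w f) h) = (\<integral>g. w g * Re (inner_L2 (UL g f) h) \<partial>mu_l)" by simp
qed

end

text \<open>The factorization of \<open>(a, b)\<close> into a dilation and a translation, so that
  the commutation rules of the two groups apply. For \<open>fst g \<le> 0\<close> the value is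
  meaningless, and weights vanish there.\<close>

definition ug :: "pt \<Rightarrow> l2 \<Rightarrow> l2" where
  "ug g v = u1 (ln (fst g)) (u2 (snd g) v)"

definition gvec :: "(pt \<Rightarrow> real) \<Rightarrow> l2 \<Rightarrow> l2" where
  "gvec w v = abs_l2 (garding_vec w (rep_l2 v))"

definition weight :: "(pt \<Rightarrow> real) \<Rightarrow> bool" where
  "weight w \<longleftrightarrow> integrable mu_l w \<and> (\<forall>g. fst g \<le> 0 \<longrightarrow> w g = 0)"

lemma ug_abs: "f \<in> L2 \<Longrightarrow> 0 < fst g \<Longrightarrow> ug g (abs_l2 f) = abs_l2 (UL g f)"
  by (simp add: ug_def u1_abs u2_abs L2_UL2) (simp add: UL1_aff[abs_def] UL2_aff[abs_def] UL_aff[abs_def] aff_def)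

lemma ug_linear: "ug g (x - y) = ug g x - ug g y" "ug g (c *\<^sub>R x) = c *\<^sub>R ug g x"
  by (simp_all add: ug_def reg.G1.U_diff reg.G2.U_diff reg.G1.U_scale reg.G2.U_scale)

lemma weightD:
  assumes "weight w"
  shows "garding_weight w (rep_l2 v)"
  using assms by (simp add: weight_def garding_weight_def)

lemma
  assumes w: "weight w"
  shows weight_integrable: "integrable mu_l (\<lambda>g. w g * inner (ug g v) y)"
    and gvec_inner: "inner (gvec w v) y = (\<integral>g. w g * inner (ug g v) y \<partial>mu_l)"
proof -
  interpret garding_weight w "rep_l2 v" by (rule weightD[OF w])
  obtain h where h: "h \<in> L2" "y = abs_l2 h" by (rule l2_cases)
  have eq: "w g * inner (ug g v) y = w g * Re (inner_L2 (UL g (rep_l2 v)) h)" for g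
  proof (cases "fst g \<le> 0")
    case False
    then have "ug g v = abs_l2 (UL g (rep_l2 v))" using ug_abs[OF rep_l2_L2, of g v] by simp
    then show ?thesis using False h by (simp add: inner_abs_l2 L2_UL)
  qed (simp add: w_pos)
  show "integrable mu_l (\<lambda>g. w g * inner (ug g v) y)"
    unfolding eq by (rule garding_vec_inner(1)[OF h(1)])
  have "inner (gvec w v) y = (\<integral>g. w g * Re (inner_L2 (UL g (rep_l2 v)) h) \<partial>mu_l)"
    unfolding gvec_def h(2) by (simp add: inner_abs_l2 garding_vec_L2 h(1) garding_vec_inner(2))
  then show "inner (gvec w v) y = (\<integral>g. w g * inner (ug g v) y \<partial>mu_l)" by (simp only: eq)
qed

text \<open>\<open>D2\<close> passes the dilation by \<open>fst g\<close> with the factor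
  \<open>fst g\<close>, which is absorbed into the weight; skew-adjointness allows testing under the
  integral.\<close>

lemma gvec_D2:
  assumes v: "(v, v2) \<in> reg.D2" and w: "weight w" "weight (\<lambda>g. w g * fst g)"
  shows "(gvec w v, gvec (\<lambda>g. w g * fst g) v2) \<in> reg.D2"
proof (rule reg.G2.gen_skew_adjoint)
  fix y y' assume y: "(y, y') \<in> reg.D2"
  have eq: "w g * inner (ug g v) y' = - (w g * fst g * inner (ug g v2) y)" for g
  proof (cases "fst g \<le> 0")
    case False
    then have "(ug g v, fst g *\<^sub>R ug g v2) \<in> reg.D2"
      unfolding ug_def using reg.D2_U1[OF reg.G2.gen_U[OF v], of "ln (fst g)" "snd g"] by simp
    from reg.G2.gen_skew[OF this y] have "fst g * inner (ug g v2) y = - inner (ug g v) y'" by simp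
    then show ?thesis by (simp add: mult.assoc)
  next
    case True
    then have "w g = 0" using w(1) unfolding weight_def by blast
    then show ?thesis by simp
  qed
  have "inner (gvec w v) y' = - inner (gvec (\<lambda>g. w g * fst g) v2) y"
    unfolding gvec_inner[OF w(1)] gvec_inner[OF w(2)] eq by simp
  then show "inner y' (gvec w v) = - inner y (gvec (\<lambda>g. w g * fst g) v2)"
    by (simp add: inner_commute)
qed

text \<open>By \<open>D1_U2\<close>, \<open>D1\<close> passes the translation by
  \<open>snd g\<close> at the cost of \<open>- snd g\<close> times \<open>D2\<close>, which becomes
  a second weighted vector.\<close>

lemma gvec_D1:
  assumes v: "(v, v1) \<in> reg.D1" "(v, v2) \<in> reg.D2" and w: "weight w" "weight (\<lambda>g. w g * snd g)"
  shows "(gvec w v, gvec w v1 - gvec (\<lambda>g. w g * snd g) v2) \<in> reg.D1"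
proof (rule reg.G1.gen_skew_adjoint)
  fix y y' assume y: "(y, y') \<in> reg.D1"
  have eq: "w g * inner (ug g v) y' = - (w g * inner (ug g v1) y - w g * snd g * inner (ug g v2) y)" for g
  proof -
    have "(ug g v, ug g (v1 - snd g *\<^sub>R v2)) \<in> reg.D1"
      unfolding ug_def by (rule reg.G1.gen_U[OF reg.D1_U2[OF v]])
    from reg.G1.gen_skew[OF this y]
    have "inner (ug g v1) y - snd g * inner (ug g v2) y = - inner (ug g v) y'"
      by (simp add: ug_linear inner_diff_left)
    then have "inner (ug g v) y' = - (inner (ug g v1) y - snd g * inner (ug g v2) y)" by linarith
    then show ?thesis by (simp only:) (simp add: algebra_simps)
  qed
  have "inner (gvec w v) y' = - (inner (gvec w v1) y - inner (gvec (\<lambda>g. w g * snd g) v2) y)"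
    unfolding gvec_inner[OF w(1)] gvec_inner[OF w(2)] eq
    by (simp add: weight_integrable[OF w(1)] weight_integrable[OF w(2)])
  then show "inner y' (gvec w v) = - inner y (gvec w v1 - gvec (\<lambda>g. w g * snd g) v2)"
    by (simp add: inner_commute[of _ y] inner_commute[of y'] inner_diff_left inner_diff_right)
qed

text \<open>Continuity in both parameters follows from that in each, because the outer factor is an
  isometry.\<close>

lemma tendsto_ug: "((\<lambda>g. ug g v) \<longlongrightarrow> v) (nhds (1, 0))"
proof -
  have c1: "isCont (\<lambda>t. u1 t v) (ln 1)" and c2: "isCont (\<lambda>t. u2 t v) 0"
    using reg.G1.continuous_on_U[of UNIV v] reg.G2.continuous_on_U[of UNIV v]
    by (simp_all add: continuous_on_eq_continuous_at)
  have f: "((\<lambda>g. fst g) \<longlongrightarrow> (1::real)) (nhds (1, 0::real))" and s: "((\<lambda>g. snd g) \<longlongrightarrow> (0::real)) (nhds (1::real, 0))"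
    using tendsto_fst[of "\<lambda>x. x" "(1::real, 0::real)"] tendsto_snd[of "\<lambda>x. x" "(1::real, 0::real)"]
    by (auto simp: filterlim_ident)
  have "((\<lambda>g. u1 (ln (fst g)) v) \<longlongrightarrow> u1 (ln 1) v) (nhds (1, 0 :: real))"
    by (rule isCont_tendsto_compose[OF c1 tendsto_ln[OF f]]) simp
  moreover have "((\<lambda>g. u2 (snd g) v) \<longlongrightarrow> u2 0 v) (nhds (1 :: real, 0))"
    by (rule isCont_tendsto_compose[OF c2 s])
  ultimately have "((\<lambda>g. norm (u2 (snd g) v - v) + norm (u1 (ln (fst g)) v - v))
      \<longlongrightarrow> norm (v - v) + norm (v - v)) (nhds (1, 0))"
    by (intro tendsto_intros) (simp_all add: reg.G1.U_0 reg.G2.U_0)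
  then have lim: "((\<lambda>g. norm (u2 (snd g) v - v) + norm (u1 (ln (fst g)) v - v)) \<longlongrightarrow> 0) (nhds (1, 0))" by simp
  have le: "norm (ug g v - v) \<le> norm (u2 (snd g) v - v) + norm (u1 (ln (fst g)) v - v)" for g
  proof -
    have "ug g v - v = u1 (ln (fst g)) (u2 (snd g) v - v) + (u1 (ln (fst g)) v - v)"
      by (simp add: ug_def reg.G1.U_diff)
    then show ?thesis by (metis norm_triangle_ineq reg.G1.norm_U)
  qed
  have "((\<lambda>g. ug g v - v) \<longlongrightarrow> 0) (nhds (1, 0))"
    by (rule Lim_null_comparison[OF _ lim]) (use le in simp)
  then show ?thesis by (simp add: LIM_zero_iff)
qed

text \<open>An approximate identity at \<open>(1, 0)\<close>. Pairing the error \<open>z\<close>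
  with itself reduces the vector integral to a scalar one, in which the integrand is small on the
  whole support.\<close>

lemma gvec_approx:
  assumes \<phi>: "\<And>n g. 0 \<le> \<phi> n g" "\<And>n. integrable mu_l (\<phi> n)" "\<And>n. 0 < (\<integral>g. \<phi> n g \<partial>mu_l)"
    and supp: "\<And>n g. \<phi> n g \<noteq> 0 \<Longrightarrow> dist g (1, 0) \<le> r n" and r: "r \<longlonglongrightarrow> 0"
    and w: "(w \<longlongrightarrow> W) (nhds (1, 0))" "\<And>n. weight (\<lambda>g. \<phi> n g * w g)"
  shows "(\<lambda>n. gvec (\<lambda>g. \<phi> n g * w g) v /\<^sub>R (\<integral>g. \<phi> n g \<partial>mu_l)) \<longlonglongrightarrow> W *\<^sub>R v"
proof (rule LIMSEQ_I)
  fix e :: real assume e: "0 < e"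
  have "((\<lambda>g. w g *\<^sub>R ug g v) \<longlongrightarrow> W *\<^sub>R v) (nhds (1, 0))" by (intro tendsto_scaleR w tendsto_ug)
  then have "\<forall>\<^sub>F g in nhds (1, 0). dist (w g *\<^sub>R ug g v) (W *\<^sub>R v) < e / 2"
    by (rule tendstoD) (use e in simp)
  then obtain d where d: "0 < d" "\<And>g. dist g (1, 0) < d \<Longrightarrow> norm (w g *\<^sub>R ug g v - W *\<^sub>R v) < e / 2"
    unfolding eventually_nhds_metric dist_norm[of "_ *\<^sub>R ug _ v"] by blast
  obtain N where N: "\<And>n. n \<ge> N \<Longrightarrow> norm (r n - 0) < d" using LIMSEQ_D[OF r d(1)] by blast
  have "norm (gvec (\<lambda>g. \<phi> n g * w g) v /\<^sub>R (\<integral>g. \<phi> n g \<partial>mu_l) - W *\<^sub>R v) < e" if n: "n \<ge> N" for n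
  proof -
    define c where "c = (\<integral>g. \<phi> n g \<partial>mu_l)"
    have c: "0 < c" using \<phi>(3) by (simp add: c_def)
    define z where "z = gvec (\<lambda>g. \<phi> n g * w g) v /\<^sub>R c - W *\<^sub>R v"
    have i: "integrable mu_l (\<lambda>g. \<phi> n g * w g * inner (ug g v) z)" by (rule weight_integrable[OF w(2)])
    have i2: "integrable mu_l (\<lambda>g. \<phi> n g * inner (W *\<^sub>R v) z)" using \<phi>(2) by simp
    have "inner z z = inner (gvec (\<lambda>g. \<phi> n g * w g) v) z / c - inner (W *\<^sub>R v) z"
      by (subst z_def) (simp add: inner_diff_left divide_inverse mult.commute)
    also have "\<dots> = ((\<integral>g. \<phi> n g * w g * inner (ug g v) z \<partial>mu_l) - (\<integral>g. \<phi> n g * inner (W *\<^sub>R v) z \<partial>mu_l)) / c"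
      using c by (simp add: gvec_inner[OF w(2)] c_def diff_divide_distrib)
    also have "\<dots> = (\<integral>g. \<phi> n g * w g * inner (ug g v) z - \<phi> n g * inner (W *\<^sub>R v) z \<partial>mu_l) / c"
      using i i2 by simp
    also have "\<dots> \<le> (\<integral>g. \<phi> n g * (e / 2 * norm z) \<partial>mu_l) / c"
    proof (intro divide_right_mono integral_mono Bochner_Integration.integrable_diff i i2)
      show "integrable mu_l (\<lambda>g. \<phi> n g * (e / 2 * norm z))" using \<phi>(2) by simp
      fix g
      show "\<phi> n g * w g * inner (ug g v) z - \<phi> n g * inner (W *\<^sub>R v) z \<le> \<phi> n g * (e / 2 * norm z)"
      proof (cases "\<phi> n g = 0")
        case False
        then have "dist g (1, 0) < d" using supp[of n g] N[OF n] by simp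
        then have "norm (w g *\<^sub>R ug g v - W *\<^sub>R v) \<le> e / 2" using d(2) less_imp_le by blast
        then have "inner (w g *\<^sub>R ug g v - W *\<^sub>R v) z \<le> e / 2 * norm z"
          using norm_cauchy_schwarz[of "w g *\<^sub>R ug g v - W *\<^sub>R v" z] mult_right_mono[OF _ norm_ge_zero[of z]]
          by (meson order_trans)
        then have "\<phi> n g * inner (w g *\<^sub>R ug g v - W *\<^sub>R v) z \<le> \<phi> n g * (e / 2 * norm z)"
          using \<phi>(1) by (rule mult_left_mono)
        then show ?thesis by (simp add: inner_diff_left right_diff_distrib mult.assoc)
      qed simp
    qed (use c in simp)
    also have "\<dots> = e / 2 * norm z" using c by (simp add: c_def)
    finally have "norm z * norm z \<le> e / 2 * norm z" by (simp add: power2_norm_eq_inner flip: power2_eq_square)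
    then have "norm z \<le> e / 2" using e by (cases "z = 0") auto
    then show ?thesis using e by (simp add: z_def c_def)
  qed
  then show "\<exists>N. \<forall>n\<ge>N. norm (gvec (\<lambda>g. \<phi> n g * w g) v /\<^sub>R (\<integral>g. \<phi> n g \<partial>mu_l) - W *\<^sub>R v) < e" by blast
qed

section \<open>Bump functions\<close>

text \<open>Powers of \<open>1 / t\<close> are included because differentiation leads from
  \<open>k\<close> to \<open>k + 1\<close> and \<open>k + 2\<close>.\<close>

definition flat :: "nat \<Rightarrow> real \<Rightarrow> real" where
  "flat k t = (if 0 < t then (1 / t) ^ k * exp (- (1 / t)) else 0)"

lemma flat_tendsto_0: "(flat k \<longlongrightarrow> 0) (at 0)"
proof -
  have "((\<lambda>t. inverse t ^ k / exp (inverse t)) \<longlongrightarrow> (0::real)) (at_right 0)"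
    using filterlim_compose[OF tendsto_power_div_exp_0[of k] filterlim_inverse_at_top_right] .
  then have "(flat k \<longlongrightarrow> 0) (at_right 0)"
  proof (rule Lim_transform_eventually)
    show "\<forall>\<^sub>F t in at_right 0. inverse t ^ k / exp (inverse t) = flat k t"
      by (rule eventually_at_right_less[THEN eventually_mono])
        (simp add: flat_def exp_minus divide_inverse)
  qed
  moreover have "(flat k \<longlongrightarrow> 0) (at_left 0)"
  proof (rule tendsto_eventually)
    show "\<forall>\<^sub>F t in at_left 0. flat k t = 0"
      unfolding eventually_at_filter by (rule always_eventually) (simp add: flat_def)
  qed
  ultimately show ?thesis by (simp add: filterlim_at_split)
qed

lemma DERIV_flat: "(flat k has_real_derivative flat (k + 2) t - real k * flat (k + 1) t) (at t)"
proof -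
  consider "0 < t" | "t < 0" | "t = 0" by linarith
  then show ?thesis
  proof cases
    case 1
    have "((\<lambda>t. (1 / t) ^ k * exp (- (1 / t))) has_real_derivative
        (1 / t) ^ k * (exp (- (1 / t)) * (1 / t ^ 2)) + real k * (1 / t) ^ (k - 1) * (- 1 / t ^ 2) * exp (- (1 / t))) (at t)"
      using 1 by (auto intro!: derivative_eq_intros simp: power2_eq_square)
    also have "(1 / t) ^ k * (exp (- (1 / t)) * (1 / t ^ 2)) + real k * (1 / t) ^ (k - 1) * (- 1 / t ^ 2) * exp (- (1 / t))
        = flat (k + 2) t - real k * flat (k + 1) t"
    proof (cases k)
      case (Suc m)
      show ?thesis using 1 by (simp add: flat_def Suc power2_eq_square)
    qed (use 1 in \<open>simp add: flat_def power2_eq_square\<close>)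
    finally show ?thesis
      by (rule has_field_derivative_transform_within_open[of _ _ _ "{0<..}"]) (use 1 in \<open>auto simp: flat_def\<close>)
  next
    case 2
    have "((\<lambda>t. 0) has_real_derivative 0) (at t)" by simp
    then have "(flat k has_real_derivative 0) (at t)"
      by (rule has_field_derivative_transform_within_open[of _ _ _ "{..<0}"]) (use 2 in \<open>auto simp: flat_def\<close>)
    then show ?thesis using 2 by (simp add: flat_def)
  next
    case 3
    \<comment> \<open>For \<open>h \<noteq> 0\<close> the difference quotient at 0 is
      \<open>flat (Suc k) h\<close>.\<close>
    have "((\<lambda>h. (flat k (0 + h) - flat k 0) / h) \<longlongrightarrow> 0) (at 0)"
      by (rule Lim_transform_eventually[OF flat_tendsto_0[of "Suc k"]])
        (auto simp: eventually_at flat_def intro!: exI[of _ 1])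
    then have "(flat k has_real_derivative 0) (at 0)" by (simp add: DERIV_def)
    then show ?thesis using 3 by (simp add: flat_def)
  qed
qed

text \<open>A class of functions that is visibly closed under partial derivatives.\<close>
inductive_set flat_algebra :: "(pt \<Rightarrow> real) set" where
  const: "(\<lambda>p. c) \<in> flat_algebra"
| flat: "(\<lambda>p. flat k (a * fst p + b * snd p + c)) \<in> flat_algebra"
| add: "\<phi> \<in> flat_algebra \<Longrightarrow> \<psi> \<in> flat_algebra \<Longrightarrow> (\<lambda>p. \<phi> p + \<psi> p) \<in> flat_algebra"
| mult: "\<phi> \<in> flat_algebra \<Longrightarrow> \<psi> \<in> flat_algebra \<Longrightarrow> (\<lambda>p. \<phi> p * \<psi> p) \<in> flat_algebra"

lemma flat_algebra_derivative:
  assumes "\<phi> \<in> flat_algebra"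
  shows "\<exists>\<phi>1\<in>flat_algebra. \<exists>\<phi>2\<in>flat_algebra. \<forall>p. (\<phi> has_derivative (\<lambda>h. fst h * \<phi>1 p + snd h * \<phi>2 p)) (at p)"
  using assms
proof induction
  case (const c)
  show ?case by (intro bexI[OF _ flat_algebra.const[of 0]]) simp
next
  case (flat k a b c)
  define \<psi> where "\<psi> p = flat (k + 2) (a * fst p + b * snd p + c) + - real k * flat (k + 1) (a * fst p + b * snd p + c)" for p
  have \<psi>: "\<psi> \<in> flat_algebra" unfolding \<psi>_def
    by (intro flat_algebra.add flat_algebra.mult flat_algebra.const flat_algebra.flat)
  have "((\<lambda>p. flat k (a * fst p + b * snd p + c)) has_derivative (\<lambda>h. fst h * (a * \<psi> p) + snd h * (b * \<psi> p))) (at p)" for p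
  proof -
    have "(flat k has_derivative (\<lambda>y. \<psi> p * y)) (at (a * fst p + b * snd p + c))"
      using DERIV_flat[of k "a * fst p + b * snd p + c"] unfolding has_field_derivative_def \<psi>_def by simp
    moreover have "((\<lambda>p. a * fst p + b * snd p + c) has_derivative (\<lambda>h. a * fst h + b * snd h)) (at p)"
      by (auto intro!: derivative_eq_intros)
    ultimately have "((\<lambda>p. flat k (a * fst p + b * snd p + c)) has_derivative (\<lambda>h. \<psi> p * (a * fst h + b * snd h))) (at p)"
      using has_derivative_compose by blast
    then show ?thesis by (simp add: algebra_simps)
  qed
  then show ?case
    by (intro bexI[of _ "\<lambda>p. a * \<psi> p"] bexI[of _ "\<lambda>p. b * \<psi> p"])
      (auto intro: flat_algebra.mult flat_algebra.const \<psi>)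
next
  case (add \<phi> \<psi>)
  then obtain \<phi>1 \<phi>2 \<psi>1 \<psi>2 where "\<phi>1 \<in> flat_algebra" "\<phi>2 \<in> flat_algebra" "\<psi>1 \<in> flat_algebra" "\<psi>2 \<in> flat_algebra"
    and d: "\<And>p. (\<phi> has_derivative (\<lambda>h. fst h * \<phi>1 p + snd h * \<phi>2 p)) (at p)"
      "\<And>p. (\<psi> has_derivative (\<lambda>h. fst h * \<psi>1 p + snd h * \<psi>2 p)) (at p)" by blast
  moreover have "((\<lambda>p. \<phi> p + \<psi> p) has_derivative (\<lambda>h. fst h * (\<phi>1 p + \<psi>1 p) + snd h * (\<phi>2 p + \<psi>2 p))) (at p)" for p
    by (rule has_derivative_eq_rhs[OF has_derivative_add[OF d]]) (simp add: algebra_simps)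
  ultimately show ?case
    by (intro bexI[of _ "\<lambda>p. \<phi>1 p + \<psi>1 p"] bexI[of _ "\<lambda>p. \<phi>2 p + \<psi>2 p"]) (auto intro: flat_algebra.add)
next
  case (mult \<phi> \<psi>)
  then obtain \<phi>1 \<phi>2 \<psi>1 \<psi>2 where *: "\<phi>1 \<in> flat_algebra" "\<phi>2 \<in> flat_algebra" "\<psi>1 \<in> flat_algebra" "\<psi>2 \<in> flat_algebra"
    and d: "\<And>p. (\<phi> has_derivative (\<lambda>h. fst h * \<phi>1 p + snd h * \<phi>2 p)) (at p)"
      "\<And>p. (\<psi> has_derivative (\<lambda>h. fst h * \<psi>1 p + snd h * \<psi>2 p)) (at p)" by blast
  moreover have "((\<lambda>p. \<phi> p * \<psi> p) has_derivative
      (\<lambda>h. fst h * (\<phi> p * \<psi>1 p + \<phi>1 p * \<psi> p) + snd h * (\<phi> p * \<psi>2 p + \<phi>2 p * \<psi> p))) (at p)" for p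
    by (rule has_derivative_eq_rhs[OF has_derivative_mult[OF d]]) (simp add: algebra_simps)
  ultimately show ?case
    by (intro bexI[of _ "\<lambda>p. \<phi> p * \<psi>1 p + \<phi>1 p * \<psi> p"] bexI[of _ "\<lambda>p. \<phi> p * \<psi>2 p + \<phi>2 p * \<psi> p"])
      (auto intro!: flat_algebra.add flat_algebra.mult mult(1,2))
qed

lemma flat_algebra_pd:
  assumes "\<phi> \<in> flat_algebra"
  shows "pd1 \<phi> \<in> flat_algebra" "pd2 \<phi> \<in> flat_algebra"
proof -
  obtain \<phi>1 \<phi>2 where m: "\<phi>1 \<in> flat_algebra" "\<phi>2 \<in> flat_algebra"
    and d: "\<And>p. (\<phi> has_derivative (\<lambda>h. fst h * \<phi>1 p + snd h * \<phi>2 p)) (at p)"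
    using flat_algebra_derivative[OF assms] by blast
  have "((\<lambda>s. \<phi> (s, y)) has_derivative (\<lambda>h. fst (h, 0::real) * \<phi>1 (x, y) + snd (h, 0::real) * \<phi>2 (x, y))) (at x)" for x y
    by (rule has_derivative_compose[of "\<lambda>s. (s, y)" "\<lambda>h. (h, 0)", OF _ d]) (auto intro!: derivative_eq_intros)
  then have "((\<lambda>s. \<phi> (s, y)) has_real_derivative \<phi>1 (x, y)) (at x)" for x y
    by (simp add: has_field_derivative_def mult_commute_abs)
  then have "pd1 \<phi> = \<phi>1" by (auto simp: pd1_def fun_eq_iff intro: DERIV_imp_deriv)
  then show "pd1 \<phi> \<in> flat_algebra" using m by simp
  have "((\<lambda>s. \<phi> (x, s)) has_derivative (\<lambda>h. fst (0::real, h) * \<phi>1 (x, y) + snd (0::real, h) * \<phi>2 (x, y))) (at y)" for x y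
    by (rule has_derivative_compose[of "\<lambda>s. (x, s)" "\<lambda>h. (0, h)", OF _ d]) (auto intro!: derivative_eq_intros)
  then have "((\<lambda>s. \<phi> (x, s)) has_real_derivative \<phi>2 (x, y)) (at y)" for x y
    by (simp add: has_field_derivative_def mult_commute_abs)
  then have "pd2 \<phi> = \<phi>2" by (auto simp: pd2_def fun_eq_iff intro: DERIV_imp_deriv)
  then show "pd2 \<phi> \<in> flat_algebra" using m by simp
qed

lemma flat_algebra_differentiable:
  assumes "\<phi> \<in> flat_algebra"
  shows "\<phi> differentiable at p"
proof -
  obtain \<phi>1 \<phi>2 where "\<And>p. (\<phi> has_derivative (\<lambda>h. fst h * \<phi>1 p + snd h * \<phi>2 p)) (at p)"
    using flat_algebra_derivative[OF assms] by blast
  then show ?thesis by (rule differentiableI)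
qed

lemma flat_algebra_smooth:
  assumes "\<phi> \<in> flat_algebra"
  shows "smooth \<phi>"
proof -
  have "iter_pd bs \<phi> \<in> flat_algebra" for bs
    by (induction bs) (simp_all add: assms flat_algebra_pd)
  then have "iter_pd bs \<phi> differentiable_on UNIV" for bs
    by (intro differentiable_at_imp_differentiable_on flat_algebra_differentiable)
  then show ?thesis unfolding smooth_def by (rule allI)
qed

text \<open>The index is shifted so that \<open>rad n \<le> 1 / 2\<close> and the supports stay away
  from \<open>fst p = 0\<close>.\<close>

definition rad :: "nat \<Rightarrow> real" where
  "rad n = inverse (real (Suc (Suc n)))"

lemma rad_pos: "0 < rad n" and rad_le: "rad n \<le> 1 / 2"
  using le_imp_inverse_le[of 2 "real (Suc (Suc n))"] by (simp_all add: rad_def)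

lemma rad_tendsto: "rad \<longlonglongrightarrow> 0"
  using LIMSEQ_Suc[OF LIMSEQ_inverse_real_of_nat] by (simp add: rad_def[abs_def])

text \<open>One flat factor for each side of a square about the identity
  \<open>(1, 0)\<close>.\<close>

definition bump :: "nat \<Rightarrow> pt \<Rightarrow> real" where
  "bump n p = flat 0 (fst p + (rad n - 1)) * flat 0 (- fst p + (rad n + 1)) *
     (flat 0 (snd p + rad n) * flat 0 (- snd p + rad n))"

lemma bump_flat_algebra: "bump n \<in> flat_algebra"
proof -
  have "bump n = (\<lambda>p. flat 0 (1 * fst p + 0 * snd p + (rad n - 1)) * flat 0 (- 1 * fst p + 0 * snd p + (rad n + 1)) *
     (flat 0 (0 * fst p + 1 * snd p + rad n) * flat 0 (0 * fst p + - 1 * snd p + rad n)))"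
    by (simp add: bump_def fun_eq_iff)
  also have "\<dots> \<in> flat_algebra" by (intro flat_algebra.mult flat_algebra.flat)
  finally show ?thesis .
qed

lemma bump_nonneg: "0 \<le> bump n p"
  by (simp add: bump_def flat_def)

lemma bump_pos_iff: "bump n p \<noteq> 0 \<longleftrightarrow> \<bar>fst p - 1\<bar> < rad n \<and> \<bar>snd p\<bar> < rad n"
proof -
  have *: "flat 0 t \<noteq> 0 \<longleftrightarrow> 0 < t" for t by (simp add: flat_def)
  show ?thesis unfolding bump_def mult_eq_0_iff de_Morgan_disj * by (intro iffI conjI; linarith)
qed

lemma bump_support: "bump n p \<noteq> 0 \<Longrightarrow> p \<in> cbox (1/2, - 1) (3/2, 1)"
proof -
  assume "bump n p \<noteq> 0"
  then have "\<bar>fst p - 1\<bar> < 1 / 2" "\<bar>snd p\<bar> < 1 / 2"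
    using rad_le[of n] by (auto simp: bump_pos_iff)
  then show ?thesis unfolding mem_cbox_pt fst_conv snd_conv by linarith
qed

lemma bump_C0inf: "bump n \<in> C0inf_G"
proof -
  have "compact (cbox (1/2, - 1) (3/2, 1) :: pt set)" by (rule compact_cbox)
  moreover have "cbox (1/2, - 1) (3/2, 1) \<subseteq> {p :: pt. 0 < fst p}" by (auto simp: mem_cbox_pt)
  moreover have "\<forall>p. p \<notin> cbox (1/2, - 1) (3/2, 1) \<longrightarrow> bump n p = 0" using bump_support by blast
  ultimately have "\<exists>K. compact K \<and> K \<subseteq> {p. 0 < fst p} \<and> (\<forall>p. p \<notin> K \<longrightarrow> bump n p = 0)"
    by (intro exI[of _ "cbox (1/2, - 1) (3/2, 1)"] conjI)
  then show ?thesis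
    unfolding C0inf_G_def mem_Collect_eq by (intro conjI flat_algebra_smooth bump_flat_algebra)
qed

lemma bump_continuous: "continuous_on UNIV (bump n)"
  by (intro continuous_at_imp_continuous_on ballI differentiable_imp_continuous_within
      flat_algebra_differentiable bump_flat_algebra)

lemma bump_weight:
  assumes w: "continuous_on UNIV w"
  shows "weight (\<lambda>g. bump n g * w g)"
  unfolding weight_def
proof (intro conjI allI impI)
  let ?K = "cbox (1/2, - 1) (3/2, 1) :: pt set"
  have c: "continuous_on UNIV (\<lambda>g. bump n g * w g)" by (intro continuous_intros bump_continuous w)
  then have "bounded ((\<lambda>g. bump n g * w g) ` ?K)"
    using compact_continuous_image[OF continuous_on_subset[OF c] compact_cbox] compact_imp_bounded by blast
  then obtain M where M: "\<And>g. g \<in> ?K \<Longrightarrow> \<bar>bump n g * w g\<bar> \<le> M" by (auto simp: bounded_iff)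
  show "integrable mu_l (\<lambda>g. bump n g * w g)"
  proof (rule Bochner_Integration.integrable_bound)
    have "emeasure mu_l ?K < \<infinity>" by (rule emeasure_mu_l_cbox) simp
    then show "integrable mu_l (\<lambda>g. M * indicator ?K g)" by (simp add: integrable_indicator_iff less_top)
    show "(\<lambda>g. bump n g * w g) \<in> borel_measurable mu_l"
      using borel_measurable_continuous_onI[OF c] by (simp cong: measurable_cong_sets)
    have "norm (bump n g * w g) \<le> norm (M * indicator ?K g)" for g
    proof (cases "g \<in> ?K")
      case True
      then show ?thesis using M[OF True] by simp
    next
      case False
      then have "bump n g = 0" using bump_support by blast
      then show ?thesis by simp
    qed
    then show "AE g in mu_l. norm (bump n g * w g) \<le> norm (M * indicator ?K g)" by simp
  qed
  fix g :: pt assume "fst g \<le> 0"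
  then have "g \<notin> ?K" by (simp add: mem_cbox_pt)
  then show "bump n g * w g = 0" using bump_support[of n g] by auto
qed

lemma bump_integrable: "integrable mu_l (bump n)"
proof -
  have "weight (\<lambda>g. bump n g * 1)" by (rule bump_weight) (rule continuous_on_const)
  then have "integrable mu_l (\<lambda>g. bump n g * 1)" unfolding weight_def by blast
  then show ?thesis by (simp only: mult_1_right)
qed

text \<open>A zero integral would make the bump vanish almost everywhere, although it is nonzero on
  a box of positive Lebesgue measure.\<close>

lemma bump_integral_pos: "0 < (\<integral>g. bump n g \<partial>mu_l)"
proof -
  have "(\<integral>g. bump n g \<partial>mu_l) \<noteq> 0"
  proof
    assume z: "(\<integral>g. bump n g \<partial>mu_l) = 0"
    have "AE g in mu_l. 0 \<le> bump n g" by (rule AE_I2) (rule bump_nonneg)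
    then have "AE g in mu_l. bump n g = 0"
      using integral_nonneg_eq_0_iff_AE[OF bump_integrable[of n]] z by blast
    then have "AE g in lborel. 0 < (case g of (a, b) \<Rightarrow> if 0 < a then ennreal (1 / a\<^sup>2) else 0) \<longrightarrow> bump n g = 0"
      unfolding mu_l_def by (subst (asm) AE_density) simp_all
    then have pos: "AE g in lborel. 0 < fst g \<longrightarrow> bump n g = 0"
      by eventually_elim (simp add: split_beta)
    let ?B = "box (1 - rad n, - rad n) (1 + rad n, rad n) :: pt set"
    have B: "bump n g \<noteq> 0 \<and> 0 < fst g" if "g \<in> ?B" for g
    proof -
      have "\<bar>fst g - 1\<bar> < rad n \<and> \<bar>snd g\<bar> < rad n"
        using that unfolding mem_box_pt fst_conv snd_conv by linarith
      then have "bump n g \<noteq> 0" by (simp only: bump_pos_iff)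
      moreover have "0 < fst g"
        using bump_support[OF calculation] unfolding mem_cbox_pt fst_conv snd_conv by linarith
      ultimately show ?thesis by blast
    qed
    have "AE g in lborel. g \<notin> ?B" using pos by eventually_elim (use B in blast)
    then have "emeasure lborel ?B = 0" by (subst (asm) AE_iff_measurable[of ?B]) auto
    moreover define P where "P = (\<Prod>b\<in>Basis. ((1 + rad n, rad n) - (1 - rad n, - rad n)) \<bullet> b)"
    have "emeasure lborel ?B = ennreal P" unfolding P_def
      by (rule emeasure_lborel_box) (use rad_pos[of n] in \<open>auto simp: Basis_prod_def\<close>)
    moreover have "0 < P" unfolding P_def
      by (rule prod_pos) (use rad_pos[of n] in \<open>auto simp: Basis_prod_def\<close>)
    ultimately show False by (simp add: ennreal_eq_0_iff)
  qed
  moreover have "0 \<le> (\<integral>g. bump n g \<partial>mu_l)"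
    by (rule Bochner_Integration.integral_nonneg) (rule bump_nonneg)
  ultimately show ?thesis by linarith
qed

lemma bump_dist: "bump n g \<noteq> 0 \<Longrightarrow> dist g (1, 0) \<le> 2 * rad n"
proof -
  assume b: "bump n g \<noteq> 0"
  have "dist g (1, 0) = norm (fst g - 1, snd g)" by (cases g) (simp add: dist_norm)
  also have "\<dots> \<le> \<bar>fst g - 1\<bar> + \<bar>snd g\<bar>"
    using norm_Pair_le[of "fst g - 1" "snd g"] by simp
  also have "\<dots> \<le> 2 * rad n" using b unfolding bump_pos_iff by linarith
  finally show ?thesis .
qed

lemma gvec_bump_tendsto:
  assumes w: "continuous_on UNIV w"
  shows "(\<lambda>n. gvec (\<lambda>g. bump n g * w g) v /\<^sub>R (\<integral>g. bump n g \<partial>mu_l)) \<longlonglongrightarrow> w (1, 0) *\<^sub>R v"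
proof (rule gvec_approx[OF bump_nonneg bump_integrable bump_integral_pos bump_dist])
  show "(\<lambda>n. 2 * rad n) \<longlonglongrightarrow> 0" using tendsto_mult_right[OF rad_tendsto, of 2] by simp
  show "(w \<longlongrightarrow> w (1, 0)) (nhds (1, 0))"
    using w by (simp add: continuous_on_eq_continuous_at isCont_def tendsto_at_iff_tendsto_nhds)
  show "weight (\<lambda>g. bump n g * w g)" for n by (rule bump_weight[OF w])
qed

section \<open>Operators on functions and relations on the quotient\<close>

text \<open>Operators on functions are saturated under equality almost everywhere, that is,
  preimages of relations on the quotient. \<open>O\<close> applies its left factor first, hence the
  reversal in \<open>opcomp_lift\<close>.\<close>

definition lift_op :: "(l2 \<times> l2) set \<Rightarrow> oper" where
  "lift_op X = {(f, g). f \<in> L2 \<and> g \<in> L2 \<and> (abs_l2 f, abs_l2 g) \<in> X}"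

lemma lift_op_iff: "(f, g) \<in> lift_op X \<longleftrightarrow> f \<in> L2 \<and> g \<in> L2 \<and> (abs_l2 f, abs_l2 g) \<in> X"
  by (simp add: lift_op_def)

lemma rep_lift_op: "(rep_l2 x, rep_l2 y) \<in> lift_op X \<longleftrightarrow> (x, y) \<in> X"
  by (simp add: lift_op_iff)

lemma lift_op_inject: "lift_op X = lift_op Y \<Longrightarrow> X = Y"
  using rep_lift_op by (metis subrelI subset_antisym)

lemma idop_lift: "idop = lift_op Id"
  unfolding idop_def lift_op_def using abs_l2_eq_iff by auto

lemma opcomp_lift: "opcomp (lift_op A) (lift_op B) = lift_op (B O A)"
proof (intro set_eqI iffI)
  fix p assume "p \<in> lift_op (B O A)"
  then obtain f h y where p: "p = (f, h)" "f \<in> L2" "h \<in> L2" "(abs_l2 f, y) \<in> B" "(y, abs_l2 h) \<in> A"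
    by (auto simp: lift_op_def)
  then have "(f, rep_l2 y) \<in> lift_op B" "(rep_l2 y, h) \<in> lift_op A" by (simp_all add: lift_op_iff)
  then show "p \<in> opcomp (lift_op A) (lift_op B)" unfolding opcomp_def p(1) by blast
qed (auto simp: opcomp_def lift_op_def)

lemma oppow_lift: "oppow k (lift_op A) = lift_op (A ^^ k)"
  by (induction k) (simp_all add: idop_lift opcomp_lift)

lemma opdom_lift: "opdom (lift_op X) = {f \<in> L2. abs_l2 f \<in> Domain X}"
proof (intro set_eqI iffI)
  fix f assume "f \<in> {f \<in> L2. abs_l2 f \<in> Domain X}"
  then obtain y where "f \<in> L2" "(abs_l2 f, y) \<in> X" by blast
  then have "(f, rep_l2 y) \<in> lift_op X" by (simp add: lift_op_iff)
  then show "f \<in> opdom (lift_op X)" unfolding opdom_def by force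
qed (auto simp: opdom_def lift_op_def)

text \<open>The value chosen by \<open>SOME\<close> is determined up to a null set, so its norm does
  not depend on the choice.\<close>

lemma nrm_opapp_lift:
  assumes f: "f \<in> L2" and y: "(abs_l2 f, y) \<in> X" and unique: "\<And>y'. (abs_l2 f, y') \<in> X \<Longrightarrow> y' = y"
  shows "nrm (opapp (lift_op X) f) = norm y"
proof -
  have "(f, rep_l2 y) \<in> lift_op X" using f y by (simp add: lift_op_iff)
  then have "(f, opapp (lift_op X) f) \<in> lift_op X" unfolding opapp_def
    by (rule someI[of "\<lambda>g. (f, g) \<in> lift_op X"])
  then have "opapp (lift_op X) f \<in> L2" "abs_l2 (opapp (lift_op X) f) = y"
    using unique by (auto simp: lift_op_iff)
  then show ?thesis using norm_abs_l2 by metis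
qed

lemma generator_lift:
  assumes u: "\<And>t f. f \<in> L2 \<Longrightarrow> u t (abs_l2 f) = abs_l2 (U t f)" and U: "\<And>t f. f \<in> L2 \<Longrightarrow> U t f \<in> L2"
  shows "generator U = lift_op (gen u)"
proof -
  have "((\<lambda>t. nrm (\<lambda>p. (U t f p - f p) / complex_of_real t - g p)) \<longlongrightarrow> 0) (at 0)
      \<longleftrightarrow> (abs_l2 f, abs_l2 g) \<in> gen u" if fg: "f \<in> L2" "g \<in> L2" for f g
  proof -
    have "nrm (\<lambda>p. (U t f p - f p) / complex_of_real t - g p)
        = norm ((u t (abs_l2 f) - abs_l2 f) /\<^sub>R t - abs_l2 g)" for t
    proof -
      have 1: "(\<lambda>p. U t f p - f p) \<in> L2" by (intro L2_diff U fg)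
      have 2: "(\<lambda>p. complex_of_real (inverse t) * (U t f p - f p)) \<in> L2" by (rule L2_cmult[OF 1])
      have "(u t (abs_l2 f) - abs_l2 f) /\<^sub>R t - abs_l2 g
          = abs_l2 (\<lambda>p. complex_of_real (inverse t) * (U t f p - f p) - g p)"
        unfolding u[OF fg(1)] diff_abs_l2[OF U[OF fg(1)] fg(1)] scaleR_abs_l2[OF 1] diff_abs_l2[OF 2 fg(2)] ..
      then show ?thesis
        using norm_abs_l2[OF L2_diff[OF 2 fg(2)]] by (simp add: divide_inverse mult.commute)
    qed
    then show ?thesis by (simp add: gen_def tendsto_norm_zero_iff LIM_zero_iff)
  qed
  then show ?thesis unfolding generator_def lift_op_def by blast
qed

lemma DL_lift: "DL j = lift_op (reg.DD j)"
  unfolding DL_def reg.DD_def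
  using generator_lift[of u1 UL1, OF u1_abs L2_UL1] generator_lift[of u2 UL2, OF u2_abs L2_UL2] by simp

lemma iterD_lift: "iterD js = lift_op (reg.word js)"
  by (induction js) (simp_all add: idop_lift opcomp_lift DL_lift)

lemma W2_Sob: "W2 m = {f \<in> L2. abs_l2 f \<in> reg.Sob m}"
proof -
  have "f \<in> W2 m \<longleftrightarrow> abs_l2 f \<in> reg.Sob m" if f: "f \<in> L2" for f
  proof -
    have "f \<in> opdom (iterD js) \<longleftrightarrow> abs_l2 f \<in> Domain (reg.word js)" for js
      using f by (simp add: iterD_lift opdom_lift)
    moreover have "abs_l2 f \<in> Domain (reg.word js)" if "\<not> 1 \<le> length js" for js
      using that by (cases js) auto
    ultimately show ?thesis unfolding reg.Sob_iff_word W2_def using f by blast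
  qed
  moreover have "W2 m \<subseteq> L2" by (auto simp: W2_def)
  ultimately show ?thesis by blast
qed

section \<open>The Laplacian on Garding vectors\<close>

lemma neg_sum_abs_l2:
  assumes "f \<in> L2" "g \<in> L2"
  shows "- (abs_l2 f + abs_l2 g) = abs_l2 (\<lambda>p. - (f p + g p))" "(\<lambda>p. - (f p + g p)) \<in> L2"
proof -
  have 1: "(\<lambda>p. f p + g p) \<in> L2" by (rule L2_add[OF assms])
  then show 2: "(\<lambda>p. - (f p + g p)) \<in> L2" using L2_cmult[of _ "- 1"] by force
  have "- (abs_l2 f + abs_l2 g) = (- 1) *\<^sub>R abs_l2 (\<lambda>p. f p + g p)" by (simp add: add_abs_l2 assms)
  also have "\<dots> = abs_l2 (\<lambda>p. complex_of_real (- 1) * (f p + g p))" by (rule scaleR_abs_l2[OF 1])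
  finally show "- (abs_l2 f + abs_l2 g) = abs_l2 (\<lambda>p. - (f p + g p))" by simp
qed

lemma lap0_Lap: "lap0 \<subseteq> lift_op reg.Lap"
proof (rule subrelI)
  fix f h assume "(f, h) \<in> lap0"
  then obtain g1 h1 g2 h2 where D: "(f, g1) \<in> DL 1" "(g1, h1) \<in> DL 1" "(f, g2) \<in> DL 2" "(g2, h2) \<in> DL 2"
    and h: "h \<in> L2" "ae_eq h (\<lambda>p. - (h1 p + h2 p))" by (auto simp: lap0_def)
  have D': "(abs_l2 f, abs_l2 g1) \<in> reg.D1" "(abs_l2 g1, abs_l2 h1) \<in> reg.D1"
    "(abs_l2 f, abs_l2 g2) \<in> reg.D2" "(abs_l2 g2, abs_l2 h2) \<in> reg.D2"
    and L2: "f \<in> L2" "h1 \<in> L2" "h2 \<in> L2"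
    using D by (auto simp: DL_lift lift_op_iff)
  have "abs_l2 h = - (abs_l2 h1 + abs_l2 h2)"
    using h neg_sum_abs_l2[OF L2(2,3)] abs_l2_eq_iff by simp
  then show "(f, h) \<in> lift_op reg.Lap"
    using reg.Lap_strong[OF D'(1,3,2,4)] L2(1) h(1) by (simp add: lift_op_iff)
qed

lemma garding_scaled:
  assumes "\<phi> \<in> C0inf_G" "f \<in> L2"
  shows "(\<lambda>p. c * garding_vec \<phi> f p) \<in> garding"
  unfolding garding_def mem_Collect_eq
  by (intro exI[of _ "1::nat"] exI[of _ "\<lambda>_. c"] exI[of _ "\<lambda>_. \<phi>"] exI[of _ "\<lambda>_. f"]) (simp add: assms)

definition bvec :: "nat \<Rightarrow> (pt \<Rightarrow> real) \<Rightarrow> l2 \<Rightarrow> l2" where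
  "bvec n w v = gvec (\<lambda>g. bump n g * w g) v /\<^sub>R (\<integral>g. bump n g \<partial>mu_l)"

lemma bvec_D1:
  assumes "(v, v1) \<in> reg.D1" "(v, v2) \<in> reg.D2" "continuous_on UNIV w"
  shows "(bvec n w v, bvec n w v1 - bvec n (\<lambda>g. w g * snd g) v2) \<in> reg.D1"
proof -
  have "weight (\<lambda>g. bump n g * w g)" by (rule bump_weight[OF assms(3)])
  moreover have "weight (\<lambda>g. bump n g * (w g * snd g))"
    by (rule bump_weight) (intro continuous_intros assms(3))
  ultimately have "(gvec (\<lambda>g. bump n g * w g) v, gvec (\<lambda>g. bump n g * w g) v1
      - gvec (\<lambda>g. bump n g * (w g * snd g)) v2) \<in> reg.D1"
    using gvec_D1[OF assms(1,2), of "\<lambda>g. bump n g * w g"] by (simp only: mult.assoc)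
  from subspace_scale[OF reg.G1.subspace_gen this, of "inverse (\<integral>g. bump n g \<partial>mu_l)"]
  show ?thesis by (simp add: bvec_def scaleR_diff_right)
qed

lemma bvec_D2:
  assumes "(v, v2) \<in> reg.D2" "continuous_on UNIV w"
  shows "(bvec n w v, bvec n (\<lambda>g. w g * fst g) v2) \<in> reg.D2"
proof -
  have "weight (\<lambda>g. bump n g * w g)" by (rule bump_weight[OF assms(2)])
  moreover have "weight (\<lambda>g. bump n g * (w g * fst g))"
    by (rule bump_weight) (intro continuous_intros assms(2))
  ultimately have "(gvec (\<lambda>g. bump n g * w g) v, gvec (\<lambda>g. bump n g * (w g * fst g)) v2) \<in> reg.D2"
    using gvec_D2[OF assms(1), of "\<lambda>g. bump n g * w g"] by (simp only: mult.assoc)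
  from subspace_scale[OF reg.G2.subspace_gen this, of "inverse (\<integral>g. bump n g \<partial>mu_l)"]
  show ?thesis by (simp add: bvec_def)
qed

lemma bvec_tendsto: "continuous_on UNIV w \<Longrightarrow> (\<lambda>n. bvec n w v) \<longlonglongrightarrow> w (1, 0) *\<^sub>R v"
  unfolding bvec_def by (rule gvec_bump_tendsto)

text \<open>Only Garding vectors of elements of the domain of the Laplacian are used. For these the derivatives
  fall on the function and not on the bump, so the smoothness of general Garding vectors is not needed.\<close>
lemma lap0_approximation:
  assumes "(v, h) \<in> reg.Lap"
  shows "\<exists>fs hs. (\<forall>n. (fs n, hs n) \<in> lap0) \<and> (\<lambda>n. abs_l2 (fs n)) \<longlonglongrightarrow> v \<and> (\<lambda>n. abs_l2 (hs n)) \<longlonglongrightarrow> h"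
proof -
  obtain v1 v2 where v: "(v, v1) \<in> reg.D1" "(v, v2) \<in> reg.D2" using assms by (rule reg.Lap_domain)
  obtain v11 v12 v21 v22 where w: "(v1, v11) \<in> reg.D1" "(v1, v12) \<in> reg.D2" "(v2, v21) \<in> reg.D1" "(v2, v22) \<in> reg.D2"
    and h: "h = - (v11 + v22)" by (rule reg.Lap_second_order[OF assms v]) blast
  \<comment> \<open>The factors 1 keep the weights in the shape that two applications of
    \<open>bvec_D1\<close> or \<open>bvec_D2\<close> produce.\<close>
  define a b where "a n = (bvec n (\<lambda>g. 1) v11 - bvec n (\<lambda>g. 1 * snd g) v12)
      - (bvec n (\<lambda>g. 1 * snd g) v21 - bvec n (\<lambda>g. 1 * snd g * snd g) v22)"
    and "b n = bvec n (\<lambda>g. 1 * fst g * fst g) v22" for n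
  define fs where "fs n = (\<lambda>p. complex_of_real (inverse (\<integral>g. bump n g \<partial>mu_l)) * garding_vec (bump n) (rep_l2 v) p)" for n
  define hs where "hs n = rep_l2 (- (a n + b n))" for n
  have c: "continuous_on UNIV (\<lambda>g::pt. 1::real)" "continuous_on UNIV (\<lambda>g::pt. 1 * snd g)"
    "continuous_on UNIV (\<lambda>g::pt. 1 * snd g * snd g)" "continuous_on UNIV (\<lambda>g::pt. 1 * fst g)"
    "continuous_on UNIV (\<lambda>g::pt. 1 * fst g * fst g)"
    by (intro continuous_intros)+
  have gv: "garding_vec (bump n) (rep_l2 v) \<in> L2" for n
  proof -
    have "weight (\<lambda>g. bump n g * 1)" by (rule bump_weight[OF c(1)])
    then interpret garding_weight "bump n" "rep_l2 v" by (intro weightD) simp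
    show ?thesis by (rule garding_vec_L2)
  qed
  have fsL2: "fs n \<in> L2" for n unfolding fs_def by (rule L2_cmult[OF gv])
  have fs_abs: "abs_l2 (fs n) = bvec n (\<lambda>g. 1) v" for n
    unfolding fs_def scaleR_abs_l2[OF gv, symmetric] by (simp add: bvec_def gvec_def)
  have "(fs n, hs n) \<in> lap0" for n
  proof -
    let ?g1 = "bvec n (\<lambda>g. 1) v1 - bvec n (\<lambda>g. 1 * snd g) v2" and ?g2 = "bvec n (\<lambda>g. 1 * fst g) v2"
    have "(bvec n (\<lambda>g. 1) v, ?g1) \<in> reg.D1" by (rule bvec_D1[OF v c(1)])
    moreover have "(?g1, a n) \<in> reg.D1"
      unfolding a_def
      using subspace_diff[OF reg.G1.subspace_gen bvec_D1[OF w(1,2) c(1)] bvec_D1[OF w(3,4) c(2)]] by simp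
    moreover have "(bvec n (\<lambda>g. 1) v, ?g2) \<in> reg.D2" by (rule bvec_D2[OF v(2) c(1)])
    moreover have "(?g2, b n) \<in> reg.D2" unfolding b_def by (rule bvec_D2[OF w(4) c(4)])
    ultimately have "(fs n, rep_l2 ?g1) \<in> DL 1" "(rep_l2 ?g1, rep_l2 (a n)) \<in> DL 1"
      "(fs n, rep_l2 ?g2) \<in> DL 2" "(rep_l2 ?g2, rep_l2 (b n)) \<in> DL 2"
      by (simp_all add: DL_lift lift_op_iff fsL2 fs_abs)
    moreover have "fs n \<in> garding" unfolding fs_def by (rule garding_scaled[OF bump_C0inf]) simp
    moreover have hsL2: "hs n \<in> L2" by (simp add: hs_def)
    moreover have "ae_eq (hs n) (\<lambda>p. - (rep_l2 (a n) p + rep_l2 (b n) p))"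
    proof -
      note s = neg_sum_abs_l2[OF rep_l2_L2 rep_l2_L2, of "a n" "b n"]
      have "abs_l2 (hs n) = abs_l2 (\<lambda>p. - (rep_l2 (a n) p + rep_l2 (b n) p))"
        unfolding s(1)[symmetric] by (simp add: hs_def)
      then show ?thesis using abs_l2_eq_iff[OF hsL2 s(2)] by blast
    qed
    ultimately show ?thesis unfolding lap0_def by blast
  qed
  moreover have "(\<lambda>n. abs_l2 (fs n)) \<longlonglongrightarrow> v" unfolding fs_abs using bvec_tendsto[OF c(1), of v] by simp
  moreover have "(\<lambda>n. abs_l2 (hs n)) \<longlonglongrightarrow> h"
  proof -
    \<comment> \<open>At \<open>(1, 0)\<close> the weights containing \<open>snd\<close> vanish and
      those in \<open>fst\<close> equal 1, so only \<open>v11\<close> and \<open>v22\<close>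
      survive.\<close>
    have "(\<lambda>n. - (a n + b n)) \<longlonglongrightarrow> - (((1 *\<^sub>R v11 - (1 * snd (1::real, 0::real)) *\<^sub>R v12)
        - ((1 * snd (1::real, 0::real)) *\<^sub>R v21 - (1 * snd (1::real, 0::real) * snd (1::real, 0::real)) *\<^sub>R v22))
        + (1 * fst (1::real, 0::real) * fst (1::real, 0::real)) *\<^sub>R v22)"
      unfolding a_def b_def by (intro tendsto_intros bvec_tendsto c)
    then show ?thesis by (simp add: hs_def h)
  qed
  ultimately show ?thesis by blast
qed

text \<open>One inclusion is the closedness of \<open>Lap\<close>, the other
  \<open>lap0_approximation\<close>; together they are essential self-adjointness on the Garding
  space.\<close>

lemma DeltaL_lift: "DeltaL = lift_op reg.Lap"
proof -
  have conv: "(\<lambda>n. nrm (\<lambda>p. fs n p - f p)) \<longlonglongrightarrow> 0 \<longleftrightarrow> (\<lambda>n. abs_l2 (fs n)) \<longlonglongrightarrow> abs_l2 f"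
    if "\<And>n. fs n \<in> L2" "f \<in> L2" for fs and f
  proof -
    have "nrm (\<lambda>p. fs n p - f p) = norm (abs_l2 (fs n) - abs_l2 f)" for n
      using that by (simp add: diff_abs_l2 norm_abs_l2 L2_diff)
    then show ?thesis by (simp add: tendsto_norm_zero_iff LIM_zero_iff)
  qed
  have L2: "f \<in> L2 \<and> h \<in> L2 \<and> (abs_l2 f, abs_l2 h) \<in> reg.Lap" if "(f, h) \<in> lap0" for f h
    using lap0_Lap that by (auto simp: lift_op_iff)
  show ?thesis
  proof (intro set_eqI iffI)
    fix p assume "p \<in> DeltaL"
    then obtain f h fs hs where p: "p = (f, h)" "f \<in> L2" "h \<in> L2" and l: "\<And>n. (fs n, hs n) \<in> lap0"
      and lim: "(\<lambda>n. nrm (\<lambda>p. fs n p - f p)) \<longlonglongrightarrow> 0" "(\<lambda>n. nrm (\<lambda>p. hs n p - h p)) \<longlonglongrightarrow> 0"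
      unfolding DeltaL_def opclosure_def by blast
    have "(\<lambda>n. abs_l2 (fs n)) \<longlonglongrightarrow> abs_l2 f" "(\<lambda>n. abs_l2 (hs n)) \<longlonglongrightarrow> abs_l2 h"
      using lim conv[of fs f] conv[of hs h] L2[OF l] p(2,3) by blast+
    then have "(\<lambda>n. (abs_l2 (fs n), abs_l2 (hs n))) \<longlonglongrightarrow> (abs_l2 f, abs_l2 h)" by (rule tendsto_Pair)
    then have "(abs_l2 f, abs_l2 h) \<in> reg.Lap"
      using closed_sequentially[OF reg.closed_Lap, of "\<lambda>n. (abs_l2 (fs n), abs_l2 (hs n))"] L2[OF l] by blast
    then show "p \<in> lift_op reg.Lap" using p by (simp add: lift_op_iff)
  next
    fix p assume "p \<in> lift_op reg.Lap"
    then obtain f h where p: "p = (f, h)" "f \<in> L2" "h \<in> L2" "(abs_l2 f, abs_l2 h) \<in> reg.Lap"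
      by (auto simp: lift_op_def)
    obtain fs hs where l: "\<And>n. (fs n, hs n) \<in> lap0" "(\<lambda>n. abs_l2 (fs n)) \<longlonglongrightarrow> abs_l2 f"
      "(\<lambda>n. abs_l2 (hs n)) \<longlonglongrightarrow> abs_l2 h" using lap0_approximation[OF p(4)] by blast
    have "(\<lambda>n. nrm (\<lambda>p. fs n p - f p)) \<longlonglongrightarrow> 0" "(\<lambda>n. nrm (\<lambda>p. hs n p - h p)) \<longlonglongrightarrow> 0"
      using l(2,3) conv[of fs f] conv[of hs h] L2[OF l(1)] p(2,3) by blast+
    then show "p \<in> DeltaL" unfolding DeltaL_def opclosure_def p(1) using p(2,3) l(1) by blast
  qed
qed

section \<open>The square root of the Laplacian\<close>

lift_definition mul_i :: "l2 \<Rightarrow> l2" is "\<lambda>f p. \<i> * f p"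
  by (auto simp: l2rel_def ae_eq_def intro: L2_cmult elim!: AE_mp)

lemma mul_i_abs: "f \<in> L2 \<Longrightarrow> mul_i (abs_l2 f) = abs_l2 (\<lambda>p. \<i> * f p)"
  by (simp add: mul_i.abs_eq l2rel_refl)

lemma inner_L2_mul_i:
  assumes "f \<in> L2" "g \<in> L2"
  shows "inner_L2 (\<lambda>p. \<i> * f p) g = \<i> * inner_L2 f g" "inner_L2 f (\<lambda>p. \<i> * g p) = - \<i> * inner_L2 f g"
  unfolding inner_L2_def by (simp_all add: mult.assoc mult.left_commute flip: Bochner_Integration.integral_mult_right_zero)

text \<open>Multiplication by \<open>\<i>\<close> turns the imaginary part into a real part, so a
  complex equality becomes two real ones.\<close>

lemma inner_L2_eq_iff:
  assumes "f \<in> L2" "g \<in> L2" "f' \<in> L2" "g' \<in> L2"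
  shows "inner_L2 f g = inner_L2 f' g' \<longleftrightarrow>
    inner (abs_l2 f) (abs_l2 g) = inner (abs_l2 f') (abs_l2 g') \<and>
    inner (mul_i (abs_l2 f)) (abs_l2 g) = inner (mul_i (abs_l2 f')) (abs_l2 g')"
  using assms by (simp add: mul_i_abs inner_abs_l2 L2_cmult inner_L2_mul_i complex_eq_iff)

lemma Im_inner_L2: "f \<in> L2 \<Longrightarrow> g \<in> L2 \<Longrightarrow> Im (inner_L2 f g) = - inner (mul_i (abs_l2 f)) (abs_l2 g)"
  by (simp add: mul_i_abs inner_abs_l2 L2_cmult inner_L2_mul_i)

lemma mul_i_skew: "inner (mul_i x) y = - inner x (mul_i y)"
proof -
  obtain f g where "f \<in> L2" "x = abs_l2 f" "g \<in> L2" "y = abs_l2 g" by (metis l2_cases)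
  then show ?thesis by (simp add: mul_i_abs inner_abs_l2 L2_cmult inner_L2_mul_i)
qed

lemma bounded_linear_mul_i: "bounded_linear mul_i"
proof (rule bounded_linear_intro[of _ 1])
  show "mul_i (x + y) = mul_i x + mul_i y" for x y
    by transfer (auto simp: l2rel_refl distrib_left intro!: L2_add L2_cmult)
  show "mul_i (r *\<^sub>R x) = r *\<^sub>R mul_i x" for r x
    by transfer (auto simp: l2rel_refl mult.left_commute intro!: L2_cmult)
  show "norm (mul_i x) \<le> norm x * 1" for x
  proof -
    obtain f where "f \<in> L2" "x = abs_l2 f" by (metis l2_cases)
    then show ?thesis by (simp add: mul_i_abs norm_abs_l2 L2_cmult nrm_def norm_mult)
  qed
qed

lemma sqrt_graph_mul_i:
  assumes "(f, g) \<in> reg.sqrt_graph"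
  shows "(mul_i f, mul_i g) \<in> reg.sqrt_graph"
proof (rule reg.sqrt_graph_skew_commute[OF bounded_linear_mul_i mul_i_skew _ _ assms])
  show "mul_i (u1 t x) = u1 t (mul_i x)" for t x
  proof -
    obtain f where "f \<in> L2" "x = abs_l2 f" by (metis l2_cases)
    then show ?thesis by (simp add: mul_i_abs u1_abs L2_UL1 L2_cmult) (simp add: UL1_aff[abs_def])
  qed
  show "mul_i (u2 t x) = u2 t (mul_i x)" for t x
  proof -
    obtain f where "f \<in> L2" "x = abs_l2 f" by (metis l2_cases)
    then show ?thesis by (simp add: mul_i_abs u2_abs L2_UL2 L2_cmult) (simp add: UL2_aff[abs_def])
  qed
qed

lemma adjoint_lift_iff:
  "(u, v) \<in> adjoint (lift_op X) \<longleftrightarrow> u \<in> L2 \<and> v \<in> L2 \<and> (\<forall>(x, y)\<in>X.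
    inner y (abs_l2 u) = inner x (abs_l2 v) \<and> inner (mul_i y) (abs_l2 u) = inner (mul_i x) (abs_l2 v))"
proof (cases "u \<in> L2 \<and> v \<in> L2")
  case True
  have "(\<forall>(f, g)\<in>lift_op X. inner_L2 g u = inner_L2 f v) \<longleftrightarrow> (\<forall>(x, y)\<in>X.
    inner y (abs_l2 u) = inner x (abs_l2 v) \<and> inner (mul_i y) (abs_l2 u) = inner (mul_i x) (abs_l2 v))"
  proof (intro iffI ballI; safe)
    fix x y assume *: "\<forall>(f, g)\<in>lift_op X. inner_L2 g u = inner_L2 f v" and "(x, y) \<in> X"
    then have "inner_L2 (rep_l2 y) u = inner_L2 (rep_l2 x) v" using rep_lift_op by blast
    then show "inner y (abs_l2 u) = inner x (abs_l2 v)" "inner (mul_i y) (abs_l2 u) = inner (mul_i x) (abs_l2 v)"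
      using True inner_L2_eq_iff[of "rep_l2 y" u "rep_l2 x" v] by auto
  next
    fix f g assume *: "\<forall>(x, y)\<in>X. inner y (abs_l2 u) = inner x (abs_l2 v) \<and> inner (mul_i y) (abs_l2 u) = inner (mul_i x) (abs_l2 v)"
      and fg: "(f, g) \<in> lift_op X"
    then have "f \<in> L2" "g \<in> L2" "(abs_l2 f, abs_l2 g) \<in> X" by (simp_all add: lift_op_iff)
    then show "inner_L2 g u = inner_L2 f v" using True * inner_L2_eq_iff[of g u f v] by blast
  qed
  then show ?thesis using True by (simp add: adjoint_def)
qed (auto simp: adjoint_def)

lemma selfadjoint_sqrt: "selfadjoint (lift_op reg.sqrt_graph)"
  unfolding selfadjoint_def
proof
  show "lift_op reg.sqrt_graph = adjoint (lift_op reg.sqrt_graph)"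
  proof (intro set_eqI iffI; clarify)
    fix u v assume "(u, v) \<in> lift_op reg.sqrt_graph"
    then show "(u, v) \<in> adjoint (lift_op reg.sqrt_graph)"
      unfolding adjoint_lift_iff lift_op_iff
      using reg.sqrt_graph_symmetric sqrt_graph_mul_i by blast
  next
    fix u v assume "(u, v) \<in> adjoint (lift_op reg.sqrt_graph)"
    then show "(u, v) \<in> lift_op reg.sqrt_graph"
      unfolding adjoint_lift_iff lift_op_iff using reg.sqrt_graph_selfadjoint by blast
  qed
  show "\<forall>f g g'. (f, g) \<in> lift_op reg.sqrt_graph \<longrightarrow> (f, g') \<in> lift_op reg.sqrt_graph \<longrightarrow> ae_eq g g'"
    using reg.sqrt_graph_unique_value abs_l2_eq_iff unfolding lift_op_iff by blast
qed

lemma nonneg_sqrt: "nonneg (lift_op reg.sqrt_graph)"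
proof -
  have "Im (inner_L2 g f) = 0 \<and> 0 \<le> Re (inner_L2 g f)" if "(f, g) \<in> lift_op reg.sqrt_graph" for f g
  proof -
    have fg: "f \<in> L2" "g \<in> L2" "(abs_l2 f, abs_l2 g) \<in> reg.sqrt_graph" using that by (simp_all add: lift_op_iff)
    \<comment> \<open>Symmetry of the root combined with skewness of \<open>mul_i\<close> makes this
      number equal to its own negative.\<close>
    have "inner (mul_i (abs_l2 g)) (abs_l2 f) = inner (mul_i (abs_l2 f)) (abs_l2 g)"
      using reg.sqrt_graph_symmetric[OF sqrt_graph_mul_i[OF fg(3)] fg(3)] .
    also have "\<dots> = - inner (mul_i (abs_l2 g)) (abs_l2 f)" by (metis mul_i_skew inner_commute)
    finally have "Im (inner_L2 g f) = 0" using fg by (simp add: Im_inner_L2)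
    moreover have "0 \<le> Re (inner_L2 g f)"
      using reg.sqrt_graph_nonneg[OF fg(3)] fg by (simp add: inner_abs_l2)
    ultimately show ?thesis ..
  qed
  then show ?thesis unfolding nonneg_def by blast
qed

text \<open>An adjoint is saturated under equality almost everywhere, so a relation equal to its
  adjoint descends to the quotient.\<close>

lemma selfadjoint_lift:
  assumes "T = adjoint T"
  obtains X where "T = lift_op X"
proof -
  let ?X = "(\<lambda>(f, g). (abs_l2 f, abs_l2 g)) ` T"
  have sub: "f \<in> L2 \<and> g \<in> L2" if "(f, g) \<in> T" for f g
    using that by (subst (asm) assms) (simp add: adjoint_def)
  have "T = lift_op ?X"
  proof (intro set_eqI iffI; clarify)
    fix f g assume "(f, g) \<in> T"
    then show "(f, g) \<in> lift_op ?X" using sub by (force simp: lift_op_iff)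
  next
    fix f g assume "(f, g) \<in> lift_op ?X"
    then obtain f' g' where fg: "f \<in> L2" "g \<in> L2" "(f', g') \<in> T" "abs_l2 f = abs_l2 f'" "abs_l2 g = abs_l2 g'"
      by (auto simp: lift_op_iff)
    then have eq: "ae_eq f f'" "ae_eq g g'" using abs_l2_eq_iff sub by blast+
    have "inner_L2 b f = inner_L2 a g" if ab: "(a, b) \<in> T" for a b
    proof -
      have "(f', g') \<in> adjoint T" using fg(3) assms by simp
      then have "inner_L2 b f' = inner_L2 a g'" using ab by (auto simp: adjoint_def)
      moreover have "inner_L2 b f = inner_L2 b f'" "inner_L2 a g = inner_L2 a g'"
        using sub[OF ab] sub[OF fg(3)] fg eq ae_eq_refl by (auto intro!: inner_L2_ae_eq)
      ultimately show ?thesis by simp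
    qed
    then have "(f, g) \<in> adjoint T" using fg by (auto simp: adjoint_def)
    then show "(f, g) \<in> T" using assms by simp
  qed
  then show ?thesis by (rule that)
qed

text \<open>The competitor is an arbitrary relation. That it is a closed subspace is read off its
  equality with its adjoint, whose defining conditions are linear and closed in the pair; then
  \<open>sqrt_graph_unique\<close> applies.\<close>

lemma opsqrt_unique:
  assumes T: "selfadjoint T" "nonneg T" "opcomp T T = lift_op reg.Lap"
  shows "T = lift_op reg.sqrt_graph"
proof -
  have adj: "T = adjoint T" using T(1) by (simp add: selfadjoint_def)
  obtain X where X: "T = lift_op X" using adj by (rule selfadjoint_lift)
  have X_iff: "(u, v) \<in> X \<longleftrightarrow> (\<forall>(x, y)\<in>X. inner y u = inner x v \<and> inner (mul_i y) u = inner (mul_i x) v)" for u v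
    using adj rep_lift_op[of u v X] adjoint_lift_iff[of "rep_l2 u" "rep_l2 v" X] by (simp add: X)
  have "X = reg.sqrt_graph"
  proof (rule reg.sqrt_graph_unique)
    show "subspace X"
    proof (rule subspaceI)
      show "0 \<in> X" by (auto simp: zero_prod_def X_iff[of 0 0])
      show "p + q \<in> X" if pq: "p \<in> X" "q \<in> X" for p q
      proof -
        obtain a b a' b' where e: "p = (a, b)" "q = (a', b')" by (cases p, cases q) blast
        have "inner y (a + a') = inner x (b + b') \<and> inner (mul_i y) (a + a') = inner (mul_i x) (b + b')"
          if xy: "(x, y) \<in> X" for x y
        proof -
          have "inner y a = inner x b \<and> inner (mul_i y) a = inner (mul_i x) b"
            using X_iff[of a b] pq(1) xy unfolding e by blast
          moreover have "inner y a' = inner x b' \<and> inner (mul_i y) a' = inner (mul_i x) b'"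
            using X_iff[of a' b'] pq(2) xy unfolding e by blast
          ultimately show ?thesis by (simp add: inner_add_right)
        qed
        then have "(a + a', b + b') \<in> X" unfolding X_iff[of "a + a'"] by blast
        then show ?thesis by (simp add: e)
      qed
      show "c *\<^sub>R p \<in> X" if p: "p \<in> X" for c p
      proof -
        obtain a b where e: "p = (a, b)" by (cases p)
        have "inner y (c *\<^sub>R a) = inner x (c *\<^sub>R b) \<and> inner (mul_i y) (c *\<^sub>R a) = inner (mul_i x) (c *\<^sub>R b)"
          if xy: "(x, y) \<in> X" for x y
        proof -
          have "inner y a = inner x b \<and> inner (mul_i y) a = inner (mul_i x) b"
            using X_iff[of a b] p xy unfolding e by blast
          then show ?thesis by simp
        qed
        then have "(c *\<^sub>R a, c *\<^sub>R b) \<in> X" unfolding X_iff[of "c *\<^sub>R a"] by blast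
        then show ?thesis by (simp add: e)
      qed
    qed
    show "closed X"
    proof -
      have "X = (\<Inter>p\<in>X. {q. inner (snd p) (fst q) = inner (fst p) (snd q)} \<inter>
          {q. inner (mul_i (snd p)) (fst q) = inner (mul_i (fst p)) (snd q)})"
      proof (rule set_eqI)
        fix q
        show "q \<in> X \<longleftrightarrow> q \<in> (\<Inter>p\<in>X. {q. inner (snd p) (fst q) = inner (fst p) (snd q)} \<inter>
          {q. inner (mul_i (snd p)) (fst q) = inner (mul_i (fst p)) (snd q)})"
          using X_iff[of "fst q" "snd q"] by (simp add: split_beta)
      qed
      moreover have "closed (\<Inter>p\<in>X. {q. inner (snd p) (fst q) = inner (fst p) (snd q)} \<inter>
          {q. inner (mul_i (snd p)) (fst q) = inner (mul_i (fst p)) (snd q)})"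
        by (intro closed_INT ballI closed_Int closed_Collect_eq continuous_intros)
      ultimately show ?thesis by simp
    qed
    show "inner g u = inner f v" if "(f, g) \<in> X" "(u, v) \<in> X" for f g u v
      using that X_iff[of u v] by blast
    show "0 \<le> inner g f" if "(f, g) \<in> X" for f g
    proof -
      have "(rep_l2 f, rep_l2 g) \<in> T" using that by (simp add: X rep_lift_op)
      then have "0 \<le> Re (inner_L2 (rep_l2 g) (rep_l2 f))" using T(2) by (auto simp: nonneg_def)
      then show ?thesis using inner_abs_l2[of "rep_l2 g" "rep_l2 f"] by simp
    qed
    have "lift_op (X O X) = lift_op reg.Lap" using T(3) by (simp add: X opcomp_lift)
    then show "X O X = reg.op_graph" using lift_op_inject reg.op_graph_Lap by simp
  qed
  then show ?thesis using X by simp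
qed

lemma opsqrt_DeltaL: "opsqrt DeltaL = lift_op reg.sqrt_graph"
  unfolding opsqrt_def
proof (rule the_equality)
  have "opcomp (lift_op reg.sqrt_graph) (lift_op reg.sqrt_graph) = DeltaL"
    by (simp add: opcomp_lift reg.sqrt_graph_square reg.op_graph_Lap DeltaL_lift)
  then show "selfadjoint (lift_op reg.sqrt_graph) \<and> nonneg (lift_op reg.sqrt_graph) \<and>
      opcomp (lift_op reg.sqrt_graph) (lift_op reg.sqrt_graph) = DeltaL"
    using selfadjoint_sqrt nonneg_sqrt by blast
  show "T = lift_op reg.sqrt_graph" if "selfadjoint T \<and> nonneg T \<and> opcomp T T = DeltaL" for T
    using that opsqrt_unique by (simp add: DeltaL_lift)
qed

lemma halfpow_lift: "halfpow m DeltaL = lift_op (reg.sqrt_graph ^^ m)"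
  by (simp add: halfpow_def opsqrt_DeltaL oppow_lift)

section \<open>Comparison of the two norms\<close>

lemma relpow_unique_value:
  fixes R :: "('a \<times> 'a) set"
  assumes "\<And>x y y'. (x, y) \<in> R \<Longrightarrow> (x, y') \<in> R \<Longrightarrow> y = y'"
  shows "(x, y) \<in> R ^^ m \<Longrightarrow> (x, y') \<in> R ^^ m \<Longrightarrow> y = y'"
proof (induction m arbitrary: y y')
  case (Suc m)
  then obtain z z' where "(x, z) \<in> R ^^ m" "(z, y) \<in> R" "(x, z') \<in> R ^^ m" "(z', y') \<in> R" by auto
  then show ?case using Suc.IH assms by blast
qed simp

lemma graph_norm_eq:
  assumes "f \<in> L2" "(abs_l2 f, y) \<in> reg.sqrt_graph ^^ m"
  shows "graph_norm m f = norm (abs_l2 f) + norm y"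
proof -
  have "nrm (opapp (halfpow m DeltaL) f) = norm y"
    unfolding halfpow_lift using assms
    by (rule nrm_opapp_lift) (use assms(2) relpow_unique_value[of reg.sqrt_graph] reg.sqrt_graph_unique_value in blast)
  then show ?thesis using assms(1) by (simp add: graph_norm_def norm_abs_l2)
qed

lemma W2norm_top_eq:
  assumes "f \<in> L2" "abs_l2 f \<in> reg.Sob m"
  shows "W2norm_top m f = norm (abs_l2 f) + (\<Sum>js\<in>reg.words m. norm (reg.wd js (abs_l2 f)))"
proof -
  have "nrm (opapp (iterD js) f) = norm (reg.wd js (abs_l2 f))" if "js \<in> reg.words m" for js
  proof -
    have "abs_l2 f \<in> Domain (reg.word js)" using reg.Sob_imp_word[of "abs_l2 f" js] assms(2) that by auto
    then obtain y where y: "(abs_l2 f, y) \<in> reg.word js" by blast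
    have "nrm (opapp (iterD js) f) = norm y"
      unfolding iterD_lift using assms(1) y by (rule nrm_opapp_lift) (use y reg.word_wd in blast)
    then show ?thesis using reg.word_wd[OF y] by simp
  qed
  then have "(\<Sum>js\<in>reg.words m. nrm (opapp (iterD js) f)) = (\<Sum>js\<in>reg.words m. norm (reg.wd js (abs_l2 f)))"
    by (rule sum.cong[OF refl])
  then show ?thesis using assms(1) by (simp add: W2norm_top_def norm_abs_l2)
qed

theorem mainTheorem14:
  fixes m :: nat
  shows "W2 m = opdom (halfpow m DeltaL) \<and>
    (\<exists>C1 C2. 0 < C1 \<and> 0 < C2 \<and>
       (\<forall>f \<in> W2 m. W2norm_top m f \<le> C1 * graph_norm m f \<and>
                    graph_norm m f \<le> C2 * W2norm_top m f))"
proof -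
  obtain A B where dom: "Domain (reg.sqrt_graph ^^ m) = reg.Sob m"
    and A: "0 \<le> A" "\<And>x y. (x, y) \<in> reg.sqrt_graph ^^ m \<Longrightarrow> reg.snorm m x \<le> A * (norm x + norm y)"
    and B: "0 \<le> B" "\<And>x y. (x, y) \<in> reg.sqrt_graph ^^ m \<Longrightarrow> norm y \<le> B * (\<Sum>js\<in>reg.words m. norm (reg.wd js x))"
    using reg.sqrt_power_Sobolev[of m] by blast
  define K where "K = real (card (reg.words m))"
  \<comment> \<open>Each of the \<open>K\<close> words is bounded by \<open>reg.snorm m\<close>,
    hence by \<open>A\<close> times the graph norm; the 1 in either constant accounts for the norm
    of \<open>f\<close>.\<close>
  have "W2norm_top m f \<le> (1 + K * A) * graph_norm m f \<and> graph_norm m f \<le> (1 + B) * W2norm_top m f"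
    if "f \<in> W2 m" for f
  proof -
    have f: "f \<in> L2" "abs_l2 f \<in> reg.Sob m" using that by (simp_all add: W2_Sob)
    define x where "x = abs_l2 f"
    obtain y where y: "(x, y) \<in> reg.sqrt_graph ^^ m" using f dom unfolding x_def by blast
    have g: "graph_norm m f = norm x + norm y" using graph_norm_eq[OF f(1)] y unfolding x_def by blast
    define S where "S = (\<Sum>js\<in>reg.words m. norm (reg.wd js x))"
    have w: "W2norm_top m f = norm x + S" using W2norm_top_eq[OF f] unfolding x_def S_def .
    have "S \<le> K * (A * (norm x + norm y))"
      unfolding S_def K_def
    proof (rule sum_bounded_above)
      fix js assume "js \<in> reg.words m"
      then have "norm (reg.wd js x) \<le> reg.snorm m x" using reg.norm_wd_le by blast
      also have "\<dots> \<le> A * (norm x + norm y)" by (rule A(2)[OF y])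
      finally show "norm (reg.wd js x) \<le> A * (norm x + norm y)" .
    qed
    then have "norm x + S \<le> (norm x + norm y) + K * A * (norm x + norm y)"
      unfolding mult.assoc using norm_ge_zero[of y] by linarith
    moreover have "norm y \<le> B * S" using B(2)[OF y] unfolding S_def .
    moreover have "0 \<le> B * norm x" using B(1) by simp
    moreover have "0 \<le> S" unfolding S_def by (intro sum_nonneg norm_ge_zero)
    ultimately show ?thesis unfolding g w by (simp add: algebra_simps)
  qed
  moreover have "0 < 1 + K * A" "0 < 1 + B" using A(1) B(1) by (simp_all add: K_def add_pos_nonneg)
  moreover have "W2 m = opdom (halfpow m DeltaL)"
    by (simp add: halfpow_lift opdom_lift dom W2_Sob)
  ultimately show ?thesis by blast
qed

end
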